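(* Let $R$ be a non-zero commutative ring with identity and let $\Delta\sim\mathcal{U}(n)$, where $n$ is even. Then with high probability, $H_{n/2-1}(\Delta,R)$ has rank at least $(1+o(1))\frac{2^{(n-1)/2}}{\sqrt{\pi n}}$. That is, there is a function $\delta(n)\to 0$ such that the probability that $H_{n/2-1}(\Delta,R)$ has rank at least $(1-\delta(n))\frac{2^{(n-1)/2}}{\sqrt{\pi n}}$ tends to $1$ as $n\to\infty$ through even integers.
   Context: A simplicial complex on $n$ vertices is a collection $\Delta$ of non-empty subsets (faces) of $[n]=\{1,\dots,n\}$ such that if $x\in\Delta$ and $\emptyset\neq y\subseteq x$ then $y\in\Delta$. $\mathcal{U}(n)$ is the uniform probability distribution on the set of all simplicial complexes on $n$ vertices. $H_k(\Delta,R)$ is the $k$-th simplicial homology of $\Delta$ with coefficients in $R$, indexed by dimension, so that $k$-chains are combinations of faces of size $k+1$. The rank of an $R$-module is the maximal cardinality of an $R$-linearly independent subset (the dimension, when $R$ is a field). *)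

theory Defs
  imports "HOL-Probability.Probability" "HOL-Algebra.Module" "HOL-Algebra.AbelCoset"
begin

section \<open>Random simplicial complexes\<close>

text \<open>The vertices in \<open>{1..n}\<close> need not be faces, and the empty collection is a complex.\<close>

definition simplicial_complexes :: "nat \<Rightarrow> nat set set set" where
  "simplicial_complexes n =
     {\<Delta>. \<Delta> \<subseteq> Pow {1..n} \<and> {} \<notin> \<Delta> \<and> (\<forall>x\<in>\<Delta>. \<forall>y. y \<noteq> {} \<and> y \<subseteq> x \<longrightarrow> y \<in> \<Delta>)}"

definition uniform_complex :: "nat \<Rightarrow> nat set set pmf" where
  "uniform_complex n = pmf_of_set (simplicial_complexes n)"

lemma finite_simplicial_complexes: "finite (simplicial_complexes n)"
  by (rule finite_subset[of _ "Pow (Pow {1..n})"]) (auto simp: simplicial_complexes_def)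

lemma simplicial_complexes_nonempty: "simplicial_complexes n \<noteq> {}"
proof -
  have "{} \<in> simplicial_complexes n" by (simp add: simplicial_complexes_def)
  then show ?thesis by blast
qed

lemma set_pmf_uniform_complex: "set_pmf (uniform_complex n) = simplicial_complexes n"
  unfolding uniform_complex_def
  by (rule set_pmf_of_set[OF simplicial_complexes_nonempty finite_simplicial_complexes])

section \<open>Quotients and rank of modules\<close>

text \<open>As usual for \<open>module\<close> records, the multiplicative fields inherited from \<open>ring\<close> are unused.\<close>

definition quotient_module ::
  "('a, 'b, 'm) module_scheme \<Rightarrow> 'b set \<Rightarrow> ('a, 'b set) module" where
  "quotient_module M N =
     \<lparr>carrier = a_rcosets\<^bsub>M\<^esub> N, mult = undefined, one = undefined,
      zero = N, add = (<+>\<^bsub>M\<^esub>), smult = (\<lambda>r X. \<Union>x\<in>X. N +>\<^bsub>M\<^esub> (r \<odot>\<^bsub>M\<^esub> x))\<rparr>"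

definition lin_indep ::
  "('a, 'r) ring_scheme \<Rightarrow> ('a, 'b, 'm) module_scheme \<Rightarrow> 'b set \<Rightarrow> bool" where
  "lin_indep R M S \<longleftrightarrow> S \<subseteq> carrier M \<and>
     (\<forall>T a. finite T \<and> T \<subseteq> S \<and> a \<in> T \<rightarrow> carrier R \<and>
            (\<Oplus>\<^bsub>M\<^esub>x\<in>T. a x \<odot>\<^bsub>M\<^esub> x) = \<zero>\<^bsub>M\<^esub> \<longrightarrow> (\<forall>x\<in>T. a x = \<zero>\<^bsub>R\<^esub>))"

text \<open>Subsets of independent sets are independent, so it suffices to take the supremum over
  finite sets; the value is \<open>\<infinity>\<close> iff the cardinalities of these are unbounded.\<close>

definition module_rank ::
  "('a, 'r) ring_scheme \<Rightarrow> ('a, 'b, 'm) module_scheme \<Rightarrow> enat" where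
  "module_rank R M = (SUP S\<in>{S. finite S \<and> lin_indep R M S}. enat (card S))"

section \<open>Simplicial homology\<close>

definition faces :: "nat set set \<Rightarrow> nat \<Rightarrow> nat set set" where
  "faces \<Delta> k = {\<sigma>\<in>\<Delta>. card \<sigma> = Suc k}"

text \<open>A \<open>k\<close>-chain is its coefficient function, extended by zero outside the \<open>k\<close>-faces.\<close>

definition chain_module ::
  "('a, 'r) ring_scheme \<Rightarrow> nat set set \<Rightarrow> nat \<Rightarrow> ('a, nat set \<Rightarrow> 'a) module" where
  "chain_module R \<Delta> k =
     \<lparr>carrier = {c. range c \<subseteq> carrier R \<and> (\<forall>\<sigma>. \<sigma> \<notin> faces \<Delta> k \<longrightarrow> c \<sigma> = \<zero>\<^bsub>R\<^esub>)},
      mult = undefined, one = undefined,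
      zero = (\<lambda>\<sigma>. \<zero>\<^bsub>R\<^esub>), add = (\<lambda>c d \<sigma>. c \<sigma> \<oplus>\<^bsub>R\<^esub> d \<sigma>),
      smult = (\<lambda>r c \<sigma>. r \<otimes>\<^bsub>R\<^esub> c \<sigma>)\<rparr>"

text \<open>The linear extension of \<open>[v\<^sub>0, \<dots>, v\<^sub>k] \<mapsto> (\<Sum>i\<le>k. (-1)^i [v\<^sub>0, \<dots>, v\<^sub>i\<^sub>-\<^sub>1, v\<^sub>i\<^sub>+\<^sub>1, \<dots>, v\<^sub>k])\<close> where
  \<open>v\<^sub>0 < \<dots> < v\<^sub>k\<close>, read off at the coefficient of \<open>\<tau>\<close>. The empty set is not a face, so the
  boundary vanishes on 0-chains and homology is not reduced.\<close>

definition boundary_map ::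
  "('a, 'r) ring_scheme \<Rightarrow> nat set set \<Rightarrow> nat \<Rightarrow> (nat set \<Rightarrow> 'a) \<Rightarrow> (nat set \<Rightarrow> 'a)" where
  "boundary_map R \<Delta> k c =
     (if k = 0 then (\<lambda>\<tau>. \<zero>\<^bsub>R\<^esub>)
      else (\<lambda>\<tau>. \<Oplus>\<^bsub>R\<^esub>\<sigma>\<in>faces \<Delta> k. \<Oplus>\<^bsub>R\<^esub>v\<in>{v\<in>\<sigma>. \<sigma> - {v} = \<tau>}.
                (\<ominus>\<^bsub>R\<^esub> \<one>\<^bsub>R\<^esub>) [^]\<^bsub>R\<^esub> card {u\<in>\<sigma>. u < v} \<otimes>\<^bsub>R\<^esub> c \<sigma>))"

definition cycles ::
  "('a, 'r) ring_scheme \<Rightarrow> nat set set \<Rightarrow> nat \<Rightarrow> (nat set \<Rightarrow> 'a) set" where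
  "cycles R \<Delta> k = {c \<in> carrier (chain_module R \<Delta> k). boundary_map R \<Delta> k c = (\<lambda>\<tau>. \<zero>\<^bsub>R\<^esub>)}"

definition boundaries ::
  "('a, 'r) ring_scheme \<Rightarrow> nat set set \<Rightarrow> nat \<Rightarrow> (nat set \<Rightarrow> 'a) set" where
  "boundaries R \<Delta> k =
     boundary_map R \<Delta> (Suc k) ` carrier (chain_module R \<Delta> (Suc k))"

definition homology ::
  "('a, 'r) ring_scheme \<Rightarrow> nat set set \<Rightarrow> nat \<Rightarrow> ('a, (nat set \<Rightarrow> 'a) set) module" where
  "homology R \<Delta> k =
     quotient_module ((chain_module R \<Delta> k)\<lparr>carrier := cycles R \<Delta> k\<rparr>) (boundaries R \<Delta> k)"

end

theory Submission
  imports Defs "HOL-Real_Asymp.Real_Asymp"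
begin

text \<open>Write \<open>n = 2 m\<close>. Condition on all faces of \<open>\<Delta>\<close> outside the middle layer of \<open>m\<close>-sets. An
  \<open>m\<close>-set that lies in no face of size \<open>m + 1\<close> and contains no missing \<open>(m - 1)\<close>-set is then a face
  with probability \<open>1/2\<close>, independently of the others. As long as there are only \<open>o(2^n / m^3)\<close> faces
  of size \<open>m + 1\<close> and missing \<open>(m - 1)\<close>-sets, almost every \<open>(m + 1)\<close>-set has only such free facets,
  so that its boundary is contained in \<open>\<Delta>\<close> with probability \<open>2^-(m + 1)\<close>. By the second moment method
  this happens for about \<open>(n choose m + 1) 2^-(m + 1)\<close> sets, almost all of which share no facet with
  another one. Their boundaries are cycles that are independent modulo the boundaries of chains, since
  each one owns a facet which lies in no face of size \<open>m + 1\<close>.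

  It remains to see that there are few faces of size \<open>m + 1\<close>; complementation then deals with the
  missing \<open>(m - 1)\<close>-sets. A prescribed family \<open>F\<close> of \<open>(m + 1)\<close>-sets forces its shadow into \<open>\<Delta>\<close> and
  so costs a factor \<open>2^-|shadow F|\<close>. These weights are summed over all large \<open>F\<close> by a container
  argument in the style of Sapozhenko, whose geometric input is that a family is at most
  \<open>m / (m + 1)\<close> times as large as its shadow and that two sets have at most one common facet. The layers above are treated recursively.\<close>

section \<open>Containers in biregular bipartite graphs\<close>

text \<open>The number of complexes is never estimated: rare complexes are compared with all
  complexes through injections, so that only ratios of counts occur. For the families above the
  middle, let \<open>A\<close> be the largest family whose shadow lies in \<open>G\<close>, and put
  \<open>\<delta> = card G - card A\<close>. The \<open>2 ^ card A\<close> subfamilies of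
  \<open>A\<close> weigh \<open>2 powr - \<delta>\<close> together if each is charged
  \<open>2 powr - card G\<close>, so a union bound works as soon as the possible \<open>A\<close>
  can be listed at a cost below \<open>\<delta>\<close> bits. Expansion guarantees only
  \<open>card G \<le> k * \<delta>\<close>; hence \<open>G\<close> must not be described point by
  point, while lists of \<open>o(\<delta> / log m)\<close> points are affordable, a point costing
  \<open>O(log m)\<close> bits. Where no such description is found, there is still a set
  \<open>S\<close> containing \<open>A\<close> with \<open>card S\<close> well below
  \<open>card G\<close>, and \<open>S\<close> plays the role of \<open>A\<close> in the bound. The
  scale of the result comes from \<open>(n choose m + 1) / 2 ^ (m + 1)\<close>, which is asymptotic
  to \<open>2 powr ((n - 1) / 2) / sqrt (pi * n)\<close>. Signs are units in every ring, which is
  why the coefficients may be arbitrary.\<close>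

text \<open>A greedy choice in disguise: \<open>T\<close> is a largest set on which \<open>w\<close>
  has grown by at least \<open>r\<close> per element. For positive \<open>r\<close> it has at most
  \<open>w T / r\<close> elements, and no further point raises \<open>w\<close> by \<open>r\<close>.
  The short lists \<open>T\<close>, \<open>X\<close> and \<open>W\<close> that describe a closed
  family all arise in this way.\<close>

lemma maximal_growth_set:
  fixes w :: "'a set \<Rightarrow> real"
  assumes "finite P" "0 \<le> w {}"
  obtains T where "T \<subseteq> P" "r * real (card T) \<le> w T"
    "\<And>v. v \<in> P \<Longrightarrow> v \<notin> T \<Longrightarrow> w (insert v T) < r * (real (card T) + 1)"
proof -
  let ?F = "{T. T \<subseteq> P \<and> r * real (card T) \<le> w T}"
  have fin: "finite ?F" using assms(1) by simp
  have "{} \<in> ?F" using assms(2) by simp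
  then have "Max (card ` ?F) \<in> card ` ?F" using fin by (intro Max_in) auto
  then obtain T where T: "T \<in> ?F" "card T = Max (card ` ?F)" by auto
  have "w (insert v T) < r * (real (card T) + 1)" if "v \<in> P" "v \<notin> T" for v
  proof (rule ccontr)
    assume neg: "\<not> ?thesis"
    have "finite T" using T(1) assms(1) finite_subset by auto
    then have c: "card (insert v T) = Suc (card T)" using that by simp
    have "insert v T \<in> ?F" using neg T(1) that c by (auto simp: algebra_simps)
    then have "card (insert v T) \<le> Max (card ` ?F)" using fin by simp
    then show False using c T(2) by simp
  qed
  then show ?thesis using T(1) that by blast
qed

lemma sum_Pow_power_card:
  fixes x :: real
  assumes "finite P"
  shows "(\<Sum>K\<in>Pow P. x ^ card K) = (1 + x) ^ card P"
  using prod_add[OF assms, of "\<lambda>_. x" "\<lambda>_. 1"] by (simp add: add.commute)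

lemma one_plus_power_le_exp: "0 \<le> (x::real) \<Longrightarrow> (1 + x) ^ n \<le> exp (x * real n)"
  using power_mono[OF exp_ge_add_one_self[of x], of n]
  by (simp add: exp_of_nat2_mult)

text \<open>Modelled on two consecutive layers of the cube at or above its middle:
  \<open>D u\<close> is the set of facets of \<open>u\<close>. The condition \<open>degrees\<close>
  drives the expansion, and \<open>codegree\<close> says that the incidence graph has no
  4-cycle.\<close>

locale biregular =
  fixes U V :: "'a set" and D :: "'a \<Rightarrow> 'a set" and k d :: nat
  assumes finite_U: "finite U" and finite_V: "finite V"
    and D_subset: "u \<in> U \<Longrightarrow> D u \<subseteq> V"
    and card_D: "u \<in> U \<Longrightarrow> card (D u) = k"
    and card_up: "v \<in> V \<Longrightarrow> card {u\<in>U. v \<in> D u} = d"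
    and codegree: "u \<in> U \<Longrightarrow> u' \<in> U \<Longrightarrow> u \<noteq> u' \<Longrightarrow> card (D u \<inter> D u') \<le> 1"
    and degrees: "d < k"
begin

definition shadow :: "'a set \<Rightarrow> 'a set" where
  "shadow F = (\<Union>u\<in>F. D u)"

definition up :: "'a set \<Rightarrow> 'a set" where
  "up T = {u\<in>U. D u \<inter> T \<noteq> {}}"

text \<open>To be read as a decoder. \<open>T\<close> consists of points of the true shadow,
  \<open>Z\<close> of those neighbours of \<open>T\<close> that must be discarded, and
  \<open>X\<close> of members of the family whose facets would otherwise be missed. With these
  choices the result lies inside the true shadow.\<close>

definition approx_shadow :: "'a set \<Rightarrow> 'a set \<Rightarrow> 'a set \<Rightarrow> 'a set" where
  "approx_shadow T Z X = shadow (up T - Z) \<union> shadow X"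

text \<open>The members are only required to have nearly all facets in the approximate shadow.
  \<open>W\<close> consists of points outside the true shadow; their neighbours cannot belong to the
  family, so deleting them removes false members only.\<close>

definition approx_closure :: "real \<Rightarrow> 'a set \<Rightarrow> 'a set \<Rightarrow> 'a set \<Rightarrow> 'a set \<Rightarrow> 'a set" where
  "approx_closure \<psi> T Z X W = {u\<in>U. real (card (D u - approx_shadow T Z X)) < \<psi>} - up W"

text \<open>A point with at least \<open>\<psi>\<close> neighbours in the approximate closure is
  certified as a point of the shadow; \<open>Y\<close> lists the points of the shadow that remain
  uncertified.\<close>

definition exact_closure ::
    "real \<Rightarrow> 'a set \<Rightarrow> 'a set \<Rightarrow> 'a set \<Rightarrow> 'a set \<Rightarrow> 'a set \<Rightarrow> 'a set" where
  "exact_closure \<psi> T Z X W Y =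
     {u\<in>U. D u \<subseteq> approx_shadow T Z X
       \<union> {v\<in>V. \<psi> \<le> real (card (up {v} \<inter> approx_closure \<psi> T Z X W))} \<union> Y}"

lemma finite_D: "u \<in> U \<Longrightarrow> finite (D u)"
  using D_subset finite_V finite_subset by blast

lemma shadow_subset: "F \<subseteq> U \<Longrightarrow> shadow F \<subseteq> V"
  using D_subset by (auto simp: shadow_def)

lemma up_subset: "up T \<subseteq> U" by (auto simp: up_def)

lemma up_singleton: "up {v} = {u\<in>U. v \<in> D u}" by (auto simp: up_def)

lemma card_up_singleton: "v \<in> V \<Longrightarrow> card (up {v}) = d"
  using card_up by (simp add: up_singleton)

lemma double_count:
  assumes "A \<subseteq> U" "B \<subseteq> V"
  shows "(\<Sum>u\<in>A. card (D u \<inter> B)) = (\<Sum>v\<in>B. card (up {v} \<inter> A))"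
proof -
  have fin: "finite A" "finite B" using assms finite_U finite_V finite_subset by blast+
  have "(\<Sum>u\<in>A. card (D u \<inter> B)) = (\<Sum>u\<in>A. \<Sum>v\<in>B. if v \<in> D u then 1 else 0)"
    using fin by (intro sum.cong) (auto simp: sum.If_cases Int_commute Int_def conj_commute)
  also have "\<dots> = (\<Sum>v\<in>B. \<Sum>u\<in>A. if v \<in> D u then 1 else 0)" by (rule sum.swap)
  also have "\<dots> = (\<Sum>v\<in>B. card (up {v} \<inter> A))"
  proof (rule sum.cong)
    fix v assume "v \<in> B"
    have "{u\<in>A. v \<in> D u} = up {v} \<inter> A" using assms by (auto simp: up_singleton)
    then show "(\<Sum>u\<in>A. if v \<in> D u then 1 else 0) = card (up {v} \<inter> A)"
      using fin by (simp add: sum.If_cases Int_def)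
  qed simp
  finally show ?thesis .
qed

lemma double_count_real:
  assumes "A \<subseteq> U" "B \<subseteq> V"
  shows "(\<Sum>u\<in>A. real (card (D u \<inter> B))) = (\<Sum>v\<in>B. real (card (up {v} \<inter> A)))"
  using double_count[OF assms] by (simp flip: of_nat_sum)

text \<open>Count the edges between \<open>A\<close> and \<open>G\<close>: each member of
  \<open>A\<close> sends \<open>k\<close> of them into \<open>G\<close>, each point of
  \<open>G\<close> receives at most \<open>d\<close>. As \<open>d + 1 \<le> k\<close>, this makes
  \<open>\<delta>\<close> at least \<open>card G / k\<close> and leaves at most
  \<open>k * \<delta>\<close> edges from \<open>G\<close> to sets outside \<open>A\<close>. All
  later errors are measured against \<open>\<delta>\<close> through these two bounds.\<close>

lemma closed_counts:
  fixes \<delta> :: real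
  assumes "G \<subseteq> V" "A \<subseteq> U" "shadow A \<subseteq> G"
  defines "(\<delta>::real) \<equiv> real (card G) - real (card A)"
  shows "real k * card A \<le> real d * card G"
    and "(\<Sum>v\<in>G. real (card (up {v} - A))) \<le> k * \<delta>"
    and "real (card G) \<le> k * \<delta>"
    and "card A \<le> card G"
proof -
  have finG: "finite G" and finA: "finite A" using assms finite_U finite_V finite_subset by blast+
  have "(\<Sum>u\<in>A. card (D u \<inter> G)) = k * card A"
  proof -
    have "card (D u \<inter> G) = k" if "u \<in> A" for u
    proof -
      have "D u \<inter> G = D u" using that assms(3) by (auto simp: shadow_def)
      then show ?thesis using card_D that assms(2) by auto
    qed
    then show ?thesis by simp
  qed
  then have e1: "k * card A = (\<Sum>v\<in>G. card (up {v} \<inter> A))" using double_count[OF assms(2,1)] by simp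
  have e2: "(\<Sum>v\<in>G. card (up {v})) = d * card G"
    using card_up_singleton assms(1) by (simp add: subset_iff)
  have fu: "finite (up {v})" for v using up_subset finite_U finite_subset by blast
  have e3: "(\<Sum>v\<in>G. card (up {v} - A)) + k * card A = d * card G"
  proof -
    have "card (up {v} - A) + card (up {v} \<inter> A) = card (up {v})" for v
      using card_Diff_subset_Int[of "up {v}" A] fu card_mono[of "up {v}" "up {v} \<inter> A"] by simp
    then show ?thesis unfolding e1 e2[symmetric] by (simp add: sum.distrib[symmetric])
  qed
  then have "k * card A \<le> d * card G" by linarith
  then show r: "real k * card A \<le> real d * card G" by (metis of_nat_le_iff of_nat_mult)
  have dk: "real d * card G + card G \<le> k * real (card G)"
  proof -
    have "real d + 1 \<le> k" using degrees by linarith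
    then have "(real d + 1) * card G \<le> k * real (card G)" by (intro mult_right_mono) auto
    then show ?thesis by (simp add: algebra_simps)
  qed
  have "(\<Sum>v\<in>G. real (card (up {v} - A))) = real d * card G - k * real (card A)"
    using e3 by (metis add_diff_cancel_right' of_nat_add of_nat_mult of_nat_sum)
  then show "(\<Sum>v\<in>G. real (card (up {v} - A))) \<le> k * \<delta>"
    using dk by (simp add: \<delta>_def algebra_simps)
  show g: "real (card G) \<le> k * \<delta>" using r dk by (simp add: \<delta>_def algebra_simps)
  have "0 \<le> k * \<delta>" using g by linarith
  then have "0 \<le> \<delta>" using degrees by (simp add: zero_le_mult_iff)
  then show "card A \<le> card G" by (simp add: \<delta>_def)
qed

lemma sum_ge_threshold:
  fixes f :: "'b \<Rightarrow> real"
  assumes "finite B" "\<And>v. v \<in> B \<Longrightarrow> 0 \<le> f v" "C \<subseteq> B" "\<And>v. v \<in> C \<Longrightarrow> c \<le> f v"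
  shows "c * card C \<le> sum f B"
proof -
  have "c * card C = (\<Sum>v\<in>C. c)" by simp
  also have "\<dots> \<le> sum f C" using assms(4) by (rule sum_mono)
  also have "\<dots> \<le> sum f B" using assms by (intro sum_mono2) auto
  finally show ?thesis .
qed

text \<open>A set \<open>T\<close> of points of \<open>G\<close> together with their neighbours in \<open>A\<close> describes most of \<open>G\<close>:
  a point of \<open>G\<close> sees up to \<open>d (k - 1)\<close> others at distance two, so \<open>T\<close> can be taken smaller than
  \<open>card G\<close> by the factor \<open>R\<close>.\<close>

lemma covering:
  fixes \<delta> \<theta> R J d\<^sub>0 :: real
  assumes G: "G \<subseteq> V" and A: "A \<subseteq> U" "shadow A \<subseteq> G"
    and par: "0 < \<theta>" "0 < R" "0 < J" "0 < d\<^sub>0" "d\<^sub>0 \<le> real d - \<theta> - R / J"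
  defines "(\<delta>::real) \<equiv> real (card G) - real (card A)"
  obtains T where "T \<subseteq> G" "card T \<le> k * \<delta> / R" "card (up T - A) \<le> \<theta> * (k * \<delta> / R)"
    "shadow (up T \<inter> A) \<subseteq> G"
    "card (G - shadow (up T \<inter> A)) \<le> (k * (J + 1) / d\<^sub>0 + k / \<theta>) * \<delta>"
proof -
  note cc = closed_counts[OF G A, folded \<delta>_def]
  have finG: "finite G" and finA: "finite A" using assms finite_U finite_V finite_subset by blast+
  have fu: "finite (up S)" for S using up_subset finite_U finite_subset by blast
  have sub: "shadow (B \<inter> A) \<subseteq> G" for B using A(2) by (auto simp: shadow_def)
  have fsh: "finite (shadow (B \<inter> A))" for B using sub finG finite_subset by blast
  \<comment> \<open>A point with more than \<open>\<theta>\<close> neighbours outside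
    \<open>A\<close> would make \<open>Z\<close> expensive. By the count of escaping edges there are
    at most \<open>k * \<delta> / \<theta>\<close> of them, and they are left uncovered.\<close>
  define P where "P = {v\<in>G. real (card (up {v} - A)) \<le> \<theta>}"
  have finP: "finite P" using finG by (simp add: P_def)
  obtain T where T: "T \<subseteq> P" "R * real (card T) \<le> real (card (shadow (up T \<inter> A)))"
    "\<And>v. v \<in> P \<Longrightarrow> v \<notin> T \<Longrightarrow>
      real (card (shadow (up (insert v T) \<inter> A))) < R * (real (card T) + 1)"
    using maximal_growth_set[of P "\<lambda>T. real (card (shadow (up T \<inter> A)))" R] finP by auto
  have finT: "finite T" using T(1) finP finite_subset by blast
  define Q where "Q = shadow (up T \<inter> A)"
  have QG: "Q \<subseteq> G" and finQ: "finite Q" using sub fsh by (auto simp: Q_def)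
  have "R * card T \<le> card G"
    using T(2) card_mono[OF finG QG] unfolding Q_def by linarith
  then have "R * card T \<le> k * \<delta>" using cc(3) by linarith
  then have cT: "card T \<le> k * \<delta> / R" using par by (simp add: field_simps)
  have cZ: "card (up T - A) \<le> \<theta> * (k * \<delta> / R)"
  proof -
    have "up T - A = (\<Union>v\<in>T. up {v} - A)" by (auto simp: up_def)
    then have "card (up T - A) \<le> (\<Sum>v\<in>T. card (up {v} - A))"
      using card_UN_le[OF finT, of "\<lambda>v. up {v} - A"] by metis
    then have "real (card (up T - A)) \<le> (\<Sum>v\<in>T. real (card (up {v} - A)))"
      by (metis of_nat_le_iff of_nat_sum)
    also have "\<dots> \<le> (\<Sum>v\<in>T. \<theta>)" using T(1) by (intro sum_mono) (auto simp: P_def)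
    also have "\<dots> \<le> \<theta> * (k * \<delta> / R)"
      using mult_left_mono[OF cT, of \<theta>] par by (simp add: mult.commute)
    finally show ?thesis .
  qed
  have fresh: "card (shadow (up {v} \<inter> A) - Q) < R" if v: "v \<in> P" for v
  proof (cases "v \<in> T")
    case True
    then have e: "shadow (up {v} \<inter> A) - Q = {}" by (auto simp: Q_def shadow_def up_def)
    show ?thesis unfolding e using par by simp
  next
    case False
    have "shadow (up (insert v T) \<inter> A) = Q \<union> (shadow (up {v} \<inter> A) - Q)"
      by (auto simp: Q_def shadow_def up_def)
    then have "card (shadow (up (insert v T) \<inter> A)) = card (Q \<union> (shadow (up {v} \<inter> A) - Q))"
      by (rule arg_cong)
    also have "\<dots> = card Q + card (shadow (up {v} \<inter> A) - Q)"
      using finQ fsh by (intro card_Un_disjoint) auto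
    finally have "card (shadow (up (insert v T) \<inter> A)) = card Q + card (shadow (up {v} \<inter> A) - Q)" .
    then show ?thesis using T(3)[OF v False] T(2) by (simp add: Q_def algebra_simps)
  qed
  define B where "B = P - Q"
  define L where "L = {u\<in>A. real (card (D u - Q)) \<le> J + 1}"
  have LA: "L \<subseteq> A" and finL: "finite L" using finA by (auto simp: L_def)
  \<comment> \<open>For the neighbours \<open>u\<close> of \<open>v\<close> in \<open>A\<close> the
    sets \<open>D u - Q - {v}\<close> are pairwise disjoint by the codegree bound. By maximality of
    \<open>T\<close> they have fewer than \<open>R\<close> points together, so at most
    \<open>R / J\<close> of them have more than \<open>J\<close> points.\<close>
  have light: "d\<^sub>0 \<le> card (up {v} \<inter> L)" if v: "v \<in> B" for v
  proof -
    have vP: "v \<in> P" and vQ: "v \<notin> Q" using v by (auto simp: B_def)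
    then have vV: "v \<in> V" using G by (auto simp: P_def)
    define N where "N = up {v} \<inter> A"
    have finN: "finite N" using fu by (simp add: N_def)
    have NU: "N \<subseteq> U" using A by (auto simp: N_def)
    define H where "H = {u\<in>N. J < real (card (D u - Q - {v}))}"
    have "(\<Sum>u\<in>N. card (D u - Q - {v})) = card (\<Union>u\<in>N. D u - Q - {v})"
    proof (rule card_UN_disjoint[symmetric, OF finN])
      show "\<forall>i\<in>N. finite (D i - Q - {v})" using finite_D NU by blast
      show "\<forall>i\<in>N. \<forall>j\<in>N. i \<noteq> j \<longrightarrow> (D i - Q - {v}) \<inter> (D j - Q - {v}) = {}"
      proof (intro ballI impI)
        fix i j assume ij: "i \<in> N" "j \<in> N" "i \<noteq> j"
        have "card (D i \<inter> D j) \<le> 1" using codegree ij NU by blast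
        moreover have "v \<in> D i \<inter> D j" using ij by (auto simp: N_def up_singleton)
        moreover have "finite (D i \<inter> D j)" using finite_D ij NU by blast
        ultimately have "D i \<inter> D j \<subseteq> {v}" by (metis card_le_Suc0_iff_eq One_nat_def singleton_iff subsetI)
        then show "(D i - Q - {v}) \<inter> (D j - Q - {v}) = {}" by blast
      qed
    qed
    also have "\<dots> \<le> card (shadow N - Q)"
      using fsh by (intro card_mono) (auto simp: shadow_def N_def)
    finally have "(\<Sum>u\<in>N. real (card (D u - Q - {v}))) \<le> card (shadow N - Q)"
      by (metis of_nat_le_iff of_nat_sum)
    then have s: "(\<Sum>u\<in>N. real (card (D u - Q - {v}))) \<le> R" using fresh[OF vP] by (simp add: N_def)
    have "J * card H \<le> (\<Sum>u\<in>N. real (card (D u - Q - {v})))"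
      by (rule sum_ge_threshold) (use finN in \<open>auto simp: H_def\<close>)
    then have H: "card H \<le> R / J" using s par by (simp add: field_simps)
    have "N - H \<subseteq> up {v} \<inter> L"
    proof
      fix u assume u: "u \<in> N - H"
      have fin: "finite (D u - Q - {v})" using finite_D u NU by blast
      have "card (D u - Q) \<le> card (insert v (D u - Q - {v}))" using fin by (intro card_mono) auto
      also have "\<dots> = card (D u - Q - {v}) + 1" using fin by (subst card_insert_disjoint) auto
      finally have "real (card (D u - Q)) \<le> real (card (D u - Q - {v})) + 1" by linarith
      then show "u \<in> up {v} \<inter> L" using u by (auto simp: H_def L_def N_def)
    qed
    then have c1: "card (N - H) \<le> card (up {v} \<inter> L)" using fu by (intro card_mono) auto
    have "card (N - H) = card N - card H" using finN by (intro card_Diff_subset) (auto simp: H_def)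
    then have c2: "real (card (N - H)) \<ge> card N - card H" by linarith
    have "up {v} = N \<union> (up {v} - A)" by (auto simp: N_def)
    then have "d \<le> card N + card (up {v} - A)"
      using card_up_singleton[OF vV] card_Un_le by metis
    moreover have "real (card (up {v} - A)) \<le> \<theta>" using vP by (simp add: P_def)
    ultimately show ?thesis using c1 c2 H par by linarith
  qed
  \<comment> \<open>Double counting between \<open>B\<close> and \<open>L\<close>: an uncovered
    point has at least \<open>d\<^sub>0\<close> light neighbours, and a light set has at most
    \<open>J + 1\<close> uncovered facets, the extra one allowing for \<open>v\<close>
    itself.\<close>
  have BG: "B \<subseteq> G" by (auto simp: B_def P_def)
  have finB: "finite B" using BG finG finite_subset by blast
  have "d\<^sub>0 * card B \<le> (\<Sum>v\<in>B. real (card (up {v} \<inter> L)))"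
    by (rule sum_ge_threshold) (use finB light in auto)
  also have "\<dots> = (\<Sum>u\<in>L. real (card (D u \<inter> B)))"
    using LA A BG G by (intro double_count_real[symmetric]) auto
  also have "\<dots> \<le> (\<Sum>u\<in>L. J + 1)"
  proof (rule sum_mono)
    fix u assume u: "u \<in> L"
    have "card (D u \<inter> B) \<le> card (D u - Q)"
      using finite_D u LA A by (intro card_mono) (auto simp: B_def)
    then show "real (card (D u \<inter> B)) \<le> J + 1" using u by (auto simp: L_def)
  qed
  also have "\<dots> \<le> (J + 1) * card G"
    using card_mono[OF finA LA] cc(4) par by (simp add: mult.commute)
  also have "\<dots> \<le> (J + 1) * (k * \<delta>)" using cc(3) par by (intro mult_left_mono) auto
  finally have cB: "card B \<le> (k * (J + 1) / d\<^sub>0) * \<delta>" using par by (simp add: field_simps)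
  have "\<theta> * card (G - P) \<le> (\<Sum>v\<in>G. real (card (up {v} - A)))"
    by (rule sum_ge_threshold) (use finG in \<open>auto simp: P_def\<close>)
  then have "\<theta> * card (G - P) \<le> k * \<delta>" using cc(2) by linarith
  then have cP: "card (G - P) \<le> (k / \<theta>) * \<delta>" using par by (simp add: field_simps)
  have "G - Q \<subseteq> B \<union> (G - P)" by (auto simp: B_def)
  then have "card (G - Q) \<le> card (B \<union> (G - P))"
    using finB finG by (intro card_mono) auto
  also have "\<dots> \<le> card B + card (G - P)" by (rule card_Un_le)
  finally have "real (card (G - Q)) \<le> card B + card (G - P)" by (metis of_nat_add of_nat_le_iff)
  then have "card (G - Q) \<le> (k * (J + 1) / d\<^sub>0 + k / \<theta>) * \<delta>"
    using cB cP by (simp add: distrib_right)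
  moreover have "T \<subseteq> G" using T(1) by (auto simp: P_def)
  ultimately show ?thesis using that[of T] cT cZ QG by (simp add: Q_def)
qed

text \<open>\<open>X\<close> repairs the members of \<open>A\<close> that stick out of the covered
  part of \<open>G\<close>, and \<open>W\<close> deletes false members through points outside
  \<open>G\<close>. The result is a set \<open>S\<close> containing \<open>A\<close>, with at most
  \<open>2 * \<delta>\<close> further members, such that every point outside \<open>G\<close> has
  fewer than \<open>\<psi>\<close> neighbours in it. If \<open>S\<close> certifies all but
  \<open>\<kappa> * \<delta>\<close> points of \<open>G\<close>, the others are listed in
  \<open>Y\<close> and \<open>A\<close> is recovered exactly. Otherwise many points of
  \<open>G\<close> receive few edges from \<open>S\<close>, which forces \<open>S\<close> itself to
  be smaller than \<open>G\<close> by a multiple of \<open>\<kappa> * \<delta>\<close>.\<close>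

lemma container:
  fixes \<delta> \<eta> \<kappa> \<theta> R J d\<^sub>0 \<psi> :: real
  assumes G: "G \<subseteq> V" and A: "A = {u\<in>U. D u \<subseteq> G}"
    and par: "0 < \<theta>" "0 < R" "0 < J" "0 < d\<^sub>0" "d\<^sub>0 \<le> real d - \<theta> - R / J"
      "0 < \<psi>" "\<psi> \<le> real k / 2" "0 < \<kappa>" "\<kappa> \<le> 1" "\<psi> \<le> \<kappa> * real k / 8"
  defines "\<delta> \<equiv> real (card G) - real (card A)"
    and "\<eta> \<equiv> k * (1 + \<theta>) / R + (k * (J + 1) / d\<^sub>0 + k / \<theta> + 2) / \<psi>"
  obtains T Z X W Y where "T \<subseteq> V" "Z \<subseteq> U" "X \<subseteq> U" "W \<subseteq> V" "Y \<subseteq> V"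
    "real (card T + card Z + card X + card W) \<le> \<eta> * \<delta>" "real (card Y) \<le> \<kappa> * \<delta>"
    "A \<subseteq> approx_closure \<psi> T Z X W \<and>
       real (card (approx_closure \<psi> T Z X W)) \<le> card G - \<kappa> / 4 * \<delta> \<or>
     A = exact_closure \<psi> T Z X W Y"
proof -
  have AU: "A \<subseteq> U" and shA: "shadow A \<subseteq> G" using A by (auto simp: shadow_def)
  note cc = closed_counts[OF G AU shA, folded \<delta>_def]
  have finG: "finite G" and finA: "finite A" using G AU finite_U finite_V finite_subset by blast+
  have fu: "finite (up S)" for S using up_subset finite_U finite_subset by blast
  have kpos: "0 < k" using degrees by simp
  have \<delta>0: "0 \<le> \<delta>" using cc(4) by (simp add: \<delta>_def)
  obtain T where T: "T \<subseteq> G" "card T \<le> k * \<delta> / R" "card (up T - A) \<le> \<theta> * (k * \<delta> / R)"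
    "shadow (up T \<inter> A) \<subseteq> G"
    "card (G - shadow (up T \<inter> A)) \<le> (k * (J + 1) / d\<^sub>0 + k / \<theta>) * \<delta>"
    using covering[OF G AU shA par(1-5)] unfolding \<delta>_def by metis
  define Z where "Z = up T - A"
  define Q where "Q = shadow (up T \<inter> A)"
  have upZ: "up T - Z = up T \<inter> A" by (auto simp: Z_def)
  obtain X where X: "X \<subseteq> A" "\<psi> * real (card X) \<le> real (card (shadow X - Q))"
    "\<And>u. u \<in> A \<Longrightarrow> u \<notin> X \<Longrightarrow> real (card (shadow (insert u X) - Q)) < \<psi> * (real (card X) + 1)"
    using maximal_growth_set[of A "\<lambda>X. real (card (shadow X - Q))" \<psi>] finA by auto
  have shX: "shadow X \<subseteq> G" using X(1) shA by (auto simp: shadow_def)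
  have cX: "card X \<le> (k * (J + 1) / d\<^sub>0 + k / \<theta>) * \<delta> / \<psi>"
  proof -
    have "card (shadow X - Q) \<le> card (G - Q)" using shX finG by (intro card_mono) auto
    then have "card X * \<psi> \<le> (k * (J + 1) / d\<^sub>0 + k / \<theta>) * \<delta>"
      using X(2) T(5) by (simp add: Q_def mult.commute)
    then show ?thesis using par(6) by (simp only: pos_le_divide_eq)
  qed
  define Q1 where "Q1 = approx_shadow T Z X"
  have Q1: "Q1 = Q \<union> shadow X" by (simp add: Q1_def approx_shadow_def upZ Q_def)
  have Q1G: "Q1 \<subseteq> G" using T(4) shX by (simp add: Q1 Q_def)
  define S1 where "S1 = {u\<in>U. real (card (D u - Q1)) < \<psi>}"
  have AS1: "A \<subseteq> S1"
  proof
    fix u assume u: "u \<in> A"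
    have "card (D u - Q1) < \<psi>"
    proof (cases "u \<in> X")
      case True
      then have e: "D u - Q1 = {}" by (auto simp: Q1 shadow_def)
      show ?thesis unfolding e using par by simp
    next
      case False
      have e: "shadow (insert u X) - Q = (shadow X - Q) \<union> (D u - Q1)" by (auto simp: Q1 shadow_def)
      have "card (shadow (insert u X) - Q) = card (shadow X - Q) + card (D u - Q1)"
        unfolding e
      proof (rule card_Un_disjoint)
        show "finite (shadow X - Q)" using finite_subset[OF shX finG] by simp
        show "finite (D u - Q1)" using finite_D u AU by blast
      qed (auto simp: Q1)
      then show ?thesis using X(3)[OF u False] X(2) by (simp add: algebra_simps)
    qed
    then show "u \<in> S1" using u AU by (auto simp: S1_def)
  qed
  have S1U: "S1 \<subseteq> U" by (auto simp: S1_def)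
  have finS1: "finite S1" using S1U finite_U finite_subset by blast
  \<comment> \<open>As \<open>\<psi> \<le> k / 2\<close>, a false member has at least half of its
    facets in \<open>G\<close>, and thus uses \<open>k / 2\<close> of the at most
    \<open>k * \<delta>\<close> edges that leave \<open>G\<close> to sets outside
    \<open>A\<close>.\<close>
  have cS1: "card (S1 - A) \<le> 2 * \<delta>"
  proof -
    have "real k / 2 * card (S1 - A) \<le> (\<Sum>u\<in>S1 - A. real (card (D u \<inter> G)))"
    proof (rule sum_ge_threshold)
      fix u assume u: "u \<in> S1 - A"
      then have uU: "u \<in> U" using S1U by auto
      have "card (D u) = card (D u \<inter> G) + card (D u - G)"
        using card_Diff_subset_Int[of "D u" G] finite_D[OF uU] card_mono[of "D u" "D u \<inter> G"] by simp
      moreover have "card (D u - G) \<le> card (D u - Q1)"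
        using Q1G finite_D[OF uU] by (intro card_mono) auto
      moreover have "card (D u - Q1) < \<psi>" using u by (auto simp: S1_def)
      ultimately show "real k / 2 \<le> card (D u \<inter> G)" using par card_D[OF uU] by linarith
    qed (use finS1 in auto)
    also have "\<dots> = (\<Sum>v\<in>G. real (card (up {v} \<inter> (S1 - A))))"
      using S1U G by (intro double_count_real) auto
    also have "\<dots> \<le> (\<Sum>v\<in>G. real (card (up {v} - A)))"
      using fu by (intro sum_mono) (auto intro!: card_mono)
    also have "\<dots> \<le> k * \<delta>" by (rule cc(2))
    finally show ?thesis using kpos by (simp add: field_simps)
  qed
  obtain W where W: "W \<subseteq> V - G" "\<psi> * real (card W) \<le> real (card (up W \<inter> S1))"
    "\<And>w. w \<in> V - G \<Longrightarrow> w \<notin> W \<Longrightarrow> real (card (up (insert w W) \<inter> S1)) < \<psi> * (real (card W) + 1)"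
    using maximal_growth_set[of "V - G" "\<lambda>W. real (card (up W \<inter> S1))" \<psi>] finite_V by auto
  have upW: "up W \<inter> A = {}" using W(1) A by (auto simp: up_def)
  have cW: "card W \<le> 2 * \<delta> / \<psi>"
  proof -
    have "card (up W \<inter> S1) \<le> card (S1 - A)" using upW finS1 by (intro card_mono) auto
    then have "\<psi> * card W \<le> 2 * \<delta>" using W(2) cS1 by linarith
    then show ?thesis using par by (simp add: field_simps)
  qed
  define S where "S = approx_closure \<psi> T Z X W"
  have S: "S = S1 - up W" by (simp add: S_def approx_closure_def S1_def Q1_def)
  have AS: "A \<subseteq> S" using AS1 upW by (auto simp: S)
  have SU: "S \<subseteq> U" and finS: "finite S" using S1U finS1 by (auto simp: S)
  define Q' where "Q' = Q1 \<union> {v\<in>V. \<psi> \<le> real (card (up {v} \<inter> S))}"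
  have Q'G: "Q' \<subseteq> G"
  proof -
    have "card (up {w} \<inter> S) < \<psi>" if w: "w \<in> V - G" for w
    proof (cases "w \<in> W")
      case True
      then have e: "up {w} \<inter> S = {}" by (auto simp: S up_def)
      show ?thesis unfolding e using par by simp
    next
      case False
      have e: "up (insert w W) \<inter> S1 = (up W \<inter> S1) \<union> (up {w} \<inter> S)" by (auto simp: S up_def)
      have "card (up (insert w W) \<inter> S1) = card (up W \<inter> S1) + card (up {w} \<inter> S)"
        unfolding e using finS finS1 by (intro card_Un_disjoint) (auto simp: S)
      then show ?thesis using W(3)[OF w False] W(2) by (simp add: algebra_simps)
    qed
    then show ?thesis using Q1G by (force simp: Q'_def)
  qed
  have finQ': "finite Q'" using Q'G finG finite_subset by blast
  define x y where "x = real (card G) - card Q'" and "y = real (card S) - card A"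
  have cGQ: "real (card (G - Q')) = x"
    using card_Diff_subset[OF finQ' Q'G] card_mono[OF finG Q'G] by (simp add: x_def)
  have cSA: "real (card (S - A)) = y"
    using card_Diff_subset[OF finA AS] card_mono[OF finS AS] by (simp add: y_def)
  have y2: "y \<le> 2 * \<delta>"
  proof -
    have "card (S - A) \<le> card (S1 - A)" using finS1 by (intro card_mono) (auto simp: S)
    then show ?thesis using cS1 cSA by linarith
  qed
  have cTZ: "real (card T + card Z + card X + card W) \<le> \<eta> * \<delta>"
  proof -
    have "real (card T + card Z + card X + card W) \<le> k * \<delta> / R + \<theta> * (k * \<delta> / R)
        + (k * (J + 1) / d\<^sub>0 + k / \<theta>) * \<delta> / \<psi> + 2 * \<delta> / \<psi>"
      using T(2,3) cX cW by (simp add: Z_def)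
    also have "\<dots> = \<eta> * \<delta>" by (simp add: \<eta>_def algebra_simps add_divide_distrib)
    finally show ?thesis .
  qed
  have ZU: "Z \<subseteq> U" using up_subset by (auto simp: Z_def)
  have TV: "T \<subseteq> V" and XU: "X \<subseteq> U" and WV: "W \<subseteq> V" using T(1) G X(1) AU W(1) by auto
  show ?thesis
  proof (cases "x \<le> \<kappa> * \<delta>")
    case True
    have "approx_shadow T Z X \<union> {v\<in>V. \<psi> \<le> real (card (up {v} \<inter> approx_closure \<psi> T Z X W))}
        \<union> (G - Q') = G"
      using Q'G by (auto simp: Q'_def Q1_def S_def)
    then have "A = exact_closure \<psi> T Z X W (G - Q')" by (simp add: exact_closure_def A)
    moreover have "G - Q' \<subseteq> V" using G by auto
    moreover have "real (card (G - Q')) \<le> \<kappa> * \<delta>" using True cGQ by simp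
    ultimately show ?thesis using that[OF TV ZU XU WV, of "G - Q'"] cTZ by blast
  next
    case False
    \<comment> \<open>The \<open>k\<close> facets of each member of \<open>S\<close> are split into
      three kinds. A point of \<open>Q'\<close> receives at most \<open>d\<close> edges and a point
      of \<open>G - Q'\<close> fewer than \<open>\<psi>\<close>; a member of \<open>S - A\<close>
      has fewer than \<open>\<psi>\<close> facets outside \<open>G\<close>, a member of
      \<open>A\<close> has none. Hence \<open>card S\<close> exceeds \<open>card Q'\<close> by at
      most \<open>\<psi> * (x + y) / k\<close>.\<close>
    have eQ: "(\<Sum>u\<in>S. real (card (D u \<inter> Q'))) \<le> k * real (card Q')"
    proof -
      have "(\<Sum>u\<in>S. real (card (D u \<inter> Q'))) = (\<Sum>v\<in>Q'. real (card (up {v} \<inter> S)))"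
        using SU Q'G G by (intro double_count_real) auto
      also have "\<dots> \<le> (\<Sum>v\<in>Q'. real d)"
      proof (rule sum_mono)
        fix v assume "v \<in> Q'"
        then have "card (up {v}) = d" using Q'G G card_up_singleton by auto
        moreover have "card (up {v} \<inter> S) \<le> card (up {v})" using fu by (intro card_mono) auto
        ultimately show "real (card (up {v} \<inter> S)) \<le> d" by simp
      qed
      also have "\<dots> \<le> k * real (card Q')" using degrees by (simp add: mult_right_mono mult.commute)
      finally show ?thesis .
    qed
    have eG: "(\<Sum>u\<in>S. real (card (D u \<inter> (G - Q')))) \<le> \<psi> * x"
    proof -
      have "(\<Sum>u\<in>S. real (card (D u \<inter> (G - Q')))) = (\<Sum>v\<in>G - Q'. real (card (up {v} \<inter> S)))"
        using SU G by (intro double_count_real) auto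
      also have "\<dots> \<le> (\<Sum>v\<in>G - Q'. \<psi>)"
        using G by (intro sum_mono) (auto simp: Q'_def not_le intro: less_imp_le)
      finally show ?thesis using cGQ by (simp add: mult.commute)
    qed
    have eR: "(\<Sum>u\<in>S. real (card (D u - G))) \<le> \<psi> * y"
    proof -
      have "(\<Sum>u\<in>S. real (card (D u - G))) = (\<Sum>u\<in>S - A. real (card (D u - G)))"
      proof (rule sum.mono_neutral_right[OF finS])
        show "\<forall>i\<in>S - (S - A). real (card (D i - G)) = 0"
        proof
          fix i assume "i \<in> S - (S - A)"
          then have e: "D i - G = {}" using A by auto
          show "real (card (D i - G)) = 0" unfolding e by simp
        qed
      qed auto
      also have "\<dots> \<le> (\<Sum>u\<in>S - A. \<psi>)"
      proof (rule sum_mono)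
        fix u assume u: "u \<in> S - A"
        have "card (D u - G) \<le> card (D u - Q1)"
          using Q1G finite_D u SU by (intro card_mono) auto
        then show "real (card (D u - G)) \<le> \<psi>" using u by (auto simp: S S1_def)
      qed
      finally show ?thesis using cSA by (simp add: mult.commute)
    qed
    have split: "real (card (D u \<inter> Q')) + real (card (D u \<inter> (G - Q'))) + real (card (D u - G)) = k"
      if "u \<in> S" for u
    proof -
      have fD: "finite (D u)" using finite_D that SU by auto
      have e: "D u = (D u \<inter> Q') \<union> ((D u \<inter> (G - Q')) \<union> (D u - G))" using Q'G by auto
      have "card ((D u \<inter> Q') \<union> ((D u \<inter> (G - Q')) \<union> (D u - G)))
          = card (D u \<inter> Q') + card ((D u \<inter> (G - Q')) \<union> (D u - G))"
        by (rule card_Un_disjoint) (use fD Q'G in auto)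
      moreover have "card ((D u \<inter> (G - Q')) \<union> (D u - G)) = card (D u \<inter> (G - Q')) + card (D u - G)"
        by (rule card_Un_disjoint) (use fD in auto)
      ultimately have "card (D u) = card (D u \<inter> Q') + card (D u \<inter> (G - Q')) + card (D u - G)"
        using e by simp
      then show ?thesis using card_D that SU by auto
    qed
    have "k * real (card S) = (\<Sum>u\<in>S. real (card (D u \<inter> Q')) + real (card (D u \<inter> (G - Q')))
        + real (card (D u - G)))"
      using split by (simp add: mult.commute)
    also have "\<dots> \<le> k * real (card Q') + \<psi> * x + \<psi> * y"
      using eQ eG eR by (simp add: sum.distrib)
    finally have kS: "k * real (card S) \<le> k * real (card Q') + \<psi> * (x + y)"
      by (simp add: algebra_simps)
    have x0: "0 \<le> x" and y0: "0 \<le> y" using cGQ cSA by (metis of_nat_0_le_iff)+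
    have "\<psi> * (x + y) \<le> k * (\<kappa> / 8 * (x + y))"
      using mult_right_mono[OF par(10), of "x + y"] x0 y0 by (simp add: algebra_simps)
    then have "k * real (card S) \<le> k * (real (card Q') + \<kappa> / 8 * (x + y))"
      using kS unfolding distrib_left[of "real k"] by linarith
    then have "card S \<le> real (card Q') + \<kappa> / 8 * (x + y)" using kpos by simp
    also have "\<dots> \<le> card G - x + (x / 4 + \<kappa> / 4 * \<delta>)"
    proof -
      have "\<kappa> * x \<le> 1 * x" using par x0 by (intro mult_right_mono) auto
      moreover have "\<kappa> * y \<le> \<kappa> * (2 * \<delta>)" using par y2 by (intro mult_left_mono) auto
      ultimately have "(\<kappa> * x + \<kappa> * y) / 8 \<le> (2 * x + \<kappa> * (2 * \<delta>)) / 8"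
        using x0 by (intro divide_right_mono) auto
      then have "\<kappa> / 8 * (x + y) \<le> x / 4 + \<kappa> / 4 * \<delta>" by (simp add: algebra_simps add_divide_distrib)
      moreover have "real (card Q') = card G - x" by (simp add: x_def)
      ultimately show ?thesis by argo
    qed
  also have "\<dots> \<le> card G - \<kappa> / 4 * \<delta>"
    proof -
      have "\<kappa> * \<delta> \<le> x" using False by simp
      then show ?thesis using x0 by argo
    qed
    finally have "card S \<le> card G - \<kappa> / 4 * \<delta>" .
    moreover have "real (card ({} :: 'a set)) \<le> \<kappa> * \<delta>" using par \<delta>0 by simp
    ultimately show ?thesis using that[OF TV ZU XU WV, of "{}"] cTZ AS unfolding S_def by blast
  qed
qed

section \<open>Weighted sums over encoded containers\<close>

text \<open>The five lists are packed into one tagged set, so that \<open>card K\<close> is the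
  total length and a sum over codes is a sum over a power set. The Boolean selects the alternative
  of \<open>container\<close>.\<close>

definition decode :: "real \<Rightarrow> bool \<Rightarrow> (nat \<times> 'a) set \<Rightarrow> 'a set" where
  "decode \<psi> b K =
     (if b then exact_closure \<psi> (K `` {0}) (K `` {1}) (K `` {2}) (K `` {3}) (K `` {4})
      else approx_closure \<psi> (K `` {0}) (K `` {1}) (K `` {2}) (K `` {3}))"

lemma decode_subset: "decode \<psi> b K \<subseteq> U"
  by (auto simp: decode_def exact_closure_def approx_closure_def)

text \<open>\<open>F\<close> is replaced by its closure \<open>A\<close>, which has the same shadow
  \<open>G\<close>. The surplus of \<open>G\<close> over the decoded container is
  \<open>\<delta>\<close> in the exact case and \<open>\<kappa> / 4 * \<delta>\<close> in the other;
  it has to pay \<open>\<Lambda>\<close> for each listed point and \<open>\<rho> * \<delta>\<close>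
  on top, whence the two budget conditions. Since \<open>card F \<le> k * \<delta>\<close>, the last
  payment dominates \<open>\<rho> * (card F / k)\<close>.\<close>

lemma container_code:
  fixes \<delta> \<eta> \<kappa> \<theta> R J d\<^sub>0 \<psi> \<Lambda> \<rho> :: real
  assumes F: "F \<subseteq> U"
    and par: "0 < \<theta>" "0 < R" "0 < J" "0 < d\<^sub>0" "d\<^sub>0 \<le> real d - \<theta> - R / J"
      "0 < \<psi>" "\<psi> \<le> real k / 2" "0 < \<kappa>" "\<kappa> \<le> 1" "\<psi> \<le> \<kappa> * real k / 8"
    and \<Lambda>: "0 \<le> \<Lambda>" "(\<eta> + \<kappa>) * \<Lambda> + \<rho> \<le> 1" "\<eta> * \<Lambda> + \<rho> \<le> \<kappa> / 4" "0 \<le> \<rho>"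
    and \<eta>: "\<eta> = k * (1 + \<theta>) / R + (k * (J + 1) / d\<^sub>0 + k / \<theta> + 2) / \<psi>"
  obtains b K where "K \<subseteq> {..<5} \<times> (U \<union> V)" "F \<subseteq> decode \<psi> b K"
    "real (card (decode \<psi> b K)) + \<Lambda> * card K + \<rho> * (card F / k) \<le> card (shadow F)"
proof -
  define G where "G = shadow F"
  define A where "A = {u\<in>U. D u \<subseteq> G}"
  define \<delta> where "\<delta> = real (card G) - real (card A)"
  have GV: "G \<subseteq> V" using shadow_subset[OF F] by (simp add: G_def)
  have AU: "A \<subseteq> U" and shA: "shadow A \<subseteq> G" by (auto simp: A_def shadow_def)
  note cc = closed_counts[OF GV AU shA, folded \<delta>_def]
  have FA: "F \<subseteq> A" using F by (auto simp: A_def G_def shadow_def)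
  have kpos: "0 < k" using degrees by simp
  have "card F \<le> card A" using FA AU finite_U by (meson card_mono finite_subset)
  then have "card F \<le> k * \<delta>" using cc(3,4) by linarith
  then have F\<delta>: "card F / k \<le> \<delta>" using kpos by (simp add: field_simps)
  then have \<delta>0: "0 \<le> \<delta>" by (meson divide_nonneg_nonneg of_nat_0_le_iff order_trans)
  have \<rho>F: "\<rho> * (card F / k) \<le> \<rho> * \<delta>" using F\<delta> \<Lambda> by (intro mult_left_mono)
  obtain T Z X W Y where sub: "T \<subseteq> V" "Z \<subseteq> U" "X \<subseteq> U" "W \<subseteq> V" "Y \<subseteq> V"
    and cT: "real (card T + card Z + card X + card W) \<le> \<eta> * \<delta>" and cY: "real (card Y) \<le> \<kappa> * \<delta>"
    and alt: "A \<subseteq> approx_closure \<psi> T Z X W \<and>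
       real (card (approx_closure \<psi> T Z X W)) \<le> card G - \<kappa> / 4 * \<delta> \<or>
     A = exact_closure \<psi> T Z X W Y"
    using container[OF GV A_def par] unfolding \<delta>_def \<eta> by metis
  define code where "code Y' = {0} \<times> T \<union> {1} \<times> Z \<union> {2} \<times> X \<union> {3} \<times> W \<union> {4::nat} \<times> Y'" for Y'
  have im: "code Y' `` {0} = T" "code Y' `` {1} = Z" "code Y' `` {2} = X" "code Y' `` {3} = W"
    "code Y' `` {4} = Y'" for Y'
    by (auto simp: code_def)
  have codesub: "Y' \<subseteq> V \<Longrightarrow> code Y' \<subseteq> {..<5} \<times> (U \<union> V)" for Y' using sub by (auto simp: code_def)
  have cardcode: "card (code Y') \<le> card T + card Z + card X + card W + card Y'" for Y'
  proof -
    have "card (code Y') \<le> card ({0::nat} \<times> T) + card ({1::nat} \<times> Z) + card ({2::nat} \<times> X)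
        + card ({3::nat} \<times> W) + card ({4::nat} \<times> Y')"
      unfolding code_def by (intro order_trans[OF card_Un_le] add_mono order_refl)
    then show ?thesis by (simp add: card_cartesian_product)
  qed
  from alt show ?thesis
  proof
    assume h: "A \<subseteq> approx_closure \<psi> T Z X W \<and>
       real (card (approx_closure \<psi> T Z X W)) \<le> card G - \<kappa> / 4 * \<delta>"
    have "real (card (code {})) \<le> \<eta> * \<delta>" using cardcode[of "{}"] cT by simp
    then have "\<Lambda> * card (code {}) \<le> \<Lambda> * (\<eta> * \<delta>)" using \<Lambda> by (intro mult_left_mono)
    moreover have "(\<eta> * \<Lambda> + \<rho>) * \<delta> \<le> \<kappa> / 4 * \<delta>" using \<Lambda> \<delta>0 by (intro mult_right_mono)
    ultimately have "real (card (decode \<psi> False (code {}))) + \<Lambda> * card (code {}) + \<rho> * (card F / k)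
        \<le> card G"
      using h \<rho>F by (simp add: decode_def im algebra_simps del: One_nat_def)
    then show ?thesis
      using that[of "code {}" False] codesub[of "{}"] h FA by (auto simp: decode_def im G_def simp del: One_nat_def)
  next
    assume h: "A = exact_closure \<psi> T Z X W Y"
    have "real (card (code Y)) \<le> (\<eta> + \<kappa>) * \<delta>"
      using cardcode[of Y] cT cY by (simp add: algebra_simps)
    then have "\<Lambda> * card (code Y) \<le> \<Lambda> * ((\<eta> + \<kappa>) * \<delta>)" using \<Lambda> by (intro mult_left_mono)
    moreover have "((\<eta> + \<kappa>) * \<Lambda> + \<rho>) * \<delta> \<le> 1 * \<delta>" using \<Lambda> \<delta>0 by (intro mult_right_mono)
    ultimately have "real (card A) + \<Lambda> * card (code Y) + \<rho> * (card F / k) \<le> card G"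
      using \<rho>F by (simp add: \<delta>_def algebra_simps)
    moreover have "decode \<psi> True (code Y) = A" by (simp add: decode_def im h del: One_nat_def)
    ultimately show ?thesis
      using that[of "code Y" True] codesub[OF sub(5)] FA by (simp add: G_def)
  qed
qed

text \<open>Weighting a code \<open>K\<close> by \<open>\<lambda> ^ card K\<close> replaces the count of small codes.\<close>

lemma weighted_shadow_sum:
  fixes \<eta> \<kappa> \<theta> R J d\<^sub>0 \<psi> \<Lambda> \<rho> t s :: real
  assumes par: "0 < \<theta>" "0 < R" "0 < J" "0 < d\<^sub>0" "d\<^sub>0 \<le> real d - \<theta> - R / J"
      "0 < \<psi>" "\<psi> \<le> real k / 2" "0 < \<kappa>" "\<kappa> \<le> 1" "\<psi> \<le> \<kappa> * real k / 8"
    and \<Lambda>: "0 \<le> \<Lambda>" "(\<eta> + \<kappa>) * \<Lambda> + \<rho> \<le> 1" "\<eta> * \<Lambda> + \<rho> \<le> \<kappa> / 4" "0 \<le> \<rho>"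
    and X: "finite \<X>" "\<And>x. x \<in> \<X> \<Longrightarrow> f x \<subseteq> U"
    and few: "\<And>C. C \<subseteq> U \<Longrightarrow> real (card {x\<in>\<X>. f x \<subseteq> C}) \<le> 2 ^ card C * s"
    and \<eta>: "\<eta> = k * (1 + \<theta>) / R + (k * (J + 1) / d\<^sub>0 + k / \<theta> + 2) / \<psi>"
  shows "(\<Sum>x\<in>{x\<in>\<X>. t \<le> card (f x)}. 2 powr - real (card (shadow (f x))))
      \<le> 2 powr (- \<rho> * t / k) * (2 * exp (2 powr - \<Lambda> * real (5 * card (U \<union> V)))) * s"
proof -
  define P :: "(nat \<times> 'a) set" where "P = {..<5} \<times> (U \<union> V)"
  define l where "l = 2 powr - \<Lambda>"
  have finP: "finite P" using finite_U finite_V by (simp add: P_def)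
  have kpos: "0 < k" using degrees by simp
  have fin: "finite (UNIV \<times> Pow P :: (bool \<times> (nat \<times> 'a) set) set)" using finP by simp
  define w where "w c = l ^ card (snd c) * 2 powr - real (card (decode \<psi> (fst c) (snd c)))"
    for c :: "bool \<times> (nat \<times> 'a) set"
  have w0: "0 \<le> w c" for c by (simp add: w_def l_def)
  define good where "good x c \<longleftrightarrow> f x \<subseteq> decode \<psi> (fst c) (snd c)" for x c
  \<comment> \<open>The code of \<open>f x\<close> given by \<open>container_code\<close> alone pays
    for \<open>x\<close>; all other codes contribute nonnegative terms.\<close>
  have one: "2 powr - real (card (shadow (f x)))
      \<le> 2 powr (- \<rho> * t / k) * (\<Sum>c\<in>UNIV \<times> Pow P. if good x c then w c else 0)"
    if x: "x \<in> \<X>" "t \<le> card (f x)" for x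
  proof -
    obtain b K where K: "K \<subseteq> P" "f x \<subseteq> decode \<psi> b K"
      "real (card (decode \<psi> b K)) + \<Lambda> * card K + \<rho> * (card (f x) / k) \<le> card (shadow (f x))"
      using container_code[OF X(2)[OF x(1)] par \<Lambda> \<eta>] unfolding P_def by metis
    have "\<rho> * t / k \<le> \<rho> * (card (f x) / k)"
      using x(2) \<Lambda> kpos by (simp add: divide_right_mono mult_left_mono)
    then have "- real (card (shadow (f x))) \<le> - \<rho> * t / k + (- \<Lambda> * card K - real (card (decode \<psi> b K)))"
      using K(3) by simp
    then have "2 powr - real (card (shadow (f x)))
        \<le> 2 powr (- \<rho> * t / k + (- \<Lambda> * card K - real (card (decode \<psi> b K))))"
      by (intro powr_mono) auto
    also have "\<dots> = 2 powr (- \<rho> * t / k) * w (b, K)"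
    proof -
      have "l ^ card K = 2 powr (- \<Lambda> * card K)" by (simp add: l_def powr_powr flip: powr_realpow)
      then show ?thesis by (simp add: w_def powr_add powr_diff powr_minus divide_inverse)
    qed
    also have "\<dots> \<le> 2 powr (- \<rho> * t / k) * (\<Sum>c\<in>UNIV \<times> Pow P. if good x c then w c else 0)"
    proof (rule mult_left_mono)
      have "(if good x (b, K) then w (b, K) else 0)
          \<le> (\<Sum>c\<in>UNIV \<times> Pow P. if good x c then w c else 0)"
        using K fin w0 by (intro member_le_sum) auto
      then show "w (b, K) \<le> (\<Sum>c\<in>UNIV \<times> Pow P. if good x c then w c else 0)"
        using K by (simp add: good_def)
    qed simp
    finally show ?thesis .
  qed
  let ?Y = "{x\<in>\<X>. t \<le> card (f x)}"
  have "(\<Sum>x\<in>?Y. 2 powr - real (card (shadow (f x))))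
      \<le> (\<Sum>x\<in>?Y. 2 powr (- \<rho> * t / k) * (\<Sum>c\<in>UNIV \<times> Pow P. if good x c then w c else 0))"
    using one by (intro sum_mono) auto
  also have "\<dots> \<le> (\<Sum>x\<in>\<X>. 2 powr (- \<rho> * t / k) * (\<Sum>c\<in>UNIV \<times> Pow P. if good x c then w c else 0))"
    using X(1) w0 by (intro sum_mono2) (auto intro!: mult_nonneg_nonneg sum_nonneg)
  also have "\<dots> = 2 powr (- \<rho> * t / k) * (\<Sum>c\<in>UNIV \<times> Pow P. \<Sum>x\<in>\<X>. if good x c then w c else 0)"
    by (simp add: sum_distrib_left[symmetric] sum.swap[of _ \<X>])
  \<comment> \<open>For a fixed code the factor \<open>2 powr - card C\<close> in its weight cancels
    the \<open>2 ^ card C\<close> in \<open>few\<close>, so only the price of the code and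
    \<open>s\<close> survive.\<close>
  also have "\<dots> \<le> 2 powr (- \<rho> * t / k) * (\<Sum>c\<in>(UNIV::bool set) \<times> Pow P. l ^ card (snd c) * s)"
  proof (rule mult_left_mono, rule sum_mono)
    fix c :: "bool \<times> (nat \<times> 'a) set"
    assume "c \<in> UNIV \<times> Pow P"
    let ?C = "decode \<psi> (fst c) (snd c)"
    have "(\<Sum>x\<in>\<X>. if good x c then w c else 0) = w c * real (card {x\<in>\<X>. f x \<subseteq> ?C})"
      using X(1) by (simp add: sum.If_cases good_def Int_def)
    also have "\<dots> \<le> w c * (2 ^ card ?C * s)"
      using few[OF decode_subset] w0 by (intro mult_left_mono)
    also have "\<dots> = l ^ card (snd c) * s"
      by (simp add: w_def powr_minus powr_realpow)
    finally show "(\<Sum>x\<in>\<X>. if good x c then w c else 0) \<le> l ^ card (snd c) * s" .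
  qed simp
  also have "(\<Sum>c\<in>(UNIV::bool set) \<times> Pow P. l ^ card (snd c) * s) = 2 * (1 + l) ^ card P * s"
  proof -
    have "(\<Sum>c\<in>(UNIV::bool set) \<times> Pow P. l ^ card (snd c) * s)
        = (\<Sum>b\<in>(UNIV::bool set). \<Sum>K\<in>Pow P. l ^ card K * s)"
      unfolding sum.cartesian_product by (simp add: case_prod_beta)
    also have "\<dots> = 2 * (\<Sum>K\<in>Pow P. l ^ card K * s)" by simp
    also have "\<dots> = 2 * (1 + l) ^ card P * s"
      using sum_Pow_power_card[OF finP, of l] by (simp flip: sum_distrib_right)
    finally show ?thesis .
  qed
  also have "2 powr (- \<rho> * t / k) * (2 * (1 + l) ^ card P * s)
      \<le> 2 powr (- \<rho> * t / k) * (2 * exp (l * real (5 * card (U \<union> V)))) * s"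
  proof -
    have "0 \<le> s" using few[of "{}"] by simp
    moreover have "(1 + l) ^ card P \<le> exp (l * real (card P))"
      by (rule one_plus_power_le_exp) (simp add: l_def)
    moreover have "card P = 5 * card (U \<union> V)" by (simp add: P_def card_cartesian_product)
    ultimately have "(1 + l) ^ card P * s \<le> exp (l * real (5 * card (U \<union> V))) * s"
      by (intro mult_right_mono) auto
    then show ?thesis by (simp add: mult.assoc)
  qed
  finally show ?thesis by (simp add: l_def)
qed

end

section \<open>The layers above the middle\<close>

lemma two_powr_neg_le_one: "0 \<le> x \<Longrightarrow> 2 powr - x \<le> (1 :: real)"
  using powr_mono[of "- x" 0 2] by simp

definition layer :: "nat \<Rightarrow> nat \<Rightarrow> nat set set" where
  "layer n k = {x. x \<subseteq> {1..n} \<and> card x = k}"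

definition facets :: "nat set \<Rightarrow> nat set set" where
  "facets x = (\<lambda>v. x - {v}) ` x"

definition facet_shadow :: "nat set set \<Rightarrow> nat set set" where
  "facet_shadow F = (\<Union>x\<in>F. facets x)"

lemma finite_layer [simp]: "finite (layer n k)"
  by (rule finite_subset[of _ "Pow {1..n}"]) (auto simp: layer_def)

lemma card_layer: "card (layer n k) = n choose k"
  using n_subsets[of "{1..n}" k] by (simp add: layer_def)

lemma layer_finite: "x \<in> layer n k \<Longrightarrow> finite x"
  by (auto simp: layer_def intro: finite_subset)

lemma card_facets: "card (facets x) = card x"
  unfolding facets_def by (rule card_image) (auto simp: inj_on_def)

lemma facet_iff: "finite x \<Longrightarrow> y \<in> facets x \<longleftrightarrow> y \<subseteq> x \<and> card x = Suc (card y)"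
proof
  assume fin: "finite x" and "y \<in> facets x"
  then obtain v where "v \<in> x" "y = x - {v}" by (auto simp: facets_def)
  then show "y \<subseteq> x \<and> card x = Suc (card y)" using card_Suc_Diff1[OF fin] by auto
next
  assume fin: "finite x" and y: "y \<subseteq> x \<and> card x = Suc (card y)"
  have "card (x - y) = 1" using y finite_subset[OF _ fin] by (subst card_Diff_subset) auto
  then obtain v where "x - y = {v}" by (auto simp: card_1_singleton_iff)
  then have "v \<in> x" "y = x - {v}" using y by auto
  then show "y \<in> facets x" by (auto simp: facets_def)
qed

lemma facets_layer: "x \<in> layer n (Suc k) \<Longrightarrow> facets x \<subseteq> layer n k"
  by (auto simp: layer_def facets_def card_Diff_singleton_if)

lemma facet_shadow_layer: "F \<subseteq> layer n (Suc k) \<Longrightarrow> facet_shadow F \<subseteq> layer n k"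
  using facets_layer by (fastforce simp: facet_shadow_def)

lemma card_cofacets:
  assumes "y \<in> layer n k"
  shows "card {x\<in>layer n (Suc k). y \<in> facets x} = n - k"
proof -
  have fin: "finite y" using assms layer_finite by blast
  have "{x\<in>layer n (Suc k). y \<in> facets x} = (\<lambda>w. insert w y) ` ({1..n} - y)"
  proof (intro equalityI subsetI)
    fix x assume "x \<in> {x\<in>layer n (Suc k). y \<in> facets x}"
    then obtain v where "v \<in> x" "y = x - {v}" "x \<subseteq> {1..n}" by (auto simp: facets_def layer_def)
    then show "x \<in> (\<lambda>w. insert w y) ` ({1..n} - y)" by (auto intro!: image_eqI[of _ _ v])
  next
    fix x assume "x \<in> (\<lambda>w. insert w y) ` ({1..n} - y)"
    then show "x \<in> {x\<in>layer n (Suc k). y \<in> facets x}"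
      using assms fin by (force simp: layer_def facets_def)
  qed
  moreover have "inj_on (\<lambda>w. insert w y) ({1..n} - y)" by (auto simp: inj_on_def)
  moreover have "card ({1..n} - y) = n - k" using assms fin by (simp add: layer_def card_Diff_subset)
  ultimately show ?thesis by (simp add: card_image)
qed

lemma card_common_facets:
  assumes "x \<in> layer n k" "x' \<in> layer n k" "x \<noteq> x'"
  shows "card (facets x \<inter> facets x') \<le> 1"
proof -
  have fin: "finite x" "finite x'" using assms layer_finite by blast+
  have "facets x \<inter> facets x' \<subseteq> {x \<inter> x'}"
  proof
    fix y assume "y \<in> facets x \<inter> facets x'"
    then have y: "y \<subseteq> x \<inter> x'" "card x = Suc (card y)" using fin by (auto simp: facet_iff)
    have "x \<inter> x' \<noteq> x"
    proof
      assume "x \<inter> x' = x"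
      then have "x = x'" using assms fin by (intro card_seteq) (auto simp: layer_def)
      then show False using assms by simp
    qed
    then have "card (x \<inter> x') < card x" using fin by (intro psubset_card_mono) auto
    then have "y = x \<inter> x'" using y fin by (intro card_seteq) auto
    then show "y \<in> {x \<inter> x'}" by simp
  qed
  then have "card (facets x \<inter> facets x') \<le> card {x \<inter> x'}" by (intro card_mono) auto
  then show ?thesis by simp
qed

lemma biregular_layers:
  assumes "n < 2 * k + 1"
  shows "biregular (layer n (Suc k)) (layer n k) facets (Suc k) (n - k)"
proof
  show "n - k < Suc k" using assms by simp
  show "card (facets u \<inter> facets u') \<le> 1"
    if "u \<in> layer n (Suc k)" "u' \<in> layer n (Suc k)" "u \<noteq> u'" for u u'
    using card_common_facets that .
  show "card {u \<in> layer n (Suc k). v \<in> facets u} = n - k" if "v \<in> layer n k" for v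
    using card_cofacets that .
  show "card (facets u) = Suc k" if "u \<in> layer n (Suc k)" for u
    using that by (simp add: card_facets layer_def)
qed (use facets_layer in auto)

section \<open>Partition sums over the part of a complex above a given layer\<close>

definition upper_complexes :: "nat \<Rightarrow> nat \<Rightarrow> nat set set set" where
  "upper_complexes n k = {\<Gamma>. \<Gamma> \<subseteq> {x. x \<subseteq> {1..n} \<and> k \<le> card x} \<and>
     (\<forall>x\<in>\<Gamma>. \<forall>y\<subseteq>x. k \<le> card y \<longrightarrow> y \<in> \<Gamma>)}"

definition level :: "nat \<Rightarrow> nat set set \<Rightarrow> nat set set" where
  "level k \<Gamma> = {x\<in>\<Gamma>. card x = k}"

definition shadow_weight :: "nat \<Rightarrow> nat set set \<Rightarrow> real" where
  "shadow_weight k \<Gamma> = 2 powr - real (card (facet_shadow (level k \<Gamma>)))"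

text \<open>For positive \<open>k\<close>, multiplication by
  \<open>2 ^ card (layer n (k - 1))\<close> gives the number of upper complexes from layer
  \<open>k - 1\<close> on: each weight is the proportion of families in layer \<open>k - 1\<close>
  that contain the forced shadow.\<close>

definition partition_sum :: "nat \<Rightarrow> nat \<Rightarrow> real" where
  "partition_sum n k = (\<Sum>\<Gamma>\<in>upper_complexes n k. shadow_weight k \<Gamma>)"

lemma upper_complexes_subset_Pow: "\<Gamma> \<in> upper_complexes n k \<Longrightarrow> \<Gamma> \<subseteq> Pow {1..n}"
  by (auto simp: upper_complexes_def)

lemma finite_upper_complexes [simp]: "finite (upper_complexes n k)"
  by (rule finite_subset[of _ "Pow (Pow {1..n})"]) (auto simp: upper_complexes_def)

lemma level_subset_layer: "\<Gamma> \<subseteq> Pow {1..n} \<Longrightarrow> level k \<Gamma> \<subseteq> layer n k"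
  by (auto simp: level_def layer_def)

lemma facet_shadow_level:
  assumes "\<Gamma> \<in> upper_complexes n j" "j \<le> k"
  shows "facet_shadow (level (Suc k) \<Gamma>) \<subseteq> level k \<Gamma>"
proof
  fix y assume "y \<in> facet_shadow (level (Suc k) \<Gamma>)"
  then obtain x where x: "x \<in> \<Gamma>" "card x = Suc k" "y \<in> facets x"
    by (auto simp: facet_shadow_def level_def)
  have "finite x" using x(2) card.infinite by fastforce
  then have "y \<subseteq> x" "card y = k" using x by (auto simp: facet_iff)
  then show "y \<in> level k \<Gamma>" using x assms by (auto simp: level_def upper_complexes_def)
qed

lemma partition_sum_nonneg: "0 \<le> partition_sum n k"
  by (auto simp: partition_sum_def shadow_weight_def intro: sum_nonneg)

lemma card_interval:
  assumes "finite C" "S \<subseteq> C"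
  shows "real (card {B\<in>Pow C. S \<subseteq> B}) = 2 ^ card C / 2 ^ card S"
proof -
  have finS: "finite S" using assms finite_subset by blast
  have "{B\<in>Pow C. S \<subseteq> B} = (\<lambda>B. S \<union> B) ` Pow (C - S)"
  proof (intro equalityI subsetI)
    fix B assume "B \<in> {B\<in>Pow C. S \<subseteq> B}"
    then show "B \<in> (\<lambda>B. S \<union> B) ` Pow (C - S)" by (auto intro!: image_eqI[of _ _ "B - S"])
  qed (use assms in auto)
  moreover have "inj_on (\<lambda>B. S \<union> B) (Pow (C - S))" by (auto simp: inj_on_def)
  ultimately have "card {B\<in>Pow C. S \<subseteq> B} = 2 ^ (card C - card S)"
    using assms finS by (simp add: card_image card_Pow card_Diff_subset)
  then have "real (card {B\<in>Pow C. S \<subseteq> B}) = 2 ^ (card C - card S)" by simp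
  then show ?thesis using card_mono[OF assms] by (simp add: power_diff)
qed

lemma card_interval_le:
  assumes "finite C"
  shows "real (card {F. S \<subseteq> F \<and> F \<subseteq> C}) \<le> 2 ^ card C * 2 powr - real (card S)"
proof (cases "S \<subseteq> C")
  case True
  have "{F. S \<subseteq> F \<and> F \<subseteq> C} = {F\<in>Pow C. S \<subseteq> F}" by auto
  then show ?thesis using card_interval[OF assms True] by (simp add: powr_minus powr_realpow divide_inverse)
next
  case False
  then have e: "{F. S \<subseteq> F \<and> F \<subseteq> C} = {}" by auto
  show ?thesis unfolding e by simp
qed

text \<open>Once the layers above \<open>k\<close> are fixed, level \<open>k\<close> is a family
  between their shadow and \<open>C\<close>. This supplies the hypothesis \<open>few\<close> of the
  weighted sum with \<open>s = partition_sum n (Suc k)\<close>, and so starts the recursion on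
  layers.\<close>

lemma card_upper_complexes_le:
  assumes "C \<subseteq> layer n k"
  shows "real (card {\<Gamma>\<in>upper_complexes n k. level k \<Gamma> \<subseteq> C}) \<le> 2 ^ card C * partition_sum n (Suc k)"
proof -
  have finC: "finite C" using finite_subset[OF assms finite_layer] .
  let ?S = "SIGMA \<Gamma>':upper_complexes n (Suc k). {F. facet_shadow (level (Suc k) \<Gamma>') \<subseteq> F \<and> F \<subseteq> C}"
  let ?f = "\<lambda>\<Gamma>. (\<Gamma> - level k \<Gamma>, level k \<Gamma>)"
  have finI: "finite {F. S \<subseteq> F \<and> F \<subseteq> C}" for S
    by (rule finite_subset[of _ "Pow C"]) (use finC in auto)
  have "?f ` {\<Gamma>\<in>upper_complexes n k. level k \<Gamma> \<subseteq> C} \<subseteq> ?S"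
  proof
    fix p assume "p \<in> ?f ` {\<Gamma>\<in>upper_complexes n k. level k \<Gamma> \<subseteq> C}"
    then obtain \<Gamma> where p: "p = ?f \<Gamma>" and \<Gamma>: "\<Gamma> \<in> upper_complexes n k" "level k \<Gamma> \<subseteq> C" by auto
    have "\<Gamma> - level k \<Gamma> \<in> upper_complexes n (Suc k)"
      using \<Gamma>(1) by (fastforce simp: upper_complexes_def level_def)
    moreover have "level (Suc k) (\<Gamma> - level k \<Gamma>) = level (Suc k) \<Gamma>" by (auto simp: level_def)
    ultimately show "p \<in> ?S" using p \<Gamma>(2) facet_shadow_level[OF \<Gamma>(1), of k] by auto
  qed
  moreover have "inj_on ?f {\<Gamma>\<in>upper_complexes n k. level k \<Gamma> \<subseteq> C}"
    by (auto simp: inj_on_def level_def)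
  moreover have finS: "finite ?S" using finI by (intro finite_SigmaI) auto
  ultimately have "card {\<Gamma>\<in>upper_complexes n k. level k \<Gamma> \<subseteq> C} \<le> card ?S"
    by (intro card_inj_on_le[of ?f])
  also have "card ?S = (\<Sum>\<Gamma>'\<in>upper_complexes n (Suc k).
      card {F. facet_shadow (level (Suc k) \<Gamma>') \<subseteq> F \<and> F \<subseteq> C})"
    using finI by (intro card_SigmaI) auto
  finally have "real (card {\<Gamma>\<in>upper_complexes n k. level k \<Gamma> \<subseteq> C})
      \<le> (\<Sum>\<Gamma>'\<in>upper_complexes n (Suc k). real (card {F. facet_shadow (level (Suc k) \<Gamma>') \<subseteq> F \<and> F \<subseteq> C}))"
    unfolding of_nat_sum[symmetric] of_nat_le_iff .
  also have "\<dots> \<le> (\<Sum>\<Gamma>'\<in>upper_complexes n (Suc k). 2 ^ card C * shadow_weight (Suc k) \<Gamma>')"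
    unfolding shadow_weight_def using card_interval_le[OF finC] by (intro sum_mono)
  finally show ?thesis by (simp add: partition_sum_def sum_distrib_left)
qed

text \<open>At or above the middle a family is no larger than its shadow. A bound for level
  \<open>k\<close> thus controls all of \<open>\<Gamma>\<close>, at the cost of a factor
  \<open>n + 1\<close>.\<close>

lemma card_level_antimono:
  assumes \<Gamma>: "\<Gamma> \<in> upper_complexes n k" and "n < 2 * k + 1" "k \<le> i"
  shows "card (level i \<Gamma>) \<le> card (level k \<Gamma>)"
  using assms(3)
proof (induction rule: dec_induct)
  case (step j)
  have sub: "\<Gamma> \<subseteq> Pow {1..n}" using upper_complexes_subset_Pow \<Gamma> .
  interpret biregular "layer n (Suc j)" "layer n j" facets "Suc j" "n - j"
    by (rule biregular_layers) (use assms step in auto)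
  have "card (level (Suc j) \<Gamma>) \<le> card (level j \<Gamma>)"
  proof (rule closed_counts(4))
    show "shadow (level (Suc j) \<Gamma>) \<subseteq> level j \<Gamma>"
      using facet_shadow_level[OF \<Gamma> step(1)] by (simp add: shadow_def facet_shadow_def)
  qed (use level_subset_layer[OF sub] in auto)
  then show ?case using step by simp
qed simp

text \<open>Rankin's trick: such a \<open>\<Gamma>\<close> has at most \<open>(n + 1) * t\<close>
  members, so \<open>l ^ card \<Gamma>\<close> times the compensating power is at least 1. Summing
  this over all families of subsets of \<open>{1..n}\<close> gives
  \<open>(1 + l) ^ 2 ^ n\<close>.\<close>

lemma card_small_upper_complexes:
  assumes "n < 2 * k + 1" and \<Lambda>: "0 \<le> \<Lambda>"
  shows "real (card {\<Gamma>\<in>upper_complexes n k. real (card (level k \<Gamma>)) \<le> t})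
     \<le> exp (2 powr - \<Lambda> * 2 ^ n) * 2 powr (\<Lambda> * ((real n + 1) * t))"
proof -
  define l where "l = 2 powr - \<Lambda>"
  let ?P = "Pow {1..n} :: nat set set"
  have l: "0 < l" "l \<le> 1" using two_powr_neg_le_one[OF \<Lambda>] by (auto simp: l_def)
  have one: "1 \<le> l ^ card \<Gamma> * 2 powr (\<Lambda> * ((real n + 1) * t))"
    if \<Gamma>: "\<Gamma> \<in> upper_complexes n k" "real (card (level k \<Gamma>)) \<le> t" for \<Gamma>
  proof -
    have "\<Gamma> = (\<Union>i\<in>{k..n}. level i \<Gamma>)"
    proof (intro equalityI subsetI)
      fix x assume x: "x \<in> \<Gamma>"
      then have "x \<subseteq> {1..n}" "k \<le> card x" using \<Gamma>(1) by (auto simp: upper_complexes_def)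
      moreover have "card x \<le> n" using card_mono[OF _ calculation(1)] by simp
      ultimately show "x \<in> (\<Union>i\<in>{k..n}. level i \<Gamma>)" using x by (auto simp: level_def)
    qed (auto simp: level_def)
    then have "card \<Gamma> \<le> (\<Sum>i\<in>{k..n}. card (level i \<Gamma>))" by (metis card_UN_le finite_atLeastAtMost)
    also have "\<dots> \<le> (\<Sum>i\<in>{k..n}. card (level k \<Gamma>))"
      using card_level_antimono[OF \<Gamma>(1) assms(1)] by (intro sum_mono) auto
    also have "\<dots> = card {k..n} * card (level k \<Gamma>)" by simp
    also have "\<dots> \<le> (n + 1) * card (level k \<Gamma>)" by (intro mult_le_mono1) simp
    finally have "real (card \<Gamma>) \<le> real ((n + 1) * card (level k \<Gamma>))"
      by (simp only: of_nat_le_iff)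
    then have "real (card \<Gamma>) \<le> (real n + 1) * real (card (level k \<Gamma>))"
      by (simp add: distrib_right)
    also have "\<dots> \<le> (real n + 1) * t" using \<Gamma>(2) by (intro mult_left_mono) auto
    finally have "\<Lambda> * real (card \<Gamma>) \<le> \<Lambda> * ((real n + 1) * t)" using \<Lambda> by (intro mult_left_mono)
    then have "1 \<le> 2 powr (- \<Lambda> * real (card \<Gamma>) + \<Lambda> * ((real n + 1) * t))"
      by (intro ge_one_powr_ge_zero) auto
    also have "\<dots> = l ^ card \<Gamma> * 2 powr (\<Lambda> * ((real n + 1) * t))"
      unfolding powr_add by (simp add: l_def powr_powr flip: powr_realpow)
    finally show ?thesis .
  qed
  let ?X = "{\<Gamma>\<in>upper_complexes n k. real (card (level k \<Gamma>)) \<le> t}"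
  have "real (card ?X) = (\<Sum>\<Gamma>\<in>?X. 1)" by simp
  also have "\<dots> \<le> (\<Sum>\<Gamma>\<in>?X. l ^ card \<Gamma> * 2 powr (\<Lambda> * ((real n + 1) * t)))"
    using one by (intro sum_mono) auto
  also have "\<dots> \<le> (\<Sum>\<Gamma>\<in>Pow ?P. l ^ card \<Gamma> * 2 powr (\<Lambda> * ((real n + 1) * t)))"
    using l upper_complexes_subset_Pow[of _ n k] by (intro sum_mono2) (blast | simp)+
  also have "\<dots> = (1 + l) ^ (2 ^ n) * 2 powr (\<Lambda> * ((real n + 1) * t))"
    using sum_Pow_power_card[of ?P l] by (simp add: card_Pow flip: sum_distrib_right)
  also have "\<dots> \<le> exp (l * 2 ^ n) * 2 powr (\<Lambda> * ((real n + 1) * t))"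
    using one_plus_power_le_exp[of l "2 ^ n"] l by (intro mult_right_mono) auto
  finally show ?thesis by (simp add: l_def)
qed

lemma partition_sum_small:
  assumes "n < 2 * k + 1" "real (n choose k) \<le> t" "0 \<le> \<Lambda>"
  shows "partition_sum n k \<le> exp (2 powr - \<Lambda> * 2 ^ n) * 2 powr (\<Lambda> * ((real n + 1) * t))"
proof -
  have "real (card (level k \<Gamma>)) \<le> t" if "\<Gamma> \<in> upper_complexes n k" for \<Gamma>
  proof -
    have "card (level k \<Gamma>) \<le> card (layer n k)"
      using level_subset_layer[OF upper_complexes_subset_Pow[OF that]] by (intro card_mono) auto
    then show ?thesis using assms(2) by (simp add: card_layer)
  qed
  then have e: "{\<Gamma>\<in>upper_complexes n k. real (card (level k \<Gamma>)) \<le> t} = upper_complexes n k" by auto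
  have "partition_sum n k \<le> (\<Sum>\<Gamma>\<in>upper_complexes n k. 1)"
    unfolding partition_sum_def shadow_weight_def by (intro sum_mono) (simp add: two_powr_neg_le_one)
  then show ?thesis using card_small_upper_complexes[OF assms(1,3), of t] unfolding e by simp
qed

definition good_parameters ::
    "real \<Rightarrow> real \<Rightarrow> real \<Rightarrow> real \<Rightarrow> real \<Rightarrow> real \<Rightarrow> real \<Rightarrow> real \<Rightarrow> nat \<Rightarrow> nat \<Rightarrow> bool" where
  "good_parameters \<theta> R J d\<^sub>0 \<psi> \<kappa> \<Lambda> \<rho> k d \<longleftrightarrow>
     0 < \<theta> \<and> 0 < R \<and> 0 < J \<and> 0 < d\<^sub>0 \<and> d\<^sub>0 \<le> real d - \<theta> - R / J \<and>
     0 < \<psi> \<and> \<psi> \<le> real k / 2 \<and> 0 < \<kappa> \<and> \<kappa> \<le> 1 \<and> \<psi> \<le> \<kappa> * real k / 8 \<and>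
     0 \<le> \<Lambda> \<and> 0 \<le> \<rho> \<and>
     (k * (1 + \<theta>) / R + (k * (J + 1) / d\<^sub>0 + k / \<theta> + 2) / \<psi> + \<kappa>) * \<Lambda> + \<rho> \<le> 1 \<and>
     (k * (1 + \<theta>) / R + (k * (J + 1) / d\<^sub>0 + k / \<theta> + 2) / \<psi>) * \<Lambda> + \<rho> \<le> \<kappa> / 4"

lemma large_level_sum:
  fixes t :: real
  assumes par: "good_parameters \<theta> R J d\<^sub>0 \<psi> \<kappa> \<Lambda> \<rho> (Suc k) (n - k)" and nk: "n < 2 * k + 1"
  shows "(\<Sum>\<Gamma>\<in>{\<Gamma>\<in>upper_complexes n (Suc k). t \<le> card (level (Suc k) \<Gamma>)}. shadow_weight (Suc k) \<Gamma>)
      \<le> 2 powr (- \<rho> * t / Suc k) * (2 * exp (2 powr - \<Lambda> * (5 * 2 ^ n))) * partition_sum n (Suc (Suc k))"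
proof -
  interpret biregular "layer n (Suc k)" "layer n k" facets "Suc k" "n - k"
    by (rule biregular_layers[OF nk])
  have "card (layer n (Suc k) \<union> layer n k) \<le> card (Pow {1..n})"
    by (intro card_mono) (auto simp: layer_def)
  then have "real (card (layer n (Suc k) \<union> layer n k)) \<le> real (card (Pow {1..n}))"
    by (simp only: of_nat_le_iff)
  then have c: "real (card (layer n (Suc k) \<union> layer n k)) \<le> 2 ^ n" by (simp add: card_Pow)
  have "(\<Sum>\<Gamma>\<in>{\<Gamma>\<in>upper_complexes n (Suc k). t \<le> card (level (Suc k) \<Gamma>)}.
        2 powr - real (card (shadow (level (Suc k) \<Gamma>))))
      \<le> 2 powr (- \<rho> * t / Suc k)
        * (2 * exp (2 powr - \<Lambda> * real (5 * card (layer n (Suc k) \<union> layer n k))))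
        * partition_sum n (Suc (Suc k))"
    using par unfolding good_parameters_def
    by (intro weighted_shadow_sum[where \<theta> = \<theta> and R = R and J = J and d\<^sub>0 = d\<^sub>0 and \<psi> = \<psi> and \<kappa> = \<kappa>,
          OF _ _ _ _ _ _ _ _ _ _ _ _ _ _ _ _ _ refl])
      (auto intro: card_upper_complexes_le dest!: upper_complexes_subset_Pow level_subset_layer)
  also have "\<dots> \<le> 2 powr (- \<rho> * t / Suc k) * (2 * exp (2 powr - \<Lambda> * (5 * 2 ^ n)))
        * partition_sum n (Suc (Suc k))"
    using c by (intro mult_right_mono mult_left_mono partition_sum_nonneg) auto
  finally show ?thesis by (simp add: shadow_weight_def shadow_def facet_shadow_def)
qed

text \<open>The \<open>\<Gamma>\<close> with level at most \<open>t\<close> are counted with weight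
  at most 1. For the others the gain \<open>2 powr (- \<rho> * t / Suc k)\<close> absorbs the cost
  of the codes, so the next partition sum enters with factor 1 and the errors of the layers add up
  instead of multiplying.\<close>

lemma partition_sum_step:
  assumes par: "good_parameters \<theta> R J d\<^sub>0 \<psi> \<kappa> \<Lambda> \<rho> (Suc k) (n - k)" and nk: "n < 2 * k + 1"
    and t: "2 powr (- \<rho> * t / Suc k) * (2 * exp (2 powr - \<Lambda> * (5 * 2 ^ n))) \<le> 1"
  shows "partition_sum n (Suc k)
    \<le> exp (2 powr - \<Lambda> * 2 ^ n) * 2 powr (\<Lambda> * ((real n + 1) * t)) + partition_sum n (Suc (Suc k))"
proof -
  let ?w = "shadow_weight (Suc k)"
  let ?S = "{\<Gamma>\<in>upper_complexes n (Suc k). real (card (level (Suc k) \<Gamma>)) \<le> t}"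
  let ?L = "{\<Gamma>\<in>upper_complexes n (Suc k). t \<le> card (level (Suc k) \<Gamma>)}"
  have w0: "0 \<le> ?w \<Gamma>" and w1: "?w \<Gamma> \<le> 1" for \<Gamma>
    by (auto simp: shadow_weight_def two_powr_neg_le_one)
  have "partition_sum n (Suc k) = sum ?w (?S \<union> ?L)"
    unfolding partition_sum_def by (rule sum.cong) auto
  also have "\<dots> \<le> sum ?w ?S + sum ?w ?L"
    using sum_nonneg[of "?S \<inter> ?L" ?w] w0 by (subst sum_Un) auto
  also have "sum ?w ?S \<le> (\<Sum>\<Gamma>\<in>?S. 1)" using w1 by (intro sum_mono)
  also have "(\<Sum>\<Gamma>\<in>?S. 1) \<le> exp (2 powr - \<Lambda> * 2 ^ n) * 2 powr (\<Lambda> * ((real n + 1) * t))"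
    using card_small_upper_complexes[of n "Suc k" \<Lambda> t] par nk by (simp add: good_parameters_def)
  also have "sum ?w ?L \<le> partition_sum n (Suc (Suc k))"
  proof -
    have "sum ?w ?L \<le> 2 powr (- \<rho> * t / Suc k) * (2 * exp (2 powr - \<Lambda> * (5 * 2 ^ n)))
        * partition_sum n (Suc (Suc k))"
      by (rule large_level_sum[OF par nk])
    also have "\<dots> \<le> 1 * partition_sum n (Suc (Suc k))"
      using t by (intro mult_right_mono partition_sum_nonneg)
    finally show ?thesis by simp
  qed
  finally show ?thesis by simp
qed

text \<open>The recursion is run down from layer \<open>Suc K\<close>, which as a whole has at most
  \<open>t\<close> members, so that no containers are needed there.\<close>

lemma partition_sum_le:
  assumes "k \<le> K" and nk: "n < 2 * k + 1"
    and par: "\<And>j. k \<le> j \<Longrightarrow> j < K \<Longrightarrow> good_parameters \<theta> R J d\<^sub>0 \<psi> \<kappa> \<Lambda> \<rho> (Suc j) (n - j)"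
    and t: "\<And>j. k \<le> j \<Longrightarrow> j < K \<Longrightarrow> 2 powr (- \<rho> * t / Suc j) * (2 * exp (2 powr - \<Lambda> * (5 * 2 ^ n))) \<le> 1"
    and K: "real (n choose Suc K) \<le> t" and "0 \<le> \<Lambda>"
  shows "partition_sum n (Suc k)
    \<le> real (K - k + 1) * (exp (2 powr - \<Lambda> * 2 ^ n) * 2 powr (\<Lambda> * ((real n + 1) * t)))"
  using assms(1) nk par t
proof (induction rule: inc_induct)
  case base
  then show ?case using partition_sum_small[of n "Suc K" t \<Lambda>] K \<open>0 \<le> \<Lambda>\<close> by simp
next
  case (step j)
  have "partition_sum n (Suc j) \<le> exp (2 powr - \<Lambda> * 2 ^ n) * 2 powr (\<Lambda> * ((real n + 1) * t))
      + partition_sum n (Suc (Suc j))"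
    by (rule partition_sum_step) (use step in auto)
  moreover have "partition_sum n (Suc (Suc j))
      \<le> real (K - Suc j + 1) * (exp (2 powr - \<Lambda> * 2 ^ n) * 2 powr (\<Lambda> * ((real n + 1) * t)))"
    by (rule step.IH) (use step in auto)
  moreover have "real (K - j + 1) = 1 + real (K - Suc j + 1)" using step by simp
  ultimately show ?case by (simp only: distrib_right)
qed

section \<open>From upper complexes to random simplicial complexes\<close>

lemma simplicial_complexesI:
  assumes "\<Delta> \<subseteq> Pow {1..n}" "{} \<notin> \<Delta>" "\<And>x y. x \<in> \<Delta> \<Longrightarrow> y \<subseteq> x \<Longrightarrow> y \<noteq> {} \<Longrightarrow> y \<in> \<Delta>"
  shows "\<Delta> \<in> simplicial_complexes n"
  using assms unfolding simplicial_complexes_def by blast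

lemma face_mono:
  "\<Delta> \<in> simplicial_complexes n \<Longrightarrow> x \<in> \<Delta> \<Longrightarrow> y \<subseteq> x \<Longrightarrow> y \<noteq> {} \<Longrightarrow> y \<in> \<Delta>"
  unfolding simplicial_complexes_def by blast

lemma face_subset: "\<Delta> \<in> simplicial_complexes n \<Longrightarrow> x \<in> \<Delta> \<Longrightarrow> x \<subseteq> {1..n}"
  unfolding simplicial_complexes_def by blast

lemma finite_face: "\<Delta> \<in> simplicial_complexes n \<Longrightarrow> x \<in> \<Delta> \<Longrightarrow> finite x"
  by (rule finite_subset[OF face_subset]) auto

definition lower_complexes :: "nat \<Rightarrow> nat \<Rightarrow> nat set set set" where
  "lower_complexes n m = {\<Delta>\<in>simplicial_complexes n. \<forall>x\<in>\<Delta>. card x \<le> m}"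

text \<open>Members of \<open>B\<close> have the largest size that occurs, so any of them can be
  removed without leaving the complexes. Each \<open>\<Delta>\<close> yields
  \<open>2 ^ card B\<close> complexes, and both \<open>\<Delta>\<close> and the removed part can be
  read off from the result, since \<open>B \<subseteq> \<Delta>\<close>.\<close>

lemma card_lower_complexes_containing:
  assumes B: "B \<subseteq> layer n m"
  shows "real (card {\<Delta>\<in>lower_complexes n m. B \<subseteq> \<Delta>})
    \<le> card (simplicial_complexes n) * 2 powr - real (card B)"
proof -
  let ?L = "{\<Delta>\<in>lower_complexes n m. B \<subseteq> \<Delta>}"
  have finB: "finite B" using finite_subset[OF B finite_layer] .
  have fin: "finite (simplicial_complexes n)" by (rule finite_simplicial_complexes)
  let ?f = "\<lambda>(\<Delta>, Y). \<Delta> - Y"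
  have "?f ` (?L \<times> Pow B) \<subseteq> simplicial_complexes n"
  proof
    fix p assume "p \<in> ?f ` (?L \<times> Pow B)"
    then obtain \<Delta> Y where p: "p = \<Delta> - Y" "\<Delta> \<in> simplicial_complexes n" "\<forall>x\<in>\<Delta>. card x \<le> m" "Y \<subseteq> B"
      by (auto simp: lower_complexes_def)
    have "p \<subseteq> Pow {1..n}" "{} \<notin> p" using p by (auto simp: simplicial_complexes_def)
    moreover have "y \<in> p" if x: "x \<in> p" "y \<subseteq> x" "y \<noteq> {}" for x y
    proof -
      have y: "y \<in> \<Delta>" using x p face_mono by blast
      have finx: "finite x" using x p finite_face by blast
      have "y \<notin> Y"
      proof
        assume "y \<in> Y"
        then have "card y = m" using p B by (auto simp: layer_def)
        moreover have "card x \<le> m" using x p by auto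
        ultimately have "y = x" using x finx by (intro card_seteq) auto
        then show False using \<open>y \<in> Y\<close> x p by auto
      qed
      then show "y \<in> p" using y p by auto
    qed
    ultimately show "p \<in> simplicial_complexes n" by (intro simplicial_complexesI)
  qed
  moreover have "inj_on ?f (?L \<times> Pow B)" by (auto simp: inj_on_def)
  ultimately have "card (?L \<times> Pow B) \<le> card (simplicial_complexes n)"
    using fin by (intro card_inj_on_le[of ?f])
  then have "card ?L * 2 ^ card B \<le> card (simplicial_complexes n)"
    using finB by (simp add: card_cartesian_product card_Pow)
  then have "real (card ?L * 2 ^ card B) \<le> card (simplicial_complexes n)"
    by (simp only: of_nat_le_iff)
  then show ?thesis by (simp add: powr_minus powr_realpow field_simps)
qed

text \<open>Cut \<open>\<Delta>\<close> between the sizes \<open>m\<close> and \<open>m + 1\<close>.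
  The lower part has to contain the shadow of level \<open>m + 1\<close>, which costs the factor
  \<open>shadow_weight (Suc m) \<Gamma>\<close> compared with all complexes.\<close>

lemma card_complexes_large_level:
  fixes \<tau> :: real
  assumes "0 < m"
  shows "real (card {\<Delta>\<in>simplicial_complexes n. \<tau> \<le> card (level (Suc m) \<Delta>)})
    \<le> card (simplicial_complexes n)
      * (\<Sum>\<Gamma>\<in>{\<Gamma>\<in>upper_complexes n (Suc m). \<tau> \<le> card (level (Suc m) \<Gamma>)}. shadow_weight (Suc m) \<Gamma>)"
proof -
  let ?X = "{\<Delta>\<in>simplicial_complexes n. \<tau> \<le> card (level (Suc m) \<Delta>)}"
  let ?U = "{\<Gamma>\<in>upper_complexes n (Suc m). \<tau> \<le> card (level (Suc m) \<Gamma>)}"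
  let ?L = "\<lambda>\<Gamma>. {\<Delta>\<in>lower_complexes n m. facet_shadow (level (Suc m) \<Gamma>) \<subseteq> \<Delta>}"
  let ?f = "\<lambda>\<Delta>. ({x\<in>\<Delta>. Suc m \<le> card x}, {x\<in>\<Delta>. card x \<le> m})"
  have finL: "finite (?L \<Gamma>)" for \<Gamma>
    by (rule finite_subset[OF _ finite_simplicial_complexes]) (auto simp: lower_complexes_def)
  have "?f ` ?X \<subseteq> Sigma ?U ?L"
  proof
    fix p assume "p \<in> ?f ` ?X"
    then obtain \<Delta> where p: "p = ?f \<Delta>" and D: "\<Delta> \<in> simplicial_complexes n" "\<tau> \<le> card (level (Suc m) \<Delta>)"
      by auto
    let ?G = "{x\<in>\<Delta>. Suc m \<le> card x}" and ?H = "{x\<in>\<Delta>. card x \<le> m}"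
    note down = face_mono[OF D(1)] and finx = finite_face[OF D(1)]
    have e: "level (Suc m) ?G = level (Suc m) \<Delta>" by (auto simp: level_def)
    have "?G \<in> upper_complexes n (Suc m)"
    proof -
      have "y \<in> ?G" if "x \<in> ?G" "y \<subseteq> x" "Suc m \<le> card y" for x y
      proof -
        have "y \<noteq> {}" using that(3) by auto
        then show ?thesis using down[of x y] that by simp
      qed
      moreover have "?G \<subseteq> {x. x \<subseteq> {1..n} \<and> Suc m \<le> card x}"
        using face_subset[OF D(1)] by blast
      ultimately show ?thesis unfolding upper_complexes_def by blast
    qed
    moreover have "?H \<in> lower_complexes n m"
    proof -
      have "y \<in> ?H" if x: "x \<in> ?H" "y \<subseteq> x" "y \<noteq> {}" for x y
      proof -
        have "card y \<le> card x" using x finx by (intro card_mono) auto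
        then show ?thesis using down[of x y] x by simp
      qed
      moreover have "{} \<notin> ?H" using D(1) by (simp add: simplicial_complexes_def)
      moreover have "?H \<subseteq> Pow {1..n}" using face_subset[OF D(1)] by auto
      ultimately have "?H \<in> simplicial_complexes n" by (intro simplicial_complexesI)
      then show ?thesis by (simp add: lower_complexes_def)
    qed
    moreover have "facet_shadow (level (Suc m) \<Delta>) \<subseteq> ?H"
    proof
      fix y assume "y \<in> facet_shadow (level (Suc m) \<Delta>)"
      then obtain x where x: "x \<in> \<Delta>" "card x = Suc m" "y \<in> facets x"
        by (auto simp: facet_shadow_def level_def)
      then have y: "y \<subseteq> x" "card y = m" using finx by (auto simp: facet_iff)
      then have "y \<noteq> {}" using \<open>0 < m\<close> by auto
      then show "y \<in> ?H" using down[OF x(1) y(1)] y by simp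
    qed
    ultimately show "p \<in> Sigma ?U ?L" using p D(2) e by simp
  qed
  moreover have "inj_on ?f ?X"
  proof (rule inj_on_inverseI)
    show "fst (?f \<Delta>) \<union> snd (?f \<Delta>) = \<Delta>" for \<Delta> by auto
  qed
  moreover have finS: "finite (Sigma ?U ?L)" using finL by (intro finite_SigmaI) auto
  ultimately have "card ?X \<le> card (Sigma ?U ?L)"
    by (intro card_inj_on_le[of ?f])
  also have "\<dots> = (\<Sum>\<Gamma>\<in>?U. card (?L \<Gamma>))" using finL by (intro card_SigmaI) auto
  finally have "real (card ?X) \<le> (\<Sum>\<Gamma>\<in>?U. real (card (?L \<Gamma>)))" unfolding of_nat_sum[symmetric] of_nat_le_iff .
  also have "\<dots> \<le> (\<Sum>\<Gamma>\<in>?U. card (simplicial_complexes n) * shadow_weight (Suc m) \<Gamma>)"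
    unfolding shadow_weight_def
    by (intro sum_mono card_lower_complexes_containing facet_shadow_layer level_subset_layer
        upper_complexes_subset_Pow) auto
  finally show ?thesis by (simp add: sum_distrib_left)
qed

section \<open>Choice of the parameters\<close>

text \<open>Here \<open>k\<close> and \<open>d\<close> are of order \<open>m\<close>. The ratio
  \<open>R / J = m / 8\<close> leaves room for \<open>d\<^sub>0 = m / 4\<close>. The terms of
  \<open>\<eta>\<close> have orders \<open>m powr (-1/4)\<close> for \<open>T\<close> and
  \<open>Z\<close>, and \<open>m powr (1/2)\<close> and \<open>m powr (3/4)\<close> divided by
  \<open>\<psi> = m powr (7/8)\<close>, so \<open>\<eta>\<close> has order
  \<open>m powr (-1/8)\<close>. The value \<open>\<kappa> = m powr (-1/16)\<close> lies well between
  \<open>\<eta> * \<Lambda>\<close> and \<open>1 / \<Lambda>\<close>, as the budget conditions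
  demand, and well above \<open>\<psi> / m\<close>. With \<open>\<Lambda> = 12 * log 2 m\<close> a
  listed point has weight \<open>1 / m ^ 12\<close>.\<close>

lemma eventually_good_parameters:
  "\<forall>\<^sub>F m::nat in sequentially. \<forall>k d. m < k \<longrightarrow> 2 * k \<le> 3 * m \<longrightarrow> m \<le> 2 * d \<longrightarrow>
     good_parameters (real m powr (1/4)) (real m powr (3/2)) (8 * sqrt (real m)) (real m / 4)
       (real m powr (7/8)) (real m powr (-1/16)) (12 * log 2 (real m)) (1 / real m) k d"
proof -
  define \<theta> R J \<psi> \<kappa> \<Lambda> \<rho> where defs: "\<theta> = (\<lambda>m::nat. real m powr (1/4))"
    "R = (\<lambda>m::nat. real m powr (3/2))" "J = (\<lambda>m::nat. 8 * sqrt (real m))"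
    "\<psi> = (\<lambda>m::nat. real m powr (7/8))" "\<kappa> = (\<lambda>m::nat. real m powr (-1/16))"
    "\<Lambda> = (\<lambda>m::nat. 12 * log 2 (real m))" "\<rho> = (\<lambda>m::nat. 1 / real m)"
  define \<eta> where "\<eta> m x = x * (1 + \<theta> m) / R m + (x * (J m + 1) / (real m / 4) + x / \<theta> m + 2) / \<psi> m"
    for m x
  have e1: "\<forall>\<^sub>F m in sequentially. real m / 4 \<le> real m / 2 - \<theta> m - R m / J m"
    unfolding defs by real_asymp
  have e2: "\<forall>\<^sub>F m in sequentially. \<psi> m \<le> real m / 2" unfolding defs by real_asymp
  have e3: "\<forall>\<^sub>F m in sequentially. \<kappa> m \<le> 1" unfolding defs by real_asymp
  have e4: "\<forall>\<^sub>F m in sequentially. \<psi> m \<le> \<kappa> m * real m / 8" unfolding defs by real_asymp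
  have e5: "\<forall>\<^sub>F m in sequentially. (\<eta> m (3 / 2 * real m) + \<kappa> m) * \<Lambda> m + \<rho> m \<le> 1"
    unfolding defs \<eta>_def by real_asymp
  have e6: "\<forall>\<^sub>F m in sequentially. \<eta> m (3 / 2 * real m) * \<Lambda> m + \<rho> m \<le> \<kappa> m / 4"
    unfolding defs \<eta>_def by real_asymp
  show ?thesis using e1 e2 e3 e4 e5 e6 eventually_gt_at_top[of 0]
  proof eventually_elim
    case (elim m)
    have pos: "0 < \<theta> m" "0 < R m" "0 < J m" "0 < \<psi> m" "0 < \<kappa> m" "0 \<le> \<Lambda> m" "0 \<le> \<rho> m"
      using elim by (simp_all add: defs)
    show ?case
    proof (intro allI impI)
      fix k d :: nat assume k: "m < k" "2 * k \<le> 3 * m" and d: "m \<le> 2 * d"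
      have k': "real m \<le> k" "k \<le> 3 / 2 * real m" and d': "real m / 2 \<le> d" using k d by linarith+
      \<comment> \<open>\<open>\<eta>\<close> increases with \<open>k\<close>, so the largest
        admissible \<open>k\<close> is the worst case.\<close>
      have "\<eta> m k \<le> \<eta> m (3 / 2 * real m)"
        unfolding \<eta>_def using k' pos elim
        by (intro add_mono divide_right_mono mult_right_mono order_refl) auto
      then have "\<eta> m k * \<Lambda> m \<le> \<eta> m (3 / 2 * real m) * \<Lambda> m"
        and "(\<eta> m k + \<kappa> m) * \<Lambda> m \<le> (\<eta> m (3 / 2 * real m) + \<kappa> m) * \<Lambda> m"
        using pos by (intro mult_right_mono; simp)+
      moreover have "\<kappa> m * real m \<le> \<kappa> m * k" using k' pos by (intro mult_left_mono) auto
      ultimately have g: "(\<eta> m k + \<kappa> m) * \<Lambda> m + \<rho> m \<le> 1" "\<eta> m k * \<Lambda> m + \<rho> m \<le> \<kappa> m / 4"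
        "\<psi> m \<le> real k / 2" "\<psi> m \<le> \<kappa> m * real k / 8" "real m / 4 \<le> real d - \<theta> m - R m / J m"
        using elim k' d' by linarith+
      have "good_parameters (\<theta> m) (R m) (J m) (real m / 4) (\<psi> m) (\<kappa> m) (\<Lambda> m) (\<rho> m) k d"
        unfolding good_parameters_def
        by (intro conjI g[unfolded \<eta>_def] pos elim(3)) (use elim in simp)
      then show "good_parameters (real m powr (1/4)) (real m powr (3/2)) (8 * sqrt (real m)) (real m / 4)
        (real m powr (7/8)) (real m powr (-1/16)) (12 * log 2 (real m)) (1 / real m) k d"
        by (simp add: defs)
    qed
  qed
qed

lemma choose_times_power_le: "real (n choose k) * x ^ k \<le> (1 + x) ^ n" if "0 \<le> x"
proof (cases "k \<le> n")
  case True
  have "real (n choose k) * x ^ k \<le> (\<Sum>i\<le>n. real (n choose i) * x ^ i)"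
    using that True by (intro member_le_sum) auto
  then show ?thesis using binomial_ring[of x 1 n] by (simp add: add.commute)
next
  case False
  then show ?thesis using that by (simp add: binomial_eq_0)
qed

text \<open>\<open>large_level_sum\<close> at the threshold \<open>4 ^ m / m ^ 4\<close>, with the
  partition sum above bounded at the threshold \<open>4 ^ m / m ^ 8\<close>. In the exponent the
  gain has order \<open>4 ^ m / m ^ 6\<close>; it competes with \<open>4 ^ m / m ^ 12\<close> for
  the codes and \<open>log m * 4 ^ m / m ^ 7\<close> for the small upper complexes. This is the
  reason for the spacing of the powers 4, 8 and 12.\<close>

definition upper_error :: "nat \<Rightarrow> real" where
  "upper_error m = 2 powr (- (1 / real m) * (4 ^ m / real m ^ 4) / real (Suc m))
     * (2 * exp (5 * 4 ^ m / real m ^ 12))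
     * (real m * (exp (4 ^ m / real m ^ 12)
         * 2 powr (12 * log 2 (real m) * ((2 * real m + 1) * (4 ^ m / real m ^ 8)))))"

lemma upper_error_tendsto: "upper_error \<longlonglongrightarrow> 0"
proof -
  define E where "E m = - ln 2 * ((1 / real m) * (4 ^ m / real m ^ 4) / real (Suc m)) + ln 2
      + 5 * 4 ^ m / real m ^ 12 + ln (real m) + 4 ^ m / real m ^ 12
      + 12 * ln (real m) * ((2 * real m + 1) * (4 ^ m / real m ^ 8))" for m :: nat
  have "\<forall>\<^sub>F m in sequentially. exp (E m) = upper_error m"
    using eventually_gt_at_top[of 0]
  proof eventually_elim
    case (elim m)
    have p: "2 powr (x::real) = exp (ln 2 * x)" for x by (simp add: powr_def mult.commute)
    have l: "ln 2 * (12 * log 2 (real m) * y) = 12 * ln (real m) * y" for y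
      by (simp add: log_def)
    have "upper_error m = exp (ln 2 * (- (1 / real m) * (4 ^ m / real m ^ 4) / real (Suc m)))
        * (exp (ln 2) * exp (5 * 4 ^ m / real m ^ 12)) * (exp (ln (real m)) * (exp (4 ^ m / real m ^ 12)
         * exp (12 * ln (real m) * ((2 * real m + 1) * (4 ^ m / real m ^ 8)))))"
      using elim unfolding upper_error_def p l by simp
    then show ?case unfolding exp_add[symmetric] E_def by (simp add: add.assoc)
  qed
  moreover have "(\<lambda>m. exp (E m)) \<longlonglongrightarrow> 0" unfolding E_def by real_asymp
  ultimately show ?thesis by (rule Lim_transform_eventually[rotated])
qed

lemma eventually_few_complexes_large_level:
  "\<forall>\<^sub>F m in sequentially.
     real (card {\<Delta>\<in>simplicial_complexes (2 * m). 4 ^ m / real m ^ 4 \<le> card (level (Suc m) \<Delta>)})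
     \<le> card (simplicial_complexes (2 * m)) * upper_error m"
proof -
  have e1: "\<forall>\<^sub>F m::nat in sequentially.
      2 powr (- (1 / real m) * (4 ^ m / real m ^ 8) / (3 / 2 * real m)) * (2 * exp (5 * 4 ^ m / real m ^ 12)) \<le> 1"
  proof -
    have "\<forall>\<^sub>F m::nat in sequentially.
      - ln 2 * ((1 / real m) * (4 ^ m / real m ^ 8) / (3 / 2 * real m)) + (ln 2 + 5 * 4 ^ m / real m ^ 12) \<le> 0"
      by real_asymp
    then show ?thesis
    proof eventually_elim
      case (elim m)
      have "2 powr (- (1 / real m) * (4 ^ m / real m ^ 8) / (3 / 2 * real m)) * (2 * exp (5 * 4 ^ m / real m ^ 12))
        = exp (- ln 2 * ((1 / real m) * (4 ^ m / real m ^ 8) / (3 / 2 * real m))) * (exp (ln 2) * exp (5 * 4 ^ m / real m ^ 12))"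
        by (simp add: powr_def mult.commute)
      also have "\<dots> \<le> exp 0" unfolding exp_add[symmetric] using elim by (simp only: exp_le_cancel_iff)
      finally show ?case by simp
    qed
  qed
  have e2: "\<forall>\<^sub>F m::nat in sequentially. (45 / 14) ^ m \<le> 4 ^ m / real m ^ 8"
    by real_asymp
  show ?thesis using eventually_good_parameters e1 e2 eventually_gt_at_top[of 3]
  proof eventually_elim
    case (elim m)
    \<comment> \<open>Up to size about \<open>3 * m / 2\<close> a set still has at least
      \<open>m / 2\<close> cofacets, as the parameters require. Beyond that the layers are
      exponentially smaller than \<open>4 ^ m\<close> and the recursion may stop.\<close>
    define K where "K = m + m div 2"
    define \<Lambda> \<rho> t \<tau> where "\<Lambda> = 12 * log 2 (real m)" and "\<rho> = 1 / real m"
      and "t = 4 ^ m / real m ^ 8" and "\<tau> = 4 ^ m / real m ^ 4"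
    have \<Lambda>0: "0 \<le> \<Lambda>" using elim by (simp add: \<Lambda>_def)
    have pow: "2 powr - \<Lambda> * (c * 2 ^ (2 * m)) = c * 4 ^ m / real m ^ 12" for c
    proof -
      have "2 powr \<Lambda> = (2 powr log 2 (real m)) powr 12" by (simp add: \<Lambda>_def powr_powr mult.commute)
      also have "\<dots> = real m ^ 12" using elim by (simp add: powr_numeral)
      finally show ?thesis by (simp add: powr_minus power_mult divide_inverse)
    qed
    note pow1 = pow[of 1, simplified]
    note par = elim(1)[rule_format, folded \<Lambda>_def \<rho>_def]
    have Kbound: "2 * j \<le> 3 * m" if "j \<le> K" for j using that by (simp add: K_def)
    have part: "partition_sum (2 * m) (Suc (Suc m)) \<le> real (K - Suc m + 1) *
        (exp (2 powr - \<Lambda> * 2 ^ (2 * m)) * 2 powr (\<Lambda> * ((real (2 * m) + 1) * t)))"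
    proof (rule partition_sum_le)
      show "Suc m \<le> K" using elim by (simp add: K_def)
      show "good_parameters (real m powr (1/4)) (real m powr (3/2)) (8 * sqrt (real m)) (real m / 4)
        (real m powr (7/8)) (real m powr (-1/16)) \<Lambda> \<rho> (Suc j) (2 * m - j)" if "Suc m \<le> j" "j < K" for j
        by (rule par) (use that in \<open>auto simp: K_def\<close>)
      show "2 powr (- \<rho> * t / Suc j) * (2 * exp (2 powr - \<Lambda> * (5 * 2 ^ (2 * m)))) \<le> 1"
        if "Suc m \<le> j" "j < K" for j
      proof -
        have "2 * Suc j \<le> 3 * m" using Kbound[of "Suc j"] that by simp
        then have "real (2 * Suc j) \<le> real (3 * m)" by (simp only: of_nat_le_iff)
        then have "real (Suc j) \<le> 3 / 2 * real m" by simp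
        then have "\<rho> * t / (3 / 2 * real m) \<le> \<rho> * t / Suc j"
          using elim by (intro divide_left_mono) (auto simp: \<rho>_def t_def)
        then have "2 powr (- \<rho> * t / Suc j) \<le> 2 powr (- \<rho> * t / (3 / 2 * real m))"
          by (intro powr_mono) auto
        then have "2 powr (- \<rho> * t / Suc j) * (2 * exp (5 * 4 ^ m / real m ^ 12))
            \<le> 2 powr (- \<rho> * t / (3 / 2 * real m)) * (2 * exp (5 * 4 ^ m / real m ^ 12))"
          by (intro mult_right_mono) auto
        also have "\<dots> \<le> 1" using elim(2) by (simp add: \<rho>_def t_def)
        finally show ?thesis unfolding pow .
      qed
      show "real (2 * m choose Suc K) \<le> t"
      proof -
        \<comment> \<open>The binomial theorem at \<open>x = 2\<close> gives
          \<open>9 ^ m / 2 ^ Suc K\<close>. Here \<open>14 / 5\<close> is a rational stand-in for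
          \<open>2 powr (3/2)\<close>, as its square is less than 8, and the resulting base
          \<open>45 / 14\<close> is below 4.\<close>
        have "real (2 * m choose Suc K) * 2 ^ Suc K \<le> (1 + 2) ^ (2 * m)"
          by (rule choose_times_power_le) simp
        then have "real (2 * m choose Suc K) * 2 ^ Suc K \<le> 9 ^ m" by (simp add: power_mult)
        moreover have c: "(14 / 5) ^ m \<le> (2 :: real) ^ Suc K"
        proof (rule power2_le_imp_le)
          have "((14 / 5 :: real) ^ m)\<^sup>2 = (196 / 25) ^ m" by (simp add: power2_eq_square flip: power_mult_distrib)
          also have "\<dots> \<le> 8 ^ m" by (intro power_mono) auto
          also have "\<dots> = 2 ^ (3 * m)" by (simp add: power_mult)
          also have "\<dots> \<le> 2 ^ (2 * Suc K)" by (intro power_increasing) (auto simp: K_def)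
          also have "\<dots> = (2 ^ Suc K)\<^sup>2" by (metis mult.commute power_mult)
          finally show "((14 / 5 :: real) ^ m)\<^sup>2 \<le> (2 ^ Suc K)\<^sup>2" .
        qed simp
        have "real (2 * m choose Suc K) * (14 / 5) ^ m \<le> real (2 * m choose Suc K) * 2 ^ Suc K"
          by (intro mult_left_mono c) simp
        ultimately have "real (2 * m choose Suc K) \<le> 9 ^ m / (14 / 5) ^ m"
          by (simp add: pos_le_divide_eq)
        also have "\<dots> = (45 / 14) ^ m" unfolding power_divide[symmetric] by simp
        finally have "real (2 * m choose Suc K) \<le> (45 / 14) ^ m" .
        then show ?thesis using elim(3) by (simp add: t_def)
      qed
    qed (use \<Lambda>0 in auto)
    have Km: "real (K - Suc m + 1) \<le> real m" using elim by (simp add: K_def)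
    have part': "partition_sum (2 * m) (Suc (Suc m)) \<le> real m *
        (exp (4 ^ m / real m ^ 12) * 2 powr (\<Lambda> * ((2 * real m + 1) * t)))"
      using order_trans[OF part mult_right_mono[OF Km]] unfolding pow1 by simp
    have "(\<Sum>\<Gamma>\<in>{\<Gamma>\<in>upper_complexes (2 * m) (Suc m). \<tau> \<le> card (level (Suc m) \<Gamma>)}. shadow_weight (Suc m) \<Gamma>)
      \<le> 2 powr (- \<rho> * \<tau> / Suc m) * (2 * exp (2 powr - \<Lambda> * (5 * 2 ^ (2 * m))))
        * partition_sum (2 * m) (Suc (Suc m))"
      by (rule large_level_sum, rule par) (use elim in auto)
    also have "\<dots> \<le> upper_error m"
      unfolding upper_error_def pow
      using mult_left_mono[OF part', of "2 powr (- \<rho> * \<tau> / Suc m) * (2 * exp (5 * 4 ^ m / real m ^ 12))"]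
      by (simp add: \<rho>_def \<tau>_def \<Lambda>_def t_def)
    finally have "(\<Sum>\<Gamma>\<in>{\<Gamma>\<in>upper_complexes (2 * m) (Suc m). \<tau> \<le> card (level (Suc m) \<Gamma>)}.
      shadow_weight (Suc m) \<Gamma>) \<le> upper_error m" .
    then have "card (simplicial_complexes (2 * m)) *
        (\<Sum>\<Gamma>\<in>{\<Gamma>\<in>upper_complexes (2 * m) (Suc m). \<tau> \<le> card (level (Suc m) \<Gamma>)}. shadow_weight (Suc m) \<Gamma>)
      \<le> card (simplicial_complexes (2 * m)) * upper_error m"
      by (intro mult_left_mono) auto
    moreover have "real (card {\<Delta>\<in>simplicial_complexes (2 * m). \<tau> \<le> card (level (Suc m) \<Delta>)})
      \<le> card (simplicial_complexes (2 * m)) *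
        (\<Sum>\<Gamma>\<in>{\<Gamma>\<in>upper_complexes (2 * m) (Suc m). \<tau> \<le> card (level (Suc m) \<Gamma>)}. shadow_weight (Suc m) \<Gamma>)"
      by (rule card_complexes_large_level) (use elim(4) in simp)
    ultimately show ?case unfolding \<tau>_def by linarith
  qed
qed

section \<open>Alexander duality\<close>

text \<open>The Alexander dual, under the convention that the empty set is tacitly a face of every
  complex although it is not listed; the full set, as its complement, is therefore never in the
  dual.\<close>

definition dual_complex :: "nat \<Rightarrow> nat set set \<Rightarrow> nat set set" where
  "dual_complex n \<Delta> = {x. x \<subseteq> {1..n} \<and> x \<noteq> {} \<and> x \<noteq> {1..n} \<and> {1..n} - x \<notin> \<Delta>}"

lemma dual_complex_in:
  assumes "\<Delta> \<in> simplicial_complexes n"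
  shows "dual_complex n \<Delta> \<in> simplicial_complexes n"
proof (rule simplicial_complexesI)
  fix x y assume xy: "x \<in> dual_complex n \<Delta>" "y \<subseteq> x" "y \<noteq> {}"
  have "{1..n} - x \<in> \<Delta>" if "{1..n} - y \<in> \<Delta>"
    by (rule face_mono[OF assms that]) (use xy in \<open>auto simp: dual_complex_def\<close>)
  then show "y \<in> dual_complex n \<Delta>" using xy by (auto simp: dual_complex_def)
qed (auto simp: dual_complex_def)

lemma inj_on_dual_complex:
  "inj_on (dual_complex n) {\<Delta>\<in>simplicial_complexes n. {1..n} \<notin> \<Delta>}"
proof (rule inj_on_inverseI)
  fix \<Delta> assume D: "\<Delta> \<in> {\<Delta>\<in>simplicial_complexes n. {1..n} \<notin> \<Delta>}"
  show "dual_complex n (dual_complex n \<Delta>) = \<Delta>"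
  proof (intro equalityI subsetI)
    fix x assume x: "x \<in> dual_complex n (dual_complex n \<Delta>)"
    then have "{1..n} - ({1..n} - x) = x" by (auto simp: dual_complex_def)
    then show "x \<in> \<Delta>" using x by (auto simp: dual_complex_def)
  next
    fix x assume x: "x \<in> \<Delta>"
    then have "x \<subseteq> {1..n}" using D face_subset by blast
    moreover have "{1..n} - ({1..n} - x) = x" using calculation by auto
    moreover have "x \<noteq> {}" using x D by (auto simp: simplicial_complexes_def)
    moreover have "x \<noteq> {1..n}" using x D by auto
    ultimately show "x \<in> dual_complex n (dual_complex n \<Delta>)" using x by (simp add: dual_complex_def)
  qed
qed

text \<open>Duality turns the missing sets of size \<open>k\<close> into faces of size
  \<open>n - k\<close>. It is injective only away from the complexes that have the full set as a
  face; these miss nothing and are excluded by \<open>0 < \<tau>\<close>.\<close>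

lemma card_complexes_missing_layer:
  fixes \<tau> :: real
  assumes "0 < \<tau>" "0 < k" "k < n"
  shows "card {\<Delta>\<in>simplicial_complexes n. \<tau> \<le> card (layer n k - \<Delta>)}
    \<le> card {\<Delta>\<in>simplicial_complexes n. \<tau> \<le> card (level (n - k) \<Delta>)}"
proof (rule card_inj_on_le)
  let ?X = "{\<Delta>\<in>simplicial_complexes n. \<tau> \<le> card (layer n k - \<Delta>)}"
  have notin: "{1..n} \<notin> \<Delta>" if D: "\<Delta> \<in> ?X" for \<Delta>
  proof
    assume full: "{1..n} \<in> \<Delta>"
    have "layer n k \<subseteq> \<Delta>"
    proof
      fix x assume x: "x \<in> layer n k"
      show "x \<in> \<Delta>" by (rule face_mono[OF _ full]) (use D x assms in \<open>auto simp: layer_def\<close>)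
    qed
    then have e: "layer n k - \<Delta> = {}" by blast
    have "\<tau> \<le> card (layer n k - \<Delta>)" using D by simp
    then show False unfolding e using assms by simp
  qed
  show "inj_on (dual_complex n) ?X"
    by (rule inj_on_subset[OF inj_on_dual_complex]) (use notin in auto)
  show "finite {\<Delta>\<in>simplicial_complexes n. \<tau> \<le> card (level (n - k) \<Delta>)}"
    using finite_simplicial_complexes by simp
  show "dual_complex n ` ?X \<subseteq> {\<Delta>\<in>simplicial_complexes n. \<tau> \<le> card (level (n - k) \<Delta>)}"
  proof (intro image_subsetI CollectI conjI)
    fix \<Delta> assume D: "\<Delta> \<in> ?X"
    then show D': "dual_complex n \<Delta> \<in> simplicial_complexes n" by (simp add: dual_complex_in)
    have "card (layer n k - \<Delta>) \<le> card (level (n - k) (dual_complex n \<Delta>))"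
    proof (rule card_inj_on_le[of "\<lambda>x. {1..n} - x"])
      show "inj_on (\<lambda>x. {1..n} - x) (layer n k - \<Delta>)"
        by (rule inj_on_inverseI[of _ "\<lambda>x. {1..n} - x"]) (auto simp: layer_def)
      show "finite (level (n - k) (dual_complex n \<Delta>))"
        by (rule finite_subset[OF level_subset_layer finite_layer]) (use face_subset[OF D'] in auto)
      show "(\<lambda>x. {1..n} - x) ` (layer n k - \<Delta>) \<subseteq> level (n - k) (dual_complex n \<Delta>)"
      proof (rule image_subsetI)
        fix x assume x: "x \<in> layer n k - \<Delta>"
        then have xs: "x \<subseteq> {1..n}" and c: "card x = k" by (auto simp: layer_def)
        have "finite x" using xs finite_subset by auto
        then have c': "card ({1..n} - x) = n - k" using xs c by (simp add: card_Diff_subset)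
        have "{1..n} - ({1..n} - x) = x" using xs by auto
        moreover have "{1..n} - x \<noteq> {}" using c' assms by (metis card.empty diff_is_0_eq not_le)
        moreover have "{1..n} - x \<noteq> {1..n}" using c' assms by (metis card_atLeastAtMost diff_Suc_1 diff_less less_irrefl order.strict_trans)
        ultimately show "{1..n} - x \<in> level (n - k) (dual_complex n \<Delta>)"
          using x c' by (simp add: level_def dual_complex_def)
      qed
    qed
    then show "\<tau> \<le> card (level (n - k) (dual_complex n \<Delta>))" using D by simp
  qed
qed

section \<open>Homology classes of missing simplices\<close>

lemma finite_complex: "\<Delta> \<in> simplicial_complexes n \<Longrightarrow> finite \<Delta>"
  by (rule finite_subset[of _ "Pow {1..n}"]) (use face_subset in blast, simp)

text \<open>Independent of any complex: it will be applied to a \<open>\<sigma>\<close> that need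
  not be a face, so that it is not a value of \<open>boundary_map\<close> on a chain of
  \<open>\<Delta>\<close>.\<close>

definition simplex_boundary ::
    "('a, 'r) ring_scheme \<Rightarrow> nat set \<Rightarrow> (nat set \<Rightarrow> 'a)" where
  "simplex_boundary R \<sigma> = (\<lambda>\<tau>. \<Oplus>\<^bsub>R\<^esub>v\<in>{v\<in>\<sigma>. \<sigma> - {v} = \<tau>}. (\<ominus>\<^bsub>R\<^esub> \<one>\<^bsub>R\<^esub>) [^]\<^bsub>R\<^esub> card {u\<in>\<sigma>. u < v})"

locale complex_chains = cring R for R :: "('a, 'r) ring_scheme" (structure) +
  fixes n :: nat and \<Delta> :: "nat set set" and k :: nat
  assumes complex: "\<Delta> \<in> simplicial_complexes n"
begin

abbreviation sgn_pow :: "nat \<Rightarrow> 'a" where "sgn_pow i \<equiv> (\<ominus> \<one>) [^] i"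

lemma finite_faces: "finite (faces \<Delta> i)"
  using finite_complex[OF complex] by (simp add: faces_def)

lemma finite_faceI: "\<sigma> \<in> faces \<Delta> i \<Longrightarrow> finite \<sigma>"
  using finite_face[OF complex] by (auto simp: faces_def)

lemma sgn_pow_closed [simp]: "sgn_pow i \<in> carrier R" by simp

lemma facet_index_set: "v \<in> \<sigma> \<Longrightarrow> {w\<in>\<sigma>. \<sigma> - {w} = \<sigma> - {v}} = {v}" by auto

lemma not_facet_index_set: "\<tau> \<notin> facets \<sigma> \<Longrightarrow> {w\<in>\<sigma>. \<sigma> - {w} = \<tau>} = {}" by (auto simp: facets_def)

lemma simplex_boundary_facet:
  "v \<in> \<sigma> \<Longrightarrow> simplex_boundary R \<sigma> (\<sigma> - {v}) = sgn_pow (card {u\<in>\<sigma>. u < v})"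
  by (simp add: simplex_boundary_def facet_index_set)

lemma simplex_boundary_not_facet: "\<tau> \<notin> facets \<sigma> \<Longrightarrow> simplex_boundary R \<sigma> \<tau> = \<zero>"
  by (simp add: simplex_boundary_def not_facet_index_set)

lemma simplex_boundary_closed [simp]: "simplex_boundary R \<sigma> \<tau> \<in> carrier R"
  by (cases "\<tau> \<in> facets \<sigma>") (auto simp: simplex_boundary_not_facet facets_def simplex_boundary_facet)

lemma boundary_inner_closed:
  assumes "c \<sigma> \<in> carrier R"
  shows "(\<Oplus>v\<in>{v\<in>\<sigma>. \<sigma> - {v} = \<tau>}. sgn_pow (card {u\<in>\<sigma>. u < v}) \<otimes> c \<sigma>) \<in> carrier R"
  using assms by (intro finsum_closed) auto

abbreviation "C \<equiv> chain_module R \<Delta>"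

lemma chain_closed: "c \<in> carrier (C i) \<Longrightarrow> c \<sigma> \<in> carrier R"
  by (auto simp: chain_module_def)

lemma abelian_group_chains: "abelian_group (C i)"
proof (rule abelian_groupI)
  fix x assume x: "x \<in> carrier (C i)"
  show "\<exists>y\<in>carrier (C i). y \<oplus>\<^bsub>C i\<^esub> x = \<zero>\<^bsub>C i\<^esub>"
    by (rule bexI[of _ "\<lambda>\<sigma>. \<ominus> x \<sigma>"]) (use x in \<open>auto simp: chain_module_def l_neg subset_iff\<close>)
qed (auto simp: chain_module_def a_ac subset_iff fun_eq_iff)

lemma boundary_map_add:
  assumes "c \<in> carrier (C i)" "d \<in> carrier (C i)"
  shows "boundary_map R \<Delta> i (c \<oplus>\<^bsub>C i\<^esub> d) = (\<lambda>\<tau>. boundary_map R \<Delta> i c \<tau> \<oplus> boundary_map R \<Delta> i d \<tau>)"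
proof (cases "i = 0")
  case False
  have cl: "c \<sigma> \<in> carrier R" "d \<sigma> \<in> carrier R" for \<sigma> using assms chain_closed by auto
  have "(\<Oplus>v\<in>{v\<in>\<sigma>. \<sigma> - {v} = \<tau>}. sgn_pow (card {u\<in>\<sigma>. u < v}) \<otimes> (c \<sigma> \<oplus> d \<sigma>))
      = (\<Oplus>v\<in>{v\<in>\<sigma>. \<sigma> - {v} = \<tau>}. sgn_pow (card {u\<in>\<sigma>. u < v}) \<otimes> c \<sigma>)
      \<oplus> (\<Oplus>v\<in>{v\<in>\<sigma>. \<sigma> - {v} = \<tau>}. sgn_pow (card {u\<in>\<sigma>. u < v}) \<otimes> d \<sigma>)" for \<sigma> \<tau>
    using cl by (subst finsum_addf[symmetric]) (auto simp: r_distr)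
  then show ?thesis
    using False cl by (auto simp: boundary_map_def chain_module_def fun_eq_iff finsum_addf boundary_inner_closed)
qed (simp add: boundary_map_def)

lemma boundary_map_smult:
  assumes "c \<in> carrier (C i)" "r \<in> carrier R"
  shows "boundary_map R \<Delta> i (r \<odot>\<^bsub>C i\<^esub> c) = (\<lambda>\<tau>. r \<otimes> boundary_map R \<Delta> i c \<tau>)"
proof (cases "i = 0")
  case False
  have cl: "c \<sigma> \<in> carrier R" for \<sigma> using assms chain_closed by auto
  have "(\<Oplus>v\<in>{v\<in>\<sigma>. \<sigma> - {v} = \<tau>}. sgn_pow (card {u\<in>\<sigma>. u < v}) \<otimes> (r \<otimes> c \<sigma>))
      = r \<otimes> (\<Oplus>v\<in>{v\<in>\<sigma>. \<sigma> - {v} = \<tau>}. sgn_pow (card {u\<in>\<sigma>. u < v}) \<otimes> c \<sigma>)"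
    if "\<sigma> \<in> faces \<Delta> i" for \<sigma> \<tau>
    using cl assms finite_faceI[OF that] by (subst finsum_rdistr) (auto simp: m_lcomm)
  then show ?thesis
    using False cl assms finite_faces boundary_inner_closed
    by (simp add: boundary_map_def chain_module_def fun_eq_iff finsum_rdistr cong: finsum_cong)
qed (use assms in \<open>simp add: boundary_map_def\<close>)

text \<open>The mechanism behind the detection of classes: a set below no face of the next dimension
  has coefficient zero in every boundary.\<close>

lemma boundary_map_vanishes:
  assumes "\<And>\<sigma>. \<sigma> \<in> faces \<Delta> i \<Longrightarrow> \<tau> \<notin> facets \<sigma>"
  shows "boundary_map R \<Delta> i c \<tau> = \<zero>"
  using assms by (simp add: boundary_map_def not_facet_index_set cong: finsum_cong)

lemma boundary_map_in_chains:
  assumes "c \<in> carrier (C (Suc i))"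
  shows "boundary_map R \<Delta> (Suc i) c \<in> carrier (C i)"
proof -
  have cl: "c \<sigma> \<in> carrier R" for \<sigma> using assms chain_closed by auto
  have "boundary_map R \<Delta> (Suc i) c \<tau> = \<zero>" if "\<tau> \<notin> faces \<Delta> i" for \<tau>
  proof (rule boundary_map_vanishes)
    show "\<tau> \<notin> facets \<sigma>" if s: "\<sigma> \<in> faces \<Delta> (Suc i)" for \<sigma>
    proof -
      have "\<sigma> - {v} \<in> faces \<Delta> i" if "v \<in> \<sigma>" for v
      proof -
        have "card (\<sigma> - {v}) = Suc i" using s that by (simp add: faces_def)
        moreover from this have "\<sigma> - {v} \<noteq> {}" by (metis card.empty nat.distinct(1))
        ultimately show ?thesis using face_mono[OF complex, of \<sigma> "\<sigma> - {v}"] s by (auto simp: faces_def)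
      qed
      then show ?thesis using \<open>\<tau> \<notin> faces \<Delta> i\<close> by (auto simp: facets_def)
    qed
  qed
  moreover have "boundary_map R \<Delta> (Suc i) c \<tau> \<in> carrier R" for \<tau>
    using cl boundary_inner_closed by (auto simp: boundary_map_def intro!: finsum_closed)
  ultimately show ?thesis by (auto simp: chain_module_def)
qed

lemma boundaries_subgroup: "subgroup (boundaries R \<Delta> i) (add_monoid (C i))"
proof -
  interpret Ci: abelian_group "C i" by (rule abelian_group_chains)
  interpret Cs: abelian_group "C (Suc i)" by (rule abelian_group_chains)
  have add: "boundary_map R \<Delta> (Suc i) (c \<oplus>\<^bsub>C (Suc i)\<^esub> d)
      = boundary_map R \<Delta> (Suc i) c \<oplus>\<^bsub>C i\<^esub> boundary_map R \<Delta> (Suc i) d"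
    if "c \<in> carrier (C (Suc i))" "d \<in> carrier (C (Suc i))" for c d
    using boundary_map_add[OF that] by (simp add: chain_module_def)
  have "group_hom (add_monoid (C (Suc i))) (add_monoid (C i)) (boundary_map R \<Delta> (Suc i))"
    by (intro group_hom.intro group_hom_axioms.intro Ci.a_group Cs.a_group)
      (auto simp: hom_def add boundary_map_in_chains)
  then have "subgroup (boundary_map R \<Delta> (Suc i) ` carrier (add_monoid (C (Suc i)))) (add_monoid (C i))"
    by (rule group_hom.img_is_subgroup)
  then show ?thesis by (simp add: boundaries_def)
qed

lemma abelian_subgroup_boundaries: "abelian_subgroup (boundaries R \<Delta> i) (C i)"
  by (intro abelian_subgroupI3 additive_subgroupI boundaries_subgroup abelian_group_chains)

text \<open>The usual cancellation, carried out directly because \<open>\<sigma>\<close> may be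
  missing from \<open>\<Delta>\<close>. For \<open>x < y\<close> the set
  \<open>\<sigma> - {x, y}\<close> is reached through \<open>\<sigma> - {x}\<close> and
  \<open>\<sigma> - {y}\<close>; deleting \<open>x\<close> lowers the position of \<open>y\<close>
  by one while deleting \<open>y\<close> does not move \<open>x\<close>, so the signs are
  opposite.\<close>

lemma boundary_simplex_boundary:
  assumes "1 \<le> k" "card \<sigma> = k + 2" "facets \<sigma> \<subseteq> \<Delta>"
  shows "boundary_map R \<Delta> k (simplex_boundary R \<sigma>) = (\<lambda>\<tau>. \<zero>)"
proof
  fix \<rho>
  have fin: "finite \<sigma>" using assms(2) card.infinite by fastforce
  define b where "b = simplex_boundary R \<sigma>"
  define g where "g \<tau> = (\<Oplus>v\<in>{v\<in>\<tau>. \<tau> - {v} = \<rho>}. sgn_pow (card {u\<in>\<tau>. u < v}) \<otimes> b \<tau>)" for \<tau>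
  have bm: "boundary_map R \<Delta> k b \<rho> = (\<Oplus>\<tau>\<in>faces \<Delta> k. g \<tau>)" using assms(1) by (simp add: boundary_map_def g_def)
  have g_closed: "g \<tau> \<in> carrier R" for \<tau>
    unfolding g_def by (rule boundary_inner_closed) (simp add: b_def)
  have g0: "g \<tau> = \<zero>" if "\<And>v. v \<in> \<tau> \<Longrightarrow> \<tau> - {v} = \<rho> \<Longrightarrow> \<tau> \<notin> facets \<sigma>" for \<tau>
  proof (cases "\<tau> \<in> facets \<sigma>")
    case True
    then have e: "{v\<in>\<tau>. \<tau> - {v} = \<rho>} = {}" using that by auto
    show ?thesis unfolding g_def e by simp
  next
    case False
    then show ?thesis by (simp add: g_def b_def simplex_boundary_not_facet)
  qed
  have "(\<Oplus>\<tau>\<in>faces \<Delta> k. g \<tau>) = \<zero>"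
  proof (cases "\<exists>x\<in>\<sigma>. \<exists>y\<in>\<sigma>. x < y \<and> \<rho> = \<sigma> - {x, y}")
    case False
    have "g \<tau> = \<zero>" for \<tau>
    proof (rule g0)
      fix v assume v: "v \<in> \<tau>" "\<tau> - {v} = \<rho>"
      show "\<tau> \<notin> facets \<sigma>"
      proof
        assume "\<tau> \<in> facets \<sigma>"
        then obtain w where w: "w \<in> \<sigma>" "\<tau> = \<sigma> - {w}" by (auto simp: facets_def)
        then have "v \<in> \<sigma>" "v \<noteq> w" "\<rho> = \<sigma> - {v, w}" "\<rho> = \<sigma> - {w, v}" using v by auto
        then show False using False w(1) by (metis nat_neq_iff)
      qed
    qed
    then show ?thesis by (simp cong: finsum_cong)
  next
    case True
    then obtain x y where xy: "x \<in> \<sigma>" "y \<in> \<sigma>" "x < y" "\<rho> = \<sigma> - {x, y}" by blast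
    let ?A = "\<sigma> - {x}" and ?B = "\<sigma> - {y}"
    have AB: "?A \<noteq> ?B" using xy by auto
    have faceAB: "?A \<in> faces \<Delta> k" "?B \<in> faces \<Delta> k"
      using assms xy fin by (auto simp: faces_def facets_def)
    have other: "g \<tau> = \<zero>" if "\<tau> \<in> faces \<Delta> k - {?A, ?B}" for \<tau>
    proof (rule g0)
      fix v assume v: "v \<in> \<tau>" "\<tau> - {v} = \<rho>"
      show "\<tau> \<notin> facets \<sigma>"
      proof
        assume "\<tau> \<in> facets \<sigma>"
        then obtain w where w: "w \<in> \<sigma>" "\<tau> = \<sigma> - {w}" by (auto simp: facets_def)
        then have "w \<notin> \<rho>" using v by auto
        then have "w = x \<or> w = y" using w xy by auto
        then show False using w that by auto
      qed
    qed
    have "(\<Oplus>\<tau>\<in>faces \<Delta> k. g \<tau>) = (\<Oplus>\<tau>\<in>{?A, ?B}. g \<tau>)"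
      by (rule add.finprod_mono_neutral_cong_right) (use finite_faces faceAB other g_closed in auto)
    also have "\<dots> = g ?A \<oplus> g ?B" using AB g_closed by simp
    also have "g ?A = sgn_pow (card {u\<in>\<sigma>. u < y} - 1) \<otimes> sgn_pow (card {u\<in>\<sigma>. u < x})"
    proof -
      have "{v\<in>?A. ?A - {v} = \<rho>} = {y}" using xy by auto
      moreover have "{u\<in>?A. u < y} = {u\<in>\<sigma>. u < y} - {x}" by auto
      moreover have "card ({u\<in>\<sigma>. u < y} - {x}) = card {u\<in>\<sigma>. u < y} - 1" using xy fin by simp
      ultimately show ?thesis using xy simplex_boundary_facet[of x \<sigma>] by (simp add: g_def b_def)
    qed
    also have "g ?B = sgn_pow (card {u\<in>\<sigma>. u < x}) \<otimes> sgn_pow (card {u\<in>\<sigma>. u < y})"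
    proof -
      have "{v\<in>?B. ?B - {v} = \<rho>} = {x}" using xy by auto
      moreover have "{u\<in>?B. u < x} = {u\<in>\<sigma>. u < x}" using xy by auto
      ultimately show ?thesis using xy simplex_boundary_facet[of y \<sigma>] by (simp add: g_def b_def)
    qed
    also have "card {u\<in>\<sigma>. u < y} = Suc (card {u\<in>\<sigma>. u < y} - 1)"
    proof -
      have "x \<in> {u\<in>\<sigma>. u < y}" using xy by simp
      then have "0 < card {u\<in>\<sigma>. u < y}" using fin by (subst card_gt_0_iff) auto
      then show ?thesis by (rule Suc_diff_1[symmetric])
    qed
    finally show ?thesis
      by (simp add: m_comm m_lcomm l_minus r_minus r_neg)
  qed
  then show "boundary_map R \<Delta> k (simplex_boundary R \<sigma>) \<rho> = \<zero>" using bm by (simp add: b_def)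
qed

lemma simplex_boundary_cycle:
  assumes "1 \<le> k" "card \<sigma> = k + 2" "facets \<sigma> \<subseteq> \<Delta>"
  shows "simplex_boundary R \<sigma> \<in> cycles R \<Delta> k"
proof -
  have fin: "finite \<sigma>" using assms(2) card.infinite by fastforce
  have "simplex_boundary R \<sigma> \<tau> = \<zero>" if "\<tau> \<notin> faces \<Delta> k" for \<tau>
  proof (rule simplex_boundary_not_facet)
    have "\<tau> \<in> faces \<Delta> k" if "\<tau> \<in> facets \<sigma>"
    proof -
      have "\<tau> \<in> \<Delta>" using that assms by auto
      moreover have "card \<tau> = Suc k" using that assms fin by (simp add: facet_iff)
      ultimately show ?thesis by (simp add: faces_def)
    qed
    then show "\<tau> \<notin> facets \<sigma>" using that by blast
  qed
  then show ?thesis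
    using boundary_simplex_boundary[OF assms] by (auto simp: cycles_def chain_module_def)
qed

abbreviation "H \<equiv> homology R \<Delta> k"
abbreviation "N \<equiv> boundaries R \<Delta> k"

lemma cycles_subset: "cycles R \<Delta> k \<subseteq> carrier (C k)" by (auto simp: cycles_def)

lemma cycles_closed:
  "c \<in> cycles R \<Delta> k \<Longrightarrow> d \<in> cycles R \<Delta> k \<Longrightarrow> c \<oplus>\<^bsub>C k\<^esub> d \<in> cycles R \<Delta> k"
  "\<zero>\<^bsub>C k\<^esub> \<in> cycles R \<Delta> k"
  "c \<in> cycles R \<Delta> k \<Longrightarrow> r \<in> carrier R \<Longrightarrow> r \<odot>\<^bsub>C k\<^esub> c \<in> cycles R \<Delta> k"
proof -
  interpret Ck: abelian_group "C k" by (rule abelian_group_chains)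
  show "c \<oplus>\<^bsub>C k\<^esub> d \<in> cycles R \<Delta> k" if "c \<in> cycles R \<Delta> k" "d \<in> cycles R \<Delta> k"
    using that by (auto simp: cycles_def boundary_map_add)
  have sm: "r \<odot>\<^bsub>C k\<^esub> c \<in> carrier (C k)" if "c \<in> carrier (C k)" "r \<in> carrier R" for r c
    using that by (auto simp: chain_module_def)
  show s: "r \<odot>\<^bsub>C k\<^esub> c \<in> cycles R \<Delta> k" if "c \<in> cycles R \<Delta> k" "r \<in> carrier R" for r c
    using that by (auto simp: cycles_def boundary_map_smult sm)
  have "boundary_map R \<Delta> k (\<zero> \<odot>\<^bsub>C k\<^esub> \<zero>\<^bsub>C k\<^esub>) = (\<lambda>\<tau>. \<zero> \<otimes> boundary_map R \<Delta> k \<zero>\<^bsub>C k\<^esub> \<tau>)"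
    by (rule boundary_map_smult) auto
  moreover have "boundary_map R \<Delta> k \<zero>\<^bsub>C k\<^esub> \<tau> \<in> carrier R" for \<tau>
    using boundary_inner_closed chain_closed[OF Ck.zero_closed] by (auto simp: boundary_map_def intro!: finsum_closed)
  moreover have "\<zero> \<odot>\<^bsub>C k\<^esub> \<zero>\<^bsub>C k\<^esub> = \<zero>\<^bsub>C k\<^esub>" by (simp add: chain_module_def)
  ultimately show "\<zero>\<^bsub>C k\<^esub> \<in> cycles R \<Delta> k" by (simp add: cycles_def)
qed

text \<open>Restricting the carrier to the cycles changes neither addition nor scalar
  multiplication, so cosets can be computed in the full chain module.\<close>

lemma homology_simps:
  "carrier H = {N +>\<^bsub>C k\<^esub> c |c. c \<in> cycles R \<Delta> k}"
  "zero H = N"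
  "add H = (<+>\<^bsub>C k\<^esub>)"
  "r \<odot>\<^bsub>H\<^esub> X = (\<Union>x\<in>X. N +>\<^bsub>C k\<^esub> (r \<odot>\<^bsub>C k\<^esub> x))"
  by (auto simp: homology_def quotient_module_def A_RCOSETS_def' a_r_coset_def' set_add_def' fun_eq_iff)

lemma abelian_monoid_homology: "abelian_monoid H"
proof -
  interpret abelian_subgroup N "C k" by (rule abelian_subgroup_boundaries)
  have sub: "c \<in> cycles R \<Delta> k \<Longrightarrow> c \<in> carrier (C k)" for c using cycles_subset by auto
  have N0: "N +>\<^bsub>C k\<^esub> \<zero>\<^bsub>C k\<^esub> = N" by (simp add: a_coset_add_zero a_subset)
  show ?thesis
  proof (rule abelian_monoidI)
    show "\<zero>\<^bsub>H\<^esub> \<in> carrier H" using N0 cycles_closed(2) by (auto simp: homology_simps)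
    show "X \<oplus>\<^bsub>H\<^esub> Y \<in> carrier H" if "X \<in> carrier H" "Y \<in> carrier H" for X Y
      using that cycles_closed(1) sub by (fastforce simp: homology_simps a_rcos_sum)
    show "X \<oplus>\<^bsub>H\<^esub> Y \<oplus>\<^bsub>H\<^esub> Z = X \<oplus>\<^bsub>H\<^esub> (Y \<oplus>\<^bsub>H\<^esub> Z)"
      if "X \<in> carrier H" "Y \<in> carrier H" "Z \<in> carrier H" for X Y Z
      using that sub by (auto simp: homology_simps a_rcos_sum a_assoc)
    show "X \<oplus>\<^bsub>H\<^esub> Y = Y \<oplus>\<^bsub>H\<^esub> X" if "X \<in> carrier H" "Y \<in> carrier H" for X Y
      using that sub by (auto simp: homology_simps a_rcos_sum a_comm)
    show "\<zero>\<^bsub>H\<^esub> \<oplus>\<^bsub>H\<^esub> X = X" if X: "X \<in> carrier H" for X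
    proof -
      obtain c where c: "X = N +>\<^bsub>C k\<^esub> c" "c \<in> carrier (C k)" using X sub by (auto simp: homology_simps)
      have "(N +>\<^bsub>C k\<^esub> \<zero>\<^bsub>C k\<^esub>) <+>\<^bsub>C k\<^esub> (N +>\<^bsub>C k\<^esub> c) = N +>\<^bsub>C k\<^esub> (\<zero>\<^bsub>C k\<^esub> \<oplus>\<^bsub>C k\<^esub> c)"
        using c by (intro a_rcos_sum) auto
      then show ?thesis using c by (simp add: homology_simps N0)
    qed
  qed
qed

text \<open>The union over representatives collapses to a single coset because the boundaries are
  closed under scalars.\<close>

lemma smult_coset:
  assumes r: "r \<in> carrier R" and c: "c \<in> carrier (C k)"
  shows "r \<odot>\<^bsub>H\<^esub> (N +>\<^bsub>C k\<^esub> c) = N +>\<^bsub>C k\<^esub> (r \<odot>\<^bsub>C k\<^esub> c)"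
proof -
  interpret abelian_subgroup N "C k" by (rule abelian_subgroup_boundaries)
  have sm: "r \<odot>\<^bsub>C i\<^esub> d \<in> carrier (C i)" if "d \<in> carrier (C i)" for d i
    using that r by (auto simp: chain_module_def)
  have rN: "r \<odot>\<^bsub>C k\<^esub> b \<in> N" if b: "b \<in> N" for b
  proof -
    obtain e where e: "e \<in> carrier (C (Suc k))" "b = boundary_map R \<Delta> (Suc k) e"
      using b by (auto simp: boundaries_def)
    have "r \<odot>\<^bsub>C k\<^esub> b = boundary_map R \<Delta> (Suc k) (r \<odot>\<^bsub>C (Suc k)\<^esub> e)"
      using boundary_map_smult[OF e(1) r] by (simp add: e chain_module_def)
    then show ?thesis using sm[OF e(1)] by (auto simp: boundaries_def)
  qed
  have one: "N +>\<^bsub>C k\<^esub> (r \<odot>\<^bsub>C k\<^esub> x) = N +>\<^bsub>C k\<^esub> (r \<odot>\<^bsub>C k\<^esub> c)" if x: "x \<in> N +>\<^bsub>C k\<^esub> c" for x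
  proof -
    obtain b where b: "b \<in> N" "x = b \<oplus>\<^bsub>C k\<^esub> c" using x by (auto simp: a_r_coset_def')
    have bC: "b \<in> carrier (C k)" using b a_subset by auto
    have "r \<odot>\<^bsub>C k\<^esub> x = (r \<odot>\<^bsub>C k\<^esub> b) \<oplus>\<^bsub>C k\<^esub> (r \<odot>\<^bsub>C k\<^esub> c)"
      using chain_closed[OF bC] chain_closed[OF c] r by (simp add: b chain_module_def r_distr)
    then have "r \<odot>\<^bsub>C k\<^esub> x \<in> N +>\<^bsub>C k\<^esub> (r \<odot>\<^bsub>C k\<^esub> c)" using rN[OF b(1)] by (auto simp: a_r_coset_def')
    then show ?thesis using a_repr_independence[OF _ sm[OF c] a_subgroup] by simp
  qed
  have self: "c \<in> N +>\<^bsub>C k\<^esub> c" using a_rcos_self[OF c] .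
  have "r \<odot>\<^bsub>H\<^esub> (N +>\<^bsub>C k\<^esub> c) = (\<Union>x\<in>N +>\<^bsub>C k\<^esub> c. N +>\<^bsub>C k\<^esub> (r \<odot>\<^bsub>C k\<^esub> x))"
    by (rule homology_simps)
  also have "\<dots> = (\<Union>x\<in>N +>\<^bsub>C k\<^esub> c. N +>\<^bsub>C k\<^esub> (r \<odot>\<^bsub>C k\<^esub> c))"
    by (rule SUP_cong[OF refl one])
  also have "\<dots> = N +>\<^bsub>C k\<^esub> (r \<odot>\<^bsub>C k\<^esub> c)" using self by (intro SUP_const) auto
  finally show ?thesis .
qed

text \<open>Evaluation of a homology class at \<open>t\<close>; it is well defined if no \<open>(k + 1)\<close>-face contains \<open>t\<close>.\<close>

definition eval_at :: "nat set \<Rightarrow> (nat set \<Rightarrow> 'a) set \<Rightarrow> 'a" where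
  "eval_at t X = (SOME c. c \<in> X) t"

text \<open>All members of the coset agree at \<open>t\<close>, since they differ by boundaries and
  these vanish there; the choice made by \<open>SOME\<close> is harmless.\<close>

lemma eval_at_coset:
  assumes t: "\<And>\<sigma>. \<sigma> \<in> faces \<Delta> (Suc k) \<Longrightarrow> t \<notin> facets \<sigma>" and c: "c \<in> carrier (C k)"
  shows "eval_at t (N +>\<^bsub>C k\<^esub> c) = c t"
proof -
  interpret abelian_subgroup N "C k" by (rule abelian_subgroup_boundaries)
  have "d t = c t" if d: "d \<in> N +>\<^bsub>C k\<^esub> c" for d
  proof -
    obtain b where b: "b \<in> N" "d = b \<oplus>\<^bsub>C k\<^esub> c" using d by (auto simp: a_r_coset_def')
    have "b t = \<zero>" using b(1) boundary_map_vanishes[OF t] by (auto simp: boundaries_def)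
    then show ?thesis using chain_closed[OF c] by (simp add: b chain_module_def)
  qed
  moreover have "(SOME d. d \<in> N +>\<^bsub>C k\<^esub> c) \<in> N +>\<^bsub>C k\<^esub> c" using a_rcos_self[OF c] by (rule someI[of "\<lambda>d. d \<in> N +>\<^bsub>C k\<^esub> c"])
  ultimately show ?thesis by (simp add: eval_at_def)
qed

lemma eval_at_finsum:
  assumes t: "\<And>\<sigma>. \<sigma> \<in> faces \<Delta> (Suc k) \<Longrightarrow> t \<notin> facets \<sigma>"
    and "finite T" "f \<in> T \<rightarrow> carrier H"
  shows "eval_at t (\<Oplus>\<^bsub>H\<^esub>x\<in>T. f x) = (\<Oplus>x\<in>T. eval_at t (f x))"
proof -
  interpret H: abelian_monoid H by (rule abelian_monoid_homology)
  interpret N: abelian_subgroup N "C k" by (rule abelian_subgroup_boundaries)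
  have cl: "eval_at t X \<in> carrier R" if "X \<in> carrier H" for X
    using that eval_at_coset[OF t] chain_closed cycles_subset by (auto simp: homology_simps subset_iff)
  have add: "eval_at t (X \<oplus>\<^bsub>H\<^esub> Y) = eval_at t X \<oplus> eval_at t Y" if XY: "X \<in> carrier H" "Y \<in> carrier H" for X Y
  proof -
    obtain c d where "X = N +>\<^bsub>C k\<^esub> c" "Y = N +>\<^bsub>C k\<^esub> d" "c \<in> carrier (C k)" "d \<in> carrier (C k)"
      using XY cycles_subset by (auto simp: homology_simps)
    moreover have "(c \<oplus>\<^bsub>C k\<^esub> d) t = c t \<oplus> d t" for c d by (simp add: chain_module_def)
    ultimately show ?thesis by (simp add: homology_simps N.a_rcos_sum eval_at_coset[OF t])
  qed
  have zero: "eval_at t \<zero>\<^bsub>H\<^esub> = \<zero>"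
  proof -
    have "eval_at t (N +>\<^bsub>C k\<^esub> \<zero>\<^bsub>C k\<^esub>) = \<zero>\<^bsub>C k\<^esub> t" by (rule eval_at_coset[OF t]) auto
    moreover have "N +>\<^bsub>C k\<^esub> \<zero>\<^bsub>C k\<^esub> = N" by (simp add: N.a_coset_add_zero N.a_subset)
    ultimately show ?thesis by (simp add: homology_simps chain_module_def)
  qed
  show ?thesis
    using assms(2,3)
  proof (induction T)
    case (insert x T)
    have "f x \<in> carrier H" "f \<in> T \<rightarrow> carrier H" using insert by auto
    then show ?case using insert cl by (simp add: add Pi_iff)
  qed (simp add: zero)
qed

text \<open>The boundary of a missing simplex \<open>\<sigma>\<close> is a cycle whose class is detected by evaluation at the
  facet \<open>t \<sigma>\<close>, which belongs neither to a \<open>(k + 1)\<close>-face nor to another missing simplex of \<open>E\<close>.\<close>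

lemma card_le_module_rank_homology:
  assumes "1 \<le> k" "\<one> \<noteq> \<zero>" "finite E"
    and E: "\<And>\<sigma>. \<sigma> \<in> E \<Longrightarrow> card \<sigma> = k + 2 \<and> facets \<sigma> \<subseteq> \<Delta> \<and> t \<sigma> \<in> facets \<sigma>"
    and faces: "\<And>\<sigma> \<phi>. \<sigma> \<in> E \<Longrightarrow> \<phi> \<in> faces \<Delta> (Suc k) \<Longrightarrow> t \<sigma> \<notin> facets \<phi>"
    and iso: "\<And>\<sigma> \<sigma>'. \<sigma> \<in> E \<Longrightarrow> \<sigma>' \<in> E \<Longrightarrow> \<sigma> \<noteq> \<sigma>' \<Longrightarrow> t \<sigma> \<notin> facets \<sigma>'"
  shows "enat (card E) \<le> module_rank R H"
proof -
  interpret Ha: abelian_monoid H by (rule abelian_monoid_homology)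
  define cls where "cls \<sigma> = N +>\<^bsub>C k\<^esub> simplex_boundary R \<sigma>" for \<sigma>
  have cyc: "simplex_boundary R \<sigma> \<in> cycles R \<Delta> k" if "\<sigma> \<in> E" for \<sigma>
    using simplex_boundary_cycle E[OF that] assms(1) by blast
  have clsH: "cls \<sigma> \<in> carrier H" if "\<sigma> \<in> E" for \<sigma> using cyc[OF that] by (auto simp: cls_def homology_simps)
  have ev: "eval_at (t \<sigma>) (cls \<sigma>') = simplex_boundary R \<sigma>' (t \<sigma>)" if "\<sigma> \<in> E" "\<sigma>' \<in> E" for \<sigma> \<sigma>'
    unfolding cls_def by (rule eval_at_coset) (use faces that cyc cycles_subset in auto)
  \<comment> \<open>The value at the private facet is a sign. Signs are their own inverses, so they
    cancel over any commutative ring, zero divisors or not.\<close>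
  have unit: "\<exists>p. eval_at (t \<sigma>) (cls \<sigma>) = sgn_pow p" if s: "\<sigma> \<in> E" for \<sigma>
    using E[OF s] ev[OF s s] by (auto simp: facets_def simplex_boundary_facet)
  have sq: "sgn_pow p \<otimes> sgn_pow p = \<one>" for p
  proof -
    have "sgn_pow p \<otimes> sgn_pow p = (\<ominus> \<one> \<otimes> \<ominus> \<one>) [^] p" by (simp add: pow_mult_distrib m_comm)
    then show ?thesis by (simp add: l_minus)
  qed
  have cancel: "x = \<zero>" if "x \<otimes> sgn_pow p = \<zero>" "x \<in> carrier R" for x p
  proof -
    have "x = x \<otimes> (sgn_pow p \<otimes> sgn_pow p)" using that by (simp add: sq)
    also have "\<dots> = (x \<otimes> sgn_pow p) \<otimes> sgn_pow p" using that(2) by (simp add: m_assoc)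
    also have "\<dots> = \<zero> \<otimes> sgn_pow p" by (simp only: that)
    finally show ?thesis by simp
  qed
  have off: "eval_at (t \<sigma>) (cls \<sigma>') = \<zero>" if "\<sigma> \<in> E" "\<sigma>' \<in> E" "\<sigma> \<noteq> \<sigma>'" for \<sigma> \<sigma>'
    using ev[OF that(1,2)] iso[OF that] by (simp add: simplex_boundary_not_facet)
  \<comment> \<open>Needed for the cardinality of the image. The ring has to be nonzero here: equal
    classes would force a sign to be zero.\<close>
  have inj: "inj_on cls E"
  proof (rule inj_onI, rule ccontr)
    fix \<sigma> \<sigma>' assume s: "\<sigma> \<in> E" "\<sigma>' \<in> E" "cls \<sigma> = cls \<sigma>'" "\<sigma> \<noteq> \<sigma>'"
    obtain p where p: "eval_at (t \<sigma>) (cls \<sigma>) = sgn_pow p" using unit s by blast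
    then have "sgn_pow p = \<zero>" using off[OF s(1,2,4)] s(3) by simp
    then show False using sq[of p] assms(2) by simp
  qed
  have "lin_indep R H (cls ` E)"
    unfolding lin_indep_def
  proof (intro conjI allI impI ballI)
    show "cls ` E \<subseteq> carrier H" using clsH by auto
    fix T a x assume h: "finite T \<and> T \<subseteq> cls ` E \<and> a \<in> T \<rightarrow> carrier R \<and>
        (\<Oplus>\<^bsub>H\<^esub>x\<in>T. a x \<odot>\<^bsub>H\<^esub> x) = \<zero>\<^bsub>H\<^esub>" and x: "x \<in> T"
    obtain \<sigma> where \<sigma>: "\<sigma> \<in> E" "x = cls \<sigma>" using h x by auto
    have noface: "\<And>\<phi>. \<phi> \<in> faces \<Delta> (Suc k) \<Longrightarrow> t \<sigma> \<notin> facets \<phi>" using faces[OF \<sigma>(1)] .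
    have sm: "a y \<odot>\<^bsub>H\<^esub> y \<in> carrier H \<and> eval_at (t \<sigma>) (a y \<odot>\<^bsub>H\<^esub> y) = a y \<otimes> eval_at (t \<sigma>) y"
      if y: "y \<in> T" for y
    proof -
      obtain \<sigma>' where s: "\<sigma>' \<in> E" "y = cls \<sigma>'" using h y by auto
      have ay: "a y \<in> carrier R" using h y by auto
      have c: "simplex_boundary R \<sigma>' \<in> carrier (C k)" using cyc[OF s(1)] cycles_subset by auto
      have e: "a y \<odot>\<^bsub>H\<^esub> y = N +>\<^bsub>C k\<^esub> (a y \<odot>\<^bsub>C k\<^esub> simplex_boundary R \<sigma>')"
        using smult_coset[OF ay c] by (simp add: s cls_def)
      have m: "a y \<odot>\<^bsub>C k\<^esub> simplex_boundary R \<sigma>' \<in> cycles R \<Delta> k"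
        using cycles_closed(3)[OF cyc[OF s(1)] ay] .
      have "eval_at (t \<sigma>) (a y \<odot>\<^bsub>H\<^esub> y) = (a y \<odot>\<^bsub>C k\<^esub> simplex_boundary R \<sigma>') (t \<sigma>)"
        unfolding e by (rule eval_at_coset[OF noface]) (use m cycles_subset in auto)
      also have "\<dots> = a y \<otimes> eval_at (t \<sigma>) y" using ev[OF \<sigma>(1) s(1)] s by (simp add: chain_module_def)
      finally show ?thesis using m unfolding e by (auto simp: homology_simps)
    qed
    have ex: "eval_at (t \<sigma>) y \<in> carrier R" if "y \<in> T" for y
      using that h ev[OF \<sigma>(1)] by auto
    \<comment> \<open>Evaluating the relation at \<open>t \<sigma>\<close> kills every term but the
      one of \<open>\<sigma>\<close>. The zero class is written as an empty sum in order to apply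
      \<open>eval_at_finsum\<close> to it.\<close>
    have "\<zero> = eval_at (t \<sigma>) (\<Oplus>\<^bsub>H\<^esub>x\<in>T. a x \<odot>\<^bsub>H\<^esub> x)"
      using eval_at_finsum[OF noface, of "{}" "\<lambda>_. undefined"] h by simp
    also have "\<dots> = (\<Oplus>y\<in>T. eval_at (t \<sigma>) (a y \<odot>\<^bsub>H\<^esub> y))"
      by (rule eval_at_finsum[OF noface]) (use h sm in auto)
    also have "\<dots> = (\<Oplus>y\<in>T. a y \<otimes> eval_at (t \<sigma>) y)"
      by (rule finsum_cong') (use sm ex h in auto)
    also have "\<dots> = (\<Oplus>y\<in>{x}. a y \<otimes> eval_at (t \<sigma>) y)"
    proof (rule add.finprod_mono_neutral_cong_right)
      show "a y \<otimes> eval_at (t \<sigma>) y = \<zero>" if y: "y \<in> T - {x}" for y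
      proof -
        obtain \<sigma>' where s: "\<sigma>' \<in> E" "y = cls \<sigma>'" using h y by auto
        then have "\<sigma> \<noteq> \<sigma>'" using y \<sigma> by auto
        moreover have "a y \<in> carrier R" using h y by auto
        ultimately show ?thesis using off[OF \<sigma>(1) s(1)] s by simp
      qed
    qed (use h x ex in auto)
    also have "\<dots> = a x \<otimes> eval_at (t \<sigma>) x"
    proof -
      have "a x \<in> carrier R" using h x by auto
      then show ?thesis using ex[OF x] by simp
    qed
    finally have z: "a x \<otimes> eval_at (t \<sigma>) x = \<zero>" by simp
    obtain p where "eval_at (t \<sigma>) x = sgn_pow p" using unit[OF \<sigma>(1)] \<sigma>(2) by auto
    then show "a x = \<zero>" using cancel z h x by auto
  qed
  then have "enat (card (cls ` E)) \<le> module_rank R H"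
    unfolding module_rank_def by (intro SUP_upper) (use assms(3) in auto)
  then show ?thesis by (simp add: card_image[OF inj])
qed

end

section \<open>The middle layer\<close>

text \<open>The second moment method for a uniform \<open>B \<subseteq> V\<close>, written with
  counts. \<open>X B\<close> is the number of \<open>\<sigma>\<close> with
  \<open>f \<sigma> \<subseteq> B\<close>, and \<open>P B\<close> the number of ordered pairs of
  distinct such members whose sets intersect; at least \<open>X B - P B\<close> members are
  isolated. The union of two intersecting sets has at least \<open>2 * q - 1\<close> points, so the
  mean of \<open>P\<close> is at most \<open>2 * q ^ 2 / 2 ^ q * \<mu>\<close>, and disjoint pairs
  contribute at most \<open>\<mu> ^ 2\<close> to the second moment of \<open>X\<close>.\<close>

lemma few_isolated_sets:
  fixes f :: "'b \<Rightarrow> 'a set" and \<epsilon> \<mu> :: real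
  assumes finV: "finite V" and finG: "finite \<G>"
    and f: "\<And>\<sigma>. \<sigma> \<in> \<G> \<Longrightarrow> f \<sigma> \<subseteq> V" "\<And>\<sigma>. \<sigma> \<in> \<G> \<Longrightarrow> card (f \<sigma>) = q"
    and pair: "\<And>\<sigma> \<sigma>'. \<sigma> \<in> \<G> \<Longrightarrow> \<sigma>' \<in> \<G> \<Longrightarrow> \<sigma> \<noteq> \<sigma>' \<Longrightarrow> card (f \<sigma> \<inter> f \<sigma>') \<le> 1"
    and deg: "\<And>\<sigma>. \<sigma> \<in> \<G> \<Longrightarrow> card {\<sigma>'\<in>\<G>. \<sigma>' \<noteq> \<sigma> \<and> f \<sigma> \<inter> f \<sigma>' \<noteq> {}} \<le> q ^ 2"
    and \<mu>: "\<mu> = card \<G> / 2 ^ q" "0 < \<mu>" and \<epsilon>: "0 < \<epsilon>"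
  shows "real (card {B\<in>Pow V. real (card {\<sigma>\<in>\<G>. f \<sigma> \<subseteq> B \<and>
        (\<forall>\<sigma>'\<in>\<G>. \<sigma>' \<noteq> \<sigma> \<longrightarrow> f \<sigma>' \<subseteq> B \<longrightarrow> f \<sigma> \<inter> f \<sigma>' = {})}) < (1 - 2 * \<epsilon>) * \<mu>})
     \<le> 2 ^ card V * ((1 + 2 * real q ^ 2 / 2 ^ q) / (\<epsilon>\<^sup>2 * \<mu>) + 2 * real q ^ 2 / 2 ^ q / \<epsilon>)"
proof -
  define M :: real where "M = 2 ^ card V"
  define p :: real where "p = 1 / 2 ^ q"
  define Shr where "Shr = (SIGMA \<sigma>:\<G>. {\<sigma>'\<in>\<G>. \<sigma>' \<noteq> \<sigma> \<and> f \<sigma> \<inter> f \<sigma>' \<noteq> {}})"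
  define X where "X B = (\<Sum>\<sigma>\<in>\<G>. of_bool (f \<sigma> \<subseteq> B) :: real)" for B
  define P where "P B = (\<Sum>s\<in>Shr. of_bool (f (fst s) \<union> f (snd s) \<subseteq> B) :: real)" for B
  have finPow: "finite (Pow V)" using finV by simp
  have finShr: "finite Shr" using finG by (auto simp: Shr_def)
  have p0: "0 < p" by (simp add: p_def)
  have \<mu>p: "\<mu> = card \<G> * p" by (simp add: \<mu> p_def)
  have cShr: "card Shr \<le> real q ^ 2 * card \<G>"
  proof -
    have "card Shr = (\<Sum>\<sigma>\<in>\<G>. card {\<sigma>'\<in>\<G>. \<sigma>' \<noteq> \<sigma> \<and> f \<sigma> \<inter> f \<sigma>' \<noteq> {}})"
      unfolding Shr_def using finG by (intro card_SigmaI) auto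
    also have "\<dots> \<le> (\<Sum>\<sigma>\<in>\<G>. q ^ 2)" using deg by (rule sum_mono)
    finally have "real (card Shr) \<le> real (q ^ 2 * card \<G>)" by (simp only: of_nat_le_iff) (simp add: mult.commute)
    then show ?thesis by simp
  qed
  have count: "(\<Sum>B\<in>Pow V. of_bool (S \<subseteq> B) :: real) = M / 2 ^ card S" if "S \<subseteq> V" for S
  proof -
    have "(\<Sum>B\<in>Pow V. of_bool (S \<subseteq> B) :: real) = real (card {B\<in>Pow V. S \<subseteq> B})"
      using finPow by (simp add: of_bool_def sum.If_cases Int_def)
    then show ?thesis using card_interval[OF finV that] by (simp add: M_def)
  qed
  have union: "M / 2 ^ card (f \<sigma> \<union> f \<sigma>') \<le> 2 * p\<^sup>2 * M" if s: "(\<sigma>, \<sigma>') \<in> Shr" for \<sigma> \<sigma>'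
  proof -
    have s': "\<sigma> \<in> \<G>" "\<sigma>' \<in> \<G>" "\<sigma> \<noteq> \<sigma>'" using s by (auto simp: Shr_def)
    have "finite (f \<sigma>)" "finite (f \<sigma>')" using f s' finV finite_subset by blast+
    then have "card (f \<sigma>) + card (f \<sigma>') = card (f \<sigma> \<union> f \<sigma>') + card (f \<sigma> \<inter> f \<sigma>')" by (rule card_Un_Int)
    then have "2 * q \<le> Suc (card (f \<sigma> \<union> f \<sigma>'))" using f(2) s' pair[OF s'] by simp
    then have "(2::real) ^ (2 * q) \<le> 2 ^ Suc (card (f \<sigma> \<union> f \<sigma>'))" by (intro power_increasing) auto
    then have "(2 ^ q)\<^sup>2 \<le> (2::real) * 2 ^ card (f \<sigma> \<union> f \<sigma>')" by (simp add: power_mult[symmetric] mult.commute)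
    then have "M * (2 ^ q)\<^sup>2 \<le> M * (2 * 2 ^ card (f \<sigma> \<union> f \<sigma>'))" by (intro mult_left_mono) (simp_all add: M_def)
    then show ?thesis by (simp add: p_def field_simps)
  qed
  have sumX: "(\<Sum>B\<in>Pow V. X B) = M * \<mu>"
  proof -
    have "(\<Sum>B\<in>Pow V. X B) = (\<Sum>\<sigma>\<in>\<G>. \<Sum>B\<in>Pow V. of_bool (f \<sigma> \<subseteq> B))"
      unfolding X_def by (rule sum.swap)
    also have "\<dots> = (\<Sum>\<sigma>\<in>\<G>. M * p)" using count f by (intro sum.cong) (auto simp: p_def)
    finally show ?thesis by (simp add: \<mu>p)
  qed
  have sumP: "(\<Sum>B\<in>Pow V. P B) \<le> M * (2 * real q ^ 2 * p * \<mu>)"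
  proof -
    have "(\<Sum>B\<in>Pow V. P B) = (\<Sum>s\<in>Shr. \<Sum>B\<in>Pow V. of_bool (f (fst s) \<union> f (snd s) \<subseteq> B))"
      unfolding P_def by (rule sum.swap)
    also have "\<dots> = (\<Sum>s\<in>Shr. M / 2 ^ card (f (fst s) \<union> f (snd s)))"
      by (intro sum.cong count) (auto simp: Shr_def dest: f(1)[THEN subsetD])
    also have "\<dots> \<le> (\<Sum>s\<in>Shr. 2 * p\<^sup>2 * M)" using union by (intro sum_mono) auto
    also have "\<dots> = card Shr * (2 * p\<^sup>2 * M)" by simp
    also have "\<dots> \<le> real q ^ 2 * card \<G> * (2 * p\<^sup>2 * M)"
      using cShr by (intro mult_right_mono) (auto simp: M_def)
    finally show ?thesis by (simp add: \<mu>p power2_eq_square mult_ac)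
  qed
  have sumX2: "(\<Sum>B\<in>Pow V. (X B)\<^sup>2) \<le> M * (\<mu> + \<mu>\<^sup>2 + 2 * real q ^ 2 * p * \<mu>)"
  proof -
    have "(X B)\<^sup>2 \<le> X B + (\<Sum>s\<in>\<G> \<times> \<G> - Shr - Id. of_bool (f (fst s) \<union> f (snd s) \<subseteq> B)) + P B" for B
    proof -
      have "(X B)\<^sup>2 = (\<Sum>s\<in>\<G> \<times> \<G>. of_bool (f (fst s) \<union> f (snd s) \<subseteq> B))"
        unfolding X_def power2_eq_square sum_product sum.cartesian_product
        by (intro sum.cong) (auto simp: of_bool_def split: if_splits)
      also have "\<G> \<times> \<G> = (\<G> \<times> \<G> - Shr - Id) \<union> ((\<lambda>\<sigma>. (\<sigma>, \<sigma>)) ` \<G> \<union> Shr)" by (auto simp: Shr_def)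
      also have "(\<Sum>s\<in>(\<G> \<times> \<G> - Shr - Id) \<union> ((\<lambda>\<sigma>. (\<sigma>, \<sigma>)) ` \<G> \<union> Shr). of_bool (f (fst s) \<union> f (snd s) \<subseteq> B))
         = (\<Sum>s\<in>\<G> \<times> \<G> - Shr - Id. of_bool (f (fst s) \<union> f (snd s) \<subseteq> B))
          + (\<Sum>s\<in>(\<lambda>\<sigma>. (\<sigma>, \<sigma>)) ` \<G> \<union> Shr. of_bool (f (fst s) \<union> f (snd s) \<subseteq> B) :: real)"
        by (rule sum.union_disjoint) (use finG finShr in auto)
      also have "(\<Sum>s\<in>(\<lambda>\<sigma>. (\<sigma>, \<sigma>)) ` \<G> \<union> Shr. of_bool (f (fst s) \<union> f (snd s) \<subseteq> B) :: real)
         = (\<Sum>s\<in>(\<lambda>\<sigma>. (\<sigma>, \<sigma>)) ` \<G>. of_bool (f (fst s) \<union> f (snd s) \<subseteq> B)) + P B"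
        unfolding P_def by (rule sum.union_disjoint) (use finG finShr in \<open>auto simp: Shr_def\<close>)
      also have "(\<Sum>s\<in>(\<lambda>\<sigma>. (\<sigma>, \<sigma>)) ` \<G>. of_bool (f (fst s) \<union> f (snd s) \<subseteq> B)) = X B"
        unfolding X_def by (subst sum.reindex) (auto simp: inj_on_def)
      finally show ?thesis by simp
    qed
    then have "(\<Sum>B\<in>Pow V. (X B)\<^sup>2) \<le> (\<Sum>B\<in>Pow V.
        X B + (\<Sum>s\<in>\<G> \<times> \<G> - Shr - Id. of_bool (f (fst s) \<union> f (snd s) \<subseteq> B)) + P B)"
      by (rule sum_mono)
    also have "\<dots> = M * \<mu> + (\<Sum>s\<in>\<G> \<times> \<G> - Shr - Id. \<Sum>B\<in>Pow V. of_bool (f (fst s) \<union> f (snd s) \<subseteq> B))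
        + (\<Sum>B\<in>Pow V. P B)"
      by (simp add: sum.distrib sumX sum.swap[of _ _ "Pow V"])
    also have "(\<Sum>s\<in>\<G> \<times> \<G> - Shr - Id. \<Sum>B\<in>Pow V. of_bool (f (fst s) \<union> f (snd s) \<subseteq> B))
        = (\<Sum>s\<in>\<G> \<times> \<G> - Shr - Id. M * p\<^sup>2)"
    proof (rule sum.cong)
      fix s assume s: "s \<in> \<G> \<times> \<G> - Shr - Id"
      then have s': "fst s \<in> \<G>" "snd s \<in> \<G>" "f (fst s) \<inter> f (snd s) = {}" by (auto simp: Shr_def)
      have "finite (f (fst s))" "finite (f (snd s))" using f s' finV finite_subset by blast+
      then have "card (f (fst s) \<union> f (snd s)) = 2 * q" using s' f(2) by (simp add: card_Un_disjoint)
      moreover have "f (fst s) \<union> f (snd s) \<subseteq> V" using f s' by auto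
      ultimately show "(\<Sum>B\<in>Pow V. of_bool (f (fst s) \<union> f (snd s) \<subseteq> B)) = M * p\<^sup>2"
        using count[of "f (fst s) \<union> f (snd s)"] by (simp add: p_def power_divide power_even_eq[of 2 q])
    qed simp
    also have "\<dots> \<le> (\<Sum>s\<in>\<G> \<times> \<G>. M * p\<^sup>2)" using finG by (intro sum_mono2) (auto simp: M_def)
    also have "\<dots> = M * \<mu>\<^sup>2" by (simp add: card_cartesian_product \<mu>p power2_eq_square)
    finally show ?thesis using sumP by (simp add: algebra_simps)
  qed
  have var: "(\<Sum>B\<in>Pow V. (X B - \<mu>)\<^sup>2) \<le> M * (\<mu> + 2 * real q ^ 2 * p * \<mu>)"
  proof -
    have "(\<Sum>B\<in>Pow V. (X B - \<mu>)\<^sup>2) = (\<Sum>B\<in>Pow V. (X B)\<^sup>2) - 2 * \<mu> * (\<Sum>B\<in>Pow V. X B) + (\<Sum>B\<in>Pow V. \<mu>\<^sup>2)"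
      by (simp add: power2_diff sum.distrib sum_subtractf sum_distrib_left algebra_simps)
    also have "(\<Sum>B\<in>Pow V. \<mu>\<^sup>2) = M * \<mu>\<^sup>2" by (simp add: M_def card_Pow finV)
    finally show ?thesis using sumX2 sumX by (simp add: algebra_simps power2_eq_square)
  qed
  let ?iso = "\<lambda>B. {\<sigma>\<in>\<G>. f \<sigma> \<subseteq> B \<and> (\<forall>\<sigma>'\<in>\<G>. \<sigma>' \<noteq> \<sigma> \<longrightarrow> f \<sigma>' \<subseteq> B \<longrightarrow> f \<sigma> \<inter> f \<sigma>' = {})}"
  have iso: "X B - P B \<le> card (?iso B)" for B
  proof -
    let ?A = "{\<sigma>\<in>\<G>. f \<sigma> \<subseteq> B}" and ?S = "{s\<in>Shr. f (fst s) \<union> f (snd s) \<subseteq> B}"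
    have "?A - ?iso B \<subseteq> fst ` ?S"
    proof
      fix \<sigma> assume "\<sigma> \<in> ?A - ?iso B"
      then obtain \<sigma>' where "\<sigma> \<in> \<G>" "f \<sigma> \<subseteq> B" "\<sigma>' \<in> \<G>" "\<sigma>' \<noteq> \<sigma>" "f \<sigma>' \<subseteq> B" "f \<sigma> \<inter> f \<sigma>' \<noteq> {}" by auto
      then have "(\<sigma>, \<sigma>') \<in> ?S" by (auto simp: Shr_def)
      then show "\<sigma> \<in> fst ` ?S" by force
    qed
    then have "card (?A - ?iso B) \<le> card ?S"
      using finShr by (intro surj_card_le[of ?S]) auto
    moreover have "card ?A \<le> card (?iso B) + card (?A - ?iso B)"
    proof -
      have "?A = ?iso B \<union> (?A - ?iso B)" by auto
      then show ?thesis using card_Un_le[of "?iso B" "?A - ?iso B"] by simp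
    qed
    moreover have "X B = card ?A" using finG by (simp add: X_def of_bool_def sum.If_cases Int_def)
    moreover have "P B = card ?S" using finShr by (simp add: P_def of_bool_def sum.If_cases Int_def)
    ultimately show ?thesis by linarith
  qed
  have P0: "0 \<le> P B" for B by (simp add: P_def sum_nonneg)
  let ?bad = "{B\<in>Pow V. real (card (?iso B)) < (1 - 2 * \<epsilon>) * \<mu>}"
  \<comment> \<open>A deficit of \<open>2 * \<epsilon> * \<mu>\<close> needs \<open>P B\<close> or
    the deviation of \<open>X B\<close> to account for \<open>\<epsilon> * \<mu>\<close>: the two
    terms are the Chebyshev bound for \<open>X\<close> and the Markov bound for
    \<open>P\<close>.\<close>
  have ind: "1 \<le> (X B - \<mu>)\<^sup>2 / (\<epsilon> * \<mu>)\<^sup>2 + P B / (\<epsilon> * \<mu>)" if B: "B \<in> ?bad" for B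
  proof (cases "\<epsilon> * \<mu> \<le> P B")
    case True
    then have "1 \<le> P B / (\<epsilon> * \<mu>)" using \<epsilon> \<mu>(2) by simp
    then show ?thesis by (simp add: add_increasing)
  next
    case False
    have "X B - P B < (1 - 2 * \<epsilon>) * \<mu>" using B iso[of B] by simp
    then have "\<epsilon> * \<mu> \<le> \<mu> - X B" using False by (simp add: algebra_simps)
    then have "(\<epsilon> * \<mu>)\<^sup>2 \<le> (\<mu> - X B)\<^sup>2" using \<epsilon> \<mu>(2) by (intro power_mono) auto
    then have "1 \<le> (X B - \<mu>)\<^sup>2 / (\<epsilon> * \<mu>)\<^sup>2" using \<epsilon> \<mu>(2) by (simp add: power2_commute)
    moreover have "0 \<le> P B / (\<epsilon> * \<mu>)" using P0 \<epsilon> \<mu>(2) by simp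
    ultimately show ?thesis by linarith
  qed
  have "real (card ?bad) = (\<Sum>B\<in>?bad. 1)" by simp
  also have "\<dots> \<le> (\<Sum>B\<in>?bad. (X B - \<mu>)\<^sup>2 / (\<epsilon> * \<mu>)\<^sup>2 + P B / (\<epsilon> * \<mu>))" using ind by (rule sum_mono)
  also have "\<dots> \<le> (\<Sum>B\<in>Pow V. (X B - \<mu>)\<^sup>2 / (\<epsilon> * \<mu>)\<^sup>2 + P B / (\<epsilon> * \<mu>))"
    using finPow P0 \<epsilon> \<mu>(2) by (intro sum_mono2) auto
  also have "\<dots> = (\<Sum>B\<in>Pow V. (X B - \<mu>)\<^sup>2) / (\<epsilon> * \<mu>)\<^sup>2 + (\<Sum>B\<in>Pow V. P B) / (\<epsilon> * \<mu>)"
    by (simp add: sum.distrib sum_divide_distrib)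
  also have "\<dots> \<le> M * (\<mu> + 2 * real q ^ 2 * p * \<mu>) / (\<epsilon> * \<mu>)\<^sup>2 + M * (2 * real q ^ 2 * p * \<mu>) / (\<epsilon> * \<mu>)"
    using var sumP \<epsilon> \<mu>(2) by (intro add_mono divide_right_mono) auto
  also have "\<dots> = M * ((1 + 2 * real q ^ 2 * p) / (\<epsilon>\<^sup>2 * \<mu>) + 2 * real q ^ 2 * p / \<epsilon>)"
    using \<epsilon> \<mu>(2) by (simp add: field_simps power2_eq_square)
  finally show ?thesis by (simp add: M_def p_def)
qed

section \<open>Conditioning on the faces outside the middle layer\<close>

lemma card_meeting_facets:
  assumes "Y \<subseteq> layer n k"
  shows "card {\<sigma>\<in>layer n (Suc k). facets \<sigma> \<inter> Y \<noteq> {}} \<le> card Y * (n - k)"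
proof -
  have finY: "finite Y" using finite_subset[OF assms finite_layer] .
  have "{\<sigma>\<in>layer n (Suc k). facets \<sigma> \<inter> Y \<noteq> {}} = (\<Union>y\<in>Y. {\<sigma>\<in>layer n (Suc k). y \<in> facets \<sigma>})" by auto
  then have "card {\<sigma>\<in>layer n (Suc k). facets \<sigma> \<inter> Y \<noteq> {}}
      \<le> (\<Sum>y\<in>Y. card {\<sigma>\<in>layer n (Suc k). y \<in> facets \<sigma>})"
    using card_UN_le[OF finY, of "\<lambda>y. {\<sigma>\<in>layer n (Suc k). y \<in> facets \<sigma>}"] by simp
  also have "\<dots> = (\<Sum>y\<in>Y. n - k)" using assms by (intro sum.cong refl card_cofacets) auto
  finally show ?thesis by simp
qed

lemma card_facet_shadow_le:
  assumes "F \<subseteq> layer n k"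
  shows "card (facet_shadow F) \<le> card F * k"
proof -
  have "card (facet_shadow F) \<le> (\<Sum>x\<in>F. card (facets x))"
    unfolding facet_shadow_def using finite_subset[OF assms finite_layer] by (rule card_UN_le)
  also have "\<dots> = (\<Sum>x\<in>F. k)" using assms by (intro sum.cong) (auto simp: card_facets layer_def)
  finally show ?thesis by simp
qed

text \<open>Given the faces outside the layer \<open>m\<close>, the faces in this layer are the shadow of the
  \<open>(m + 1)\<close>-sets together with an arbitrary set of these.\<close>

definition free_faces :: "nat \<Rightarrow> nat \<Rightarrow> nat set set \<Rightarrow> nat set set" where
  "free_faces n m \<Delta> = {x\<in>layer n m. x \<notin> facet_shadow (level (Suc m) \<Delta>) \<and> facets x \<subseteq> \<Delta>}"

lemma level_Diff_layer:
  "\<Delta> \<subseteq> Pow {1..n} \<Longrightarrow> k \<noteq> m \<Longrightarrow> level k (\<Delta> - layer n m) = level k \<Delta>"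
  by (auto simp: level_def layer_def)

lemma complex_subset_Pow: "\<Delta> \<in> simplicial_complexes n \<Longrightarrow> \<Delta> \<subseteq> Pow {1..n}"
  using face_subset by blast

lemma facets_in_complex:
  assumes "\<Delta> \<in> simplicial_complexes n" "x \<in> \<Delta>" "card x \<noteq> 1"
  shows "facets x \<subseteq> \<Delta>"
proof
  fix y assume y: "y \<in> facets x"
  have "y \<subseteq> x" "card x = Suc (card y)" using y finite_face[OF assms(1,2)] by (auto simp: facet_iff)
  moreover from this have "y \<noteq> {}" using assms(3) by auto
  ultimately show "y \<in> \<Delta>" using face_mono[OF assms(1,2)] by blast
qed

text \<open>A face of size \<open>m\<close> outside the forced shadow is free: its facets have size
  \<open>m - 1\<close>, so they survive the removal of layer \<open>m\<close>. With
  \<open>2 \<le> m\<close> they are nonempty and hence faces of \<open>\<Delta>\<close>.\<close>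

lemma complex_decomposition:
  assumes D: "\<Delta> \<in> simplicial_complexes n" and m: "2 \<le> m"
  defines "\<Omega> \<equiv> \<Delta> - layer n m"
  shows "\<Delta> = \<Omega> \<union> facet_shadow (level (Suc m) \<Omega>) \<union> (\<Delta> \<inter> free_faces n m \<Omega>)"
proof -
  have lev: "level (Suc m) \<Omega> = level (Suc m) \<Delta>"
    unfolding \<Omega>_def by (rule level_Diff_layer[OF complex_subset_Pow[OF D]]) simp
  have "facet_shadow (level (Suc m) \<Delta>) \<subseteq> \<Delta>"
    using facets_in_complex[OF D] m by (fastforce simp: facet_shadow_def level_def)
  moreover have "x \<in> free_faces n m \<Omega>"
    if x: "x \<in> \<Delta>" "x \<in> layer n m" "x \<notin> facet_shadow (level (Suc m) \<Omega>)" for x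
  proof -
    have "facets x \<subseteq> \<Delta>" using facets_in_complex[OF D x(1)] x(2) m by (auto simp: layer_def)
    moreover have "y \<notin> layer n m" if "y \<in> facets x" for y
      using that x(2) finite_face[OF D x(1)] by (auto simp: facet_iff layer_def)
    ultimately show ?thesis using x by (auto simp: free_faces_def \<Omega>_def)
  qed
  ultimately show ?thesis unfolding lev \<Omega>_def[symmetric] by (auto simp: lev \<Omega>_def)
qed

text \<open>The converse of the decomposition: every set of free faces can be added. An
  \<open>m\<close>-set properly below a face lies below a face of size \<open>m + 1\<close>, hence
  in the shadow, and whatever lies properly below a free face lies below one of its facets, which
  are present.\<close>

lemma recombined_complex:
  assumes D: "\<Delta> \<in> simplicial_complexes n" and m: "2 \<le> m"
  defines "\<Omega> \<equiv> \<Delta> - layer n m"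
  assumes B: "B \<subseteq> free_faces n m \<Omega>"
  shows "\<Omega> \<union> facet_shadow (level (Suc m) \<Omega>) \<union> B \<in> simplicial_complexes n"
    and "(\<Omega> \<union> facet_shadow (level (Suc m) \<Omega>) \<union> B) - layer n m = \<Omega>"
proof -
  let ?S = "facet_shadow (level (Suc m) \<Omega>)"
  have lev: "level (Suc m) \<Omega> = level (Suc m) \<Delta>"
    unfolding \<Omega>_def by (rule level_Diff_layer[OF complex_subset_Pow[OF D]]) simp
  have SD: "?S \<subseteq> \<Delta>"
    unfolding lev using facets_in_complex[OF D] m by (fastforce simp: facet_shadow_def level_def)
  have Sl: "?S \<subseteq> layer n m"
    unfolding lev by (intro facet_shadow_layer level_subset_layer complex_subset_Pow[OF D])
  have Bl: "B \<subseteq> layer n m" using B by (auto simp: free_faces_def)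
  show "(\<Omega> \<union> ?S \<union> B) - layer n m = \<Omega>" using Sl Bl by (auto simp: \<Omega>_def)
  show "\<Omega> \<union> ?S \<union> B \<in> simplicial_complexes n"
  proof (rule simplicial_complexesI)
    show "\<Omega> \<union> ?S \<union> B \<subseteq> Pow {1..n}"
      using complex_subset_Pow[OF D] SD Bl by (auto simp: \<Omega>_def layer_def)
    show "{} \<notin> \<Omega> \<union> ?S \<union> B"
      using D SD Bl m by (auto simp: \<Omega>_def simplicial_complexes_def layer_def)
    fix x y assume xy: "x \<in> \<Omega> \<union> ?S \<union> B" "y \<subseteq> x" "y \<noteq> {}"
    show "y \<in> \<Omega> \<union> ?S \<union> B"
    proof (cases "x \<in> \<Delta>")
      case True
      have yD: "y \<in> \<Delta>" using face_mono[OF D True xy(2,3)] .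
      show ?thesis
      proof (cases "y \<in> layer n m")
        case ylayer: True
        have fx: "finite x" using finite_face[OF D True] .
        show ?thesis
        proof (cases "x = y")
          case False
          then have "card y < card x" using xy fx by (intro psubset_card_mono) auto
          then have "card y + 1 \<le> card x" by simp
          then obtain z where z: "y \<subseteq> z" "z \<subseteq> x" "card z = card y + 1"
            using exists_subset_between[of y "card y + 1" x] xy fx by auto
          have "z \<noteq> {}" using z xy by auto
          then have zD: "z \<in> \<Delta>" using face_mono[OF D True z(2)] by simp
          have "card z = Suc m" using z ylayer by (simp add: layer_def)
          then have "z \<in> level (Suc m) \<Omega>" using zD unfolding lev by (simp add: level_def)
          moreover have "y \<in> facets z" using z finite_face[OF D zD] by (simp add: facet_iff)
          ultimately show ?thesis by (auto simp: facet_shadow_def)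
        qed (use xy in auto)
      qed (use yD in \<open>auto simp: \<Omega>_def\<close>)
    next
      case False
      then have xB: "x \<in> B" using xy SD by (auto simp: \<Omega>_def)
      then have fx: "finite x" using Bl layer_finite by blast
      show ?thesis
      proof (cases "x = y")
        case False
        then obtain v where v: "v \<in> x" "v \<notin> y" using xy by auto
        then have "x - {v} \<in> \<Delta>" using xB B by (auto simp: free_faces_def facets_def \<Omega>_def)
        then have yD: "y \<in> \<Delta>" by (rule face_mono[OF D]) (use v xy in auto)
        have "card y < card x" using False xy fx by (intro psubset_card_mono) auto
        then have "y \<notin> layer n m" using xB Bl by (auto simp: layer_def)
        then show ?thesis using yD by (simp add: \<Omega>_def)
      qed (use xy in auto)
    qed
  qed
qed

text \<open>The law of total probability over the outer part \<open>\<Omega>\<close>. Each fibre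
  contains a cube indexed by the subsets of \<open>free_faces\<close>, and every complex of the
  fibre arises from it; so a bound for the proportion of bad subsets, uniform over the
  \<open>\<Omega>\<close> that satisfy \<open>Q\<close>, passes to all complexes.\<close>

lemma card_complexes_by_fibre:
  fixes e :: real
  assumes m: "2 \<le> m" and e: "0 \<le> e"
    and fibre: "\<And>\<Delta>. \<Delta> \<in> simplicial_complexes n \<Longrightarrow> Q (\<Delta> - layer n m) \<Longrightarrow>
      real (card {B\<in>Pow (free_faces n m (\<Delta> - layer n m)).
        bad ((\<Delta> - layer n m) \<union> facet_shadow (level (Suc m) (\<Delta> - layer n m)) \<union> B)})
      \<le> 2 ^ card (free_faces n m (\<Delta> - layer n m)) * e"
  shows "real (card {\<Delta>\<in>simplicial_complexes n. Q (\<Delta> - layer n m) \<and> bad \<Delta>})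
    \<le> card (simplicial_complexes n) * e"
proof -
  let ?SC = "simplicial_complexes n"
  define g where "g \<Delta> = \<Delta> - layer n m" for \<Delta>
  define r where "r \<Omega> B = \<Omega> \<union> facet_shadow (level (Suc m) \<Omega>) \<union> B" for \<Omega> B
  have fin: "finite ?SC" by (rule finite_simplicial_complexes)
  have finF: "finite (free_faces n m \<Omega>)" for \<Omega> by (simp add: free_faces_def)
  have one: "real (card {\<Delta>\<in>?SC. (Q (g \<Delta>) \<and> bad \<Delta>) \<and> g \<Delta> = \<Omega>}) \<le> real (card {\<Delta>\<in>?SC. g \<Delta> = \<Omega>}) * e"
    if \<Omega>: "\<Omega> \<in> g ` ?SC" for \<Omega>
  proof -
    obtain \<Delta> where \<Delta>: "\<Delta> \<in> ?SC" "\<Omega> = \<Delta> - layer n m" using \<Omega> by (auto simp: g_def)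
    have inj: "inj_on (r \<Omega>) (Pow (free_faces n m \<Omega>))"
    proof (rule inj_on_inverseI)
      fix B assume "B \<in> Pow (free_faces n m \<Omega>)"
      then show "r \<Omega> B \<inter> free_faces n m \<Omega> = B" using \<Delta>(2) by (auto simp: r_def free_faces_def)
    qed
    have img: "r \<Omega> B \<in> ?SC" "g (r \<Omega> B) = \<Omega>" if "B \<in> Pow (free_faces n m \<Omega>)" for B
      using recombined_complex[OF \<Delta>(1) m, of B] that by (simp_all add: g_def r_def \<Delta>(2))
    have "2 ^ card (free_faces n m \<Omega>) = card (r \<Omega> ` Pow (free_faces n m \<Omega>))"
      using card_image[OF inj] by (simp add: card_Pow finF)
    also have "\<dots> \<le> card {\<Delta>\<in>?SC. g \<Delta> = \<Omega>}" using img fin by (intro card_mono) auto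
    finally have "real (2 ^ card (free_faces n m \<Omega>)) \<le> real (card {\<Delta>\<in>?SC. g \<Delta> = \<Omega>})"
      by (simp only: of_nat_le_iff)
    then have lower: "2 ^ card (free_faces n m \<Omega>) * e \<le> real (card {\<Delta>\<in>?SC. g \<Delta> = \<Omega>}) * e"
      using e by (intro mult_right_mono) auto
    show ?thesis
    proof (cases "Q \<Omega>")
      case True
      have "{\<Delta>\<in>?SC. (Q (g \<Delta>) \<and> bad \<Delta>) \<and> g \<Delta> = \<Omega>} \<subseteq> r \<Omega> ` {B\<in>Pow (free_faces n m \<Omega>). bad (r \<Omega> B)}"
      proof
        fix \<Delta>' assume h: "\<Delta>' \<in> {\<Delta>\<in>?SC. (Q (g \<Delta>) \<and> bad \<Delta>) \<and> g \<Delta> = \<Omega>}"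
        then have "\<Delta>' = r \<Omega> (\<Delta>' \<inter> free_faces n m \<Omega>)"
          using complex_decomposition[of \<Delta>' n m] m by (simp add: r_def g_def)
        then show "\<Delta>' \<in> r \<Omega> ` {B\<in>Pow (free_faces n m \<Omega>). bad (r \<Omega> B)}"
          using h by (intro image_eqI[of _ _ "\<Delta>' \<inter> free_faces n m \<Omega>"]) auto
      qed
      then have "card {\<Delta>\<in>?SC. (Q (g \<Delta>) \<and> bad \<Delta>) \<and> g \<Delta> = \<Omega>} \<le> card {B\<in>Pow (free_faces n m \<Omega>). bad (r \<Omega> B)}"
        by (rule surj_card_le[rotated]) (simp add: finF)
      then have "real (card {\<Delta>\<in>?SC. (Q (g \<Delta>) \<and> bad \<Delta>) \<and> g \<Delta> = \<Omega>})
          \<le> real (card {B\<in>Pow (free_faces n m \<Omega>). bad (r \<Omega> B)})" by (simp only: of_nat_le_iff)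
      also have "\<dots> \<le> 2 ^ card (free_faces n m \<Omega>) * e"
        using fibre[OF \<Delta>(1)] True unfolding \<Delta>(2) r_def by simp
      finally show ?thesis using lower by linarith
    next
      case False
      then have z: "{\<Delta>\<in>?SC. (Q (g \<Delta>) \<and> bad \<Delta>) \<and> g \<Delta> = \<Omega>} = {}" by auto
      show ?thesis unfolding z using e by simp
    qed
  qed
  have group: "real (card {\<Delta>\<in>?SC. P \<Delta>}) = (\<Sum>\<Omega>\<in>g ` ?SC. real (card {\<Delta>\<in>?SC. P \<Delta> \<and> g \<Delta> = \<Omega>}))" for P
  proof -
    have "real (card {\<Delta>\<in>?SC. P \<Delta>}) = (\<Sum>\<Delta>\<in>?SC. of_bool (P \<Delta>))"
      using fin by (simp add: of_bool_def sum.If_cases Int_def)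
    also have "\<dots> = (\<Sum>\<Omega>\<in>g ` ?SC. \<Sum>\<Delta>\<in>{\<Delta>\<in>?SC. g \<Delta> = \<Omega>}. of_bool (P \<Delta>))"
      by (rule sum.image_gen[OF fin])
    also have "\<dots> = (\<Sum>\<Omega>\<in>g ` ?SC. real (card {\<Delta>\<in>?SC. P \<Delta> \<and> g \<Delta> = \<Omega>}))"
    proof (rule sum.cong)
      fix \<Omega>
      have "{\<Delta>\<in>?SC. g \<Delta> = \<Omega>} \<inter> {\<Delta>. P \<Delta>} = {\<Delta>\<in>?SC. P \<Delta> \<and> g \<Delta> = \<Omega>}" by auto
      then show "(\<Sum>\<Delta>\<in>{\<Delta>\<in>?SC. g \<Delta> = \<Omega>}. of_bool (P \<Delta>)) = real (card {\<Delta>\<in>?SC. P \<Delta> \<and> g \<Delta> = \<Omega>})"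
        using fin by (simp add: of_bool_def sum.If_cases)
    qed simp
    finally show ?thesis .
  qed
  have "real (card {\<Delta>\<in>?SC. Q (g \<Delta>) \<and> bad \<Delta>})
      = (\<Sum>\<Omega>\<in>g ` ?SC. real (card {\<Delta>\<in>?SC. (Q (g \<Delta>) \<and> bad \<Delta>) \<and> g \<Delta> = \<Omega>}))"
    by (rule group)
  also have "\<dots> \<le> (\<Sum>\<Omega>\<in>g ` ?SC. real (card {\<Delta>\<in>?SC. g \<Delta> = \<Omega>}) * e)" using one by (rule sum_mono)
  also have "\<dots> = card ?SC * e" using group[of "\<lambda>_. True"] by (simp add: sum_distrib_right)
  finally show ?thesis by (simp add: g_def)
qed

text \<open>A face of size \<open>m + 1\<close> spoils its \<open>m + 1\<close> facets, each lying
  in \<open>n - m\<close> sets of size \<open>m + 1\<close>. A missing \<open>(m - 1)\<close>-set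
  spoils the \<open>n - (m - 1)\<close> sets of size \<open>m\<close> above it, each again lying in
  \<open>n - m\<close> larger ones.\<close>

lemma many_free_simplices:
  assumes O: "\<Omega> \<subseteq> Pow {1..n}" and m: "1 \<le> m"
  shows "n choose Suc m \<le> card {\<sigma>\<in>layer n (Suc m). facets \<sigma> \<subseteq> free_faces n m \<Omega>}
    + card (level (Suc m) \<Omega>) * Suc m * (n - m)
    + card (layer n (m - 1) - \<Omega>) * (n - (m - 1)) * (n - m)"
proof -
  let ?F = "level (Suc m) \<Omega>" and ?G = "layer n (m - 1) - \<Omega>"
  let ?Y = "{x\<in>layer n (Suc (m - 1)). facets x \<inter> ?G \<noteq> {}}"
  let ?A = "{\<sigma>\<in>layer n (Suc m). facets \<sigma> \<subseteq> free_faces n m \<Omega>}"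
  let ?B = "{\<sigma>\<in>layer n (Suc m). facets \<sigma> \<inter> facet_shadow ?F \<noteq> {}}"
  let ?C = "{\<sigma>\<in>layer n (Suc m). facets \<sigma> \<inter> ?Y \<noteq> {}}"
  have F: "?F \<subseteq> layer n (Suc m)" using level_subset_layer[OF O] .
  have sm: "Suc (m - 1) = m" using m by simp
  have "layer n (Suc m) \<subseteq> ?A \<union> (?B \<union> ?C)"
  proof
    fix \<sigma> assume \<sigma>: "\<sigma> \<in> layer n (Suc m)"
    show "\<sigma> \<in> ?A \<union> (?B \<union> ?C)"
    proof (cases "facets \<sigma> \<subseteq> free_faces n m \<Omega>")
      case False
      then obtain x where x: "x \<in> facets \<sigma>" "x \<notin> free_faces n m \<Omega>" by auto
      then have xl: "x \<in> layer n m" using facets_layer[OF \<sigma>] by auto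
      show ?thesis
      proof (cases "x \<in> facet_shadow ?F")
        case False
        then obtain y where "y \<in> facets x" "y \<notin> \<Omega>" using x xl by (auto simp: free_faces_def)
        moreover have "y \<in> layer n (m - 1)"
          using facets_layer[of x n "m - 1"] xl \<open>y \<in> facets x\<close> sm by auto
        ultimately have "x \<in> ?Y" using xl sm by auto
        then show ?thesis using x \<sigma> by auto
      qed (use x \<sigma> in auto)
    qed (use \<sigma> in auto)
  qed
  then have "card (layer n (Suc m)) \<le> card (?A \<union> (?B \<union> ?C))" by (intro card_mono) auto
  also have "\<dots> \<le> card ?A + (card ?B + card ?C)"
    by (rule order_trans[OF card_Un_le add_left_mono[OF card_Un_le]])
  finally have "n choose Suc m \<le> card ?A + (card ?B + card ?C)" by (simp add: card_layer)
  moreover have "card ?B \<le> card ?F * Suc m * (n - m)"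
    using card_meeting_facets[OF facet_shadow_layer[OF F]] card_facet_shadow_le[OF F]
    by (meson mult_le_mono1 order_trans)
  moreover have "card ?C \<le> card ?G * (n - (m - 1)) * (n - m)"
  proof -
    have "card ?C \<le> card ?Y * (n - m)" by (rule card_meeting_facets) (use sm in auto)
    moreover have "card ?Y \<le> card ?G * (n - (m - 1))" by (rule card_meeting_facets) auto
    ultimately show ?thesis by (meson mult_le_mono1 order_trans)
  qed
  ultimately show ?thesis by linarith
qed

definition few_defects :: "nat \<Rightarrow> real \<Rightarrow> nat set set \<Rightarrow> bool" where
  "few_defects m \<tau> \<Delta> \<longleftrightarrow>
     real (card (level (Suc m) \<Delta>)) < \<tau> \<and> real (card (layer (2 * m) (m - 1) - \<Delta>)) < \<tau>"

text \<open>The defects live in the layers \<open>m - 1\<close> and \<open>m + 1\<close>, so this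
  event is decided by the part on which one conditions.\<close>

lemma few_defects_outer:
  assumes "\<Delta> \<subseteq> Pow {1..2 * m}" "1 \<le> m"
  shows "few_defects m \<tau> (\<Delta> - layer (2 * m) m) \<longleftrightarrow> few_defects m \<tau> \<Delta>"
proof -
  have "layer (2 * m) (m - 1) - (\<Delta> - layer (2 * m) m) = layer (2 * m) (m - 1) - \<Delta>"
    using assms(2) by (auto simp: layer_def)
  then show ?thesis using level_Diff_layer[OF assms(1), of "Suc m" m] by (simp add: few_defects_def)
qed

text \<open>An isolated simplex shares no facet with the other ones, and its facets are free and so
  below no face of size \<open>m + 1\<close>; any facet can serve as \<open>t \<sigma>\<close>. The
  dimension is \<open>m - 1\<close>, since facets have \<open>m\<close> elements.\<close>

lemma rank_of_isolated_simplices: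
  fixes R :: "('a, 'r) ring_scheme" (structure)
  assumes R: "cring R" "\<one> \<noteq> \<zero>" and m: "2 \<le> m"
    and D: "\<Delta> \<in> simplicial_complexes (2 * m)" and \<Omega>: "\<Omega> = \<Delta> - layer (2 * m) m"
    and B: "B \<subseteq> free_faces (2 * m) m \<Omega>"
  defines "\<G> \<equiv> {\<sigma>\<in>layer (2 * m) (Suc m). facets \<sigma> \<subseteq> free_faces (2 * m) m \<Omega>}"
  defines "I \<equiv> {\<sigma>\<in>\<G>. facets \<sigma> \<subseteq> B \<and>
    (\<forall>\<sigma>'\<in>\<G>. \<sigma>' \<noteq> \<sigma> \<longrightarrow> facets \<sigma>' \<subseteq> B \<longrightarrow> facets \<sigma> \<inter> facets \<sigma>' = {})}"
  shows "enat (card I)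
    \<le> module_rank R (homology R (\<Omega> \<union> facet_shadow (level (Suc m) \<Omega>) \<union> B) (m - 1))"
proof -
  interpret cring R by (rule R(1))
  let ?E = "\<Omega> \<union> facet_shadow (level (Suc m) \<Omega>) \<union> B"
  have E: "?E \<in> simplicial_complexes (2 * m)" "?E - layer (2 * m) m = \<Omega>"
    using recombined_complex[OF D m] B unfolding \<Omega> by blast+
  interpret complex_chains R "2 * m" ?E "m - 1" by unfold_locales (rule E(1))
  have lev: "faces ?E (Suc (m - 1)) = level (Suc m) \<Omega>"
  proof -
    have "faces ?E (Suc (m - 1)) = level (Suc m) ?E" using m by (simp add: faces_def level_def)
    also have "\<dots> = level (Suc m) (?E - layer (2 * m) m)"
      using level_Diff_layer[OF complex_subset_Pow[OF E(1)], of "Suc m" m] by simp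
    finally show ?thesis using E(2) by simp
  qed
  define t where "t \<sigma> = (SOME x. x \<in> facets \<sigma>)" for \<sigma>
  have I: "\<sigma> \<in> layer (2 * m) (Suc m)" "facets \<sigma> \<subseteq> B" "t \<sigma> \<in> facets \<sigma>" if "\<sigma> \<in> I" for \<sigma>
  proof -
    show l: "\<sigma> \<in> layer (2 * m) (Suc m)" "facets \<sigma> \<subseteq> B" using that by (auto simp: I_def \<G>_def)
    have "\<sigma> \<noteq> {}" using l by (auto simp: layer_def)
    then have "\<exists>x. x \<in> facets \<sigma>" by (auto simp: facets_def)
    then show "t \<sigma> \<in> facets \<sigma>" unfolding t_def by (rule someI_ex)
  qed
  show ?thesis
  proof (rule card_le_module_rank_homology)
    show "1 \<le> m - 1" using m by simp
    show "finite I" by (rule finite_subset[OF _ finite_layer]) (use I in auto)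
    show "card \<sigma> = m - 1 + 2 \<and> facets \<sigma> \<subseteq> ?E \<and> t \<sigma> \<in> facets \<sigma>" if "\<sigma> \<in> I" for \<sigma>
      using I[OF that] m by (auto simp: layer_def)
    show "t \<sigma> \<notin> facets \<phi>" if "\<sigma> \<in> I" "\<phi> \<in> faces ?E (Suc (m - 1))" for \<sigma> \<phi>
    proof
      assume "t \<sigma> \<in> facets \<phi>"
      then have "t \<sigma> \<in> facet_shadow (level (Suc m) \<Omega>)"
        using that(2) unfolding lev by (auto simp: facet_shadow_def)
      moreover have "t \<sigma> \<in> free_faces (2 * m) m \<Omega>" using I[OF that(1)] B by auto
      ultimately show False by (simp add: free_faces_def)
    qed
    show "t \<sigma> \<notin> facets \<sigma>'" if "\<sigma> \<in> I" "\<sigma>' \<in> I" "\<sigma> \<noteq> \<sigma>'" for \<sigma> \<sigma>'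
      using that I(3)[OF that(1)] by (auto simp: I_def)
  qed (rule R(2))
qed

section \<open>Asymptotics of the rank bound\<close>

text \<open>Lower bound for the conditional mean number of simplices with boundary in
  \<open>\<Delta>\<close>: each of the fewer than \<open>2 * (4 ^ m / m ^ 4)\<close> defects spoils
  at most \<open>m * Suc m\<close> sets.\<close>

definition mean_bound :: "nat \<Rightarrow> real" where
  "mean_bound m = (real (2 * m choose Suc m) - 2 * (4 ^ m / real m ^ 4) * real m * real (Suc m)) / 2 ^ Suc m"

definition variance_error :: "real \<Rightarrow> real \<Rightarrow> nat \<Rightarrow> real" where
  "variance_error \<epsilon> \<mu> q = (1 + 2 * real q ^ 2 / 2 ^ q) / (\<epsilon>\<^sup>2 * \<mu>) + 2 * real q ^ 2 / 2 ^ q / \<epsilon>"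

text \<open>The conditional mean \<open>\<mu>\<close> varies with the outer part, but it stays above
  \<open>mean_bound m\<close>, and the error of the second moment method decreases in
  \<open>\<mu>\<close>. This makes the bound uniform over the fibres.\<close>

lemma few_complexes_small_rank:
  fixes R :: "('a, 'r) ring_scheme" (structure) and \<epsilon> :: real
  assumes R: "cring R" "\<one> \<noteq> \<zero>" and m: "2 \<le> m" and \<epsilon>: "0 < \<epsilon>" "\<epsilon> \<le> 1 / 2"
    and \<mu>0: "0 < mean_bound m"
  shows "real (card {\<Delta>\<in>simplicial_complexes (2 * m). few_defects m (4 ^ m / real m ^ 4) \<Delta> \<and>
      \<not> ereal ((1 - 2 * \<epsilon>) * mean_bound m) \<le> ereal_of_enat (module_rank R (homology R \<Delta> (m - 1)))})
    \<le> card (simplicial_complexes (2 * m)) * variance_error \<epsilon> (mean_bound m) (Suc m)"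
proof -
  define \<tau> where "\<tau> = 4 ^ m / real m ^ 4"
  let ?n = "2 * m"
  let ?bad = "\<lambda>\<Delta>. \<not> ereal ((1 - 2 * \<epsilon>) * mean_bound m) \<le> ereal_of_enat (module_rank R (homology R \<Delta> (m - 1)))"
  have "real (card {\<Delta>\<in>simplicial_complexes ?n. few_defects m \<tau> (\<Delta> - layer ?n m) \<and> ?bad \<Delta>})
      \<le> card (simplicial_complexes ?n) * variance_error \<epsilon> (mean_bound m) (Suc m)"
  proof (rule card_complexes_by_fibre[OF m])
    show "0 \<le> variance_error \<epsilon> (mean_bound m) (Suc m)"
      using \<epsilon> \<mu>0 by (simp add: variance_error_def)
    fix \<Delta> assume D: "\<Delta> \<in> simplicial_complexes ?n"
      and few: "few_defects m \<tau> (\<Delta> - layer ?n m)"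
    define \<Omega> where "\<Omega> = \<Delta> - layer ?n m"
    define V where "V = free_faces ?n m \<Omega>"
    define \<G> where "\<G> = {\<sigma>\<in>layer ?n (Suc m). facets \<sigma> \<subseteq> V}"
    define \<mu> where "\<mu> = card \<G> / 2 ^ Suc m"
    let ?iso = "\<lambda>B. {\<sigma>\<in>\<G>. facets \<sigma> \<subseteq> B \<and>
      (\<forall>\<sigma>'\<in>\<G>. \<sigma>' \<noteq> \<sigma> \<longrightarrow> facets \<sigma>' \<subseteq> B \<longrightarrow> facets \<sigma> \<inter> facets \<sigma>' = {})}"
    have \<Omega>sub: "\<Omega> \<subseteq> Pow {1..?n}" using complex_subset_Pow[OF D] by (auto simp: \<Omega>_def)
    have finV: "finite V" and finG: "finite \<G>" by (auto simp: V_def free_faces_def \<G>_def)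
    have \<mu>: "mean_bound m \<le> \<mu>"
    proof -
      let ?a = "card (level (Suc m) \<Omega>)" and ?b = "card (layer ?n (m - 1) - \<Omega>)"
      have "?n choose Suc m \<le> card \<G> + ?a * Suc m * (?n - m) + ?b * (?n - (m - 1)) * (?n - m)"
        unfolding \<G>_def V_def by (rule many_free_simplices[OF \<Omega>sub]) (use m in simp)
      also have "\<dots> = card \<G> + (?a + ?b) * (m * Suc m)"
      proof -
        have "?n - m = m" "?n - (m - 1) = Suc m" using m by auto
        then show ?thesis by (simp add: algebra_simps)
      qed
      finally have "real (?n choose Suc m) \<le> real (card \<G> + (?a + ?b) * (m * Suc m))"
        by (simp only: of_nat_le_iff)
      also have "\<dots> = card \<G> + (real ?a + real ?b) * (real m * real (Suc m))"
        by (simp only: of_nat_add of_nat_mult)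
      also have "\<dots> \<le> card \<G> + (\<tau> + \<tau>) * (real m * real (Suc m))"
        using few unfolding few_defects_def \<Omega>_def[symmetric] by (intro add_left_mono mult_right_mono) auto
      finally have "real (?n choose Suc m) - 2 * \<tau> * real m * real (Suc m) \<le> card \<G>"
        by (simp add: algebra_simps)
      then show ?thesis unfolding mean_bound_def \<mu>_def \<tau>_def by (intro divide_right_mono) auto
    qed
    have \<mu>pos: "0 < \<mu>" using \<mu> \<mu>0 by linarith
    have "real (card {B\<in>Pow V. real (card (?iso B)) < (1 - 2 * \<epsilon>) * \<mu>})
      \<le> 2 ^ card V * ((1 + 2 * real (Suc m) ^ 2 / 2 ^ Suc m) / (\<epsilon>\<^sup>2 * \<mu>) + 2 * real (Suc m) ^ 2 / 2 ^ Suc m / \<epsilon>)"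
    proof (rule few_isolated_sets[OF finV finG _ _ _ _ \<mu>_def \<mu>pos \<epsilon>(1)])
      show "facets \<sigma> \<subseteq> V" if "\<sigma> \<in> \<G>" for \<sigma> using that by (simp add: \<G>_def)
      show "card (facets \<sigma>) = Suc m" if "\<sigma> \<in> \<G>" for \<sigma>
        using that by (simp add: \<G>_def card_facets layer_def)
      show "card (facets \<sigma> \<inter> facets \<sigma>') \<le> 1" if "\<sigma> \<in> \<G>" "\<sigma>' \<in> \<G>" "\<sigma> \<noteq> \<sigma>'" for \<sigma> \<sigma>'
        using that by (intro card_common_facets[of _ ?n "Suc m"]) (auto simp: \<G>_def)
      show "card {\<sigma>'\<in>\<G>. \<sigma>' \<noteq> \<sigma> \<and> facets \<sigma> \<inter> facets \<sigma>' \<noteq> {}} \<le> (Suc m)\<^sup>2" if "\<sigma> \<in> \<G>" for \<sigma>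
      proof -
        have \<sigma>: "\<sigma> \<in> layer ?n (Suc m)" using that by (simp add: \<G>_def)
        have "card {\<sigma>'\<in>\<G>. \<sigma>' \<noteq> \<sigma> \<and> facets \<sigma> \<inter> facets \<sigma>' \<noteq> {}}
            \<le> card {\<sigma>'\<in>layer ?n (Suc m). facets \<sigma>' \<inter> facets \<sigma> \<noteq> {}}"
          by (intro card_mono) (auto simp: \<G>_def)
        also have "\<dots> \<le> card (facets \<sigma>) * (?n - m)" by (rule card_meeting_facets[OF facets_layer[OF \<sigma>]])
        also have "\<dots> \<le> (Suc m)\<^sup>2" using \<sigma> by (simp add: card_facets layer_def power2_eq_square)
        finally show ?thesis .
      qed
    qed
    also have "\<dots> \<le> 2 ^ card V * variance_error \<epsilon> (mean_bound m) (Suc m)"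
      unfolding variance_error_def using \<mu> \<mu>0 \<epsilon>
      by (intro mult_left_mono add_right_mono divide_left_mono) (auto intro!: mult_pos_pos add_nonneg_nonneg)
    finally have main: "real (card {B\<in>Pow V. real (card (?iso B)) < (1 - 2 * \<epsilon>) * \<mu>})
      \<le> 2 ^ card V * variance_error \<epsilon> (mean_bound m) (Suc m)" .
    have "card {B\<in>Pow V. ?bad (\<Omega> \<union> facet_shadow (level (Suc m) \<Omega>) \<union> B)}
        \<le> card {B\<in>Pow V. real (card (?iso B)) < (1 - 2 * \<epsilon>) * \<mu>}"
    proof (rule card_mono)
      show "{B\<in>Pow V. ?bad (\<Omega> \<union> facet_shadow (level (Suc m) \<Omega>) \<union> B)}
        \<subseteq> {B\<in>Pow V. real (card (?iso B)) < (1 - 2 * \<epsilon>) * \<mu>}"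
      proof (intro subsetI CollectI conjI)
        fix B assume B: "B \<in> {B\<in>Pow V. ?bad (\<Omega> \<union> facet_shadow (level (Suc m) \<Omega>) \<union> B)}"
        then show "B \<in> Pow V" by simp
        let ?H = "homology R (\<Omega> \<union> facet_shadow (level (Suc m) \<Omega>) \<union> B) (m - 1)"
        have rank: "enat (card (?iso B)) \<le> module_rank R ?H"
          unfolding \<G>_def V_def
          by (rule rank_of_isolated_simplices[OF R m D \<Omega>_def]) (use B in \<open>simp add: V_def\<close>)
        show "real (card (?iso B)) < (1 - 2 * \<epsilon>) * \<mu>"
        proof (rule ccontr)
          assume "\<not> ?thesis"
          then have "(1 - 2 * \<epsilon>) * mean_bound m \<le> real (card (?iso B))"
            using mult_left_mono[OF \<mu>, of "1 - 2 * \<epsilon>"] \<epsilon> by linarith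
          then have "ereal ((1 - 2 * \<epsilon>) * mean_bound m) \<le> ereal_of_enat (enat (card (?iso B)))" by simp
          also have "\<dots> \<le> ereal_of_enat (module_rank R ?H)"
            using rank by (simp only: ereal_of_enat_le_iff)
          finally show False using B by simp
        qed
      qed
    qed (simp add: finV)
    then have "real (card {B\<in>Pow V. ?bad (\<Omega> \<union> facet_shadow (level (Suc m) \<Omega>) \<union> B)})
        \<le> real (card {B\<in>Pow V. real (card (?iso B)) < (1 - 2 * \<epsilon>) * \<mu>})" by (simp only: of_nat_le_iff)
    then show "real (card {B\<in>Pow (free_faces ?n m (\<Delta> - layer ?n m)).
        ?bad ((\<Delta> - layer ?n m) \<union> facet_shadow (level (Suc m) (\<Delta> - layer ?n m)) \<union> B)})
      \<le> 2 ^ card (free_faces ?n m (\<Delta> - layer ?n m)) * variance_error \<epsilon> (mean_bound m) (Suc m)"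
      using main unfolding V_def \<Omega>_def by linarith
  qed
  moreover have "{\<Delta>\<in>simplicial_complexes ?n. few_defects m \<tau> (\<Delta> - layer ?n m) \<and> ?bad \<Delta>}
      = {\<Delta>\<in>simplicial_complexes ?n. few_defects m \<tau> \<Delta> \<and> ?bad \<Delta>}"
    using few_defects_outer[OF complex_subset_Pow, of _ m \<tau>] m by auto
  ultimately show ?thesis by (simp add: \<tau>_def)
qed

text \<open>Turns the limit \<open>pi / 2\<close> of the Wallis product into the asymptotics of the
  central binomial coefficient; the induction rests on its ratio
  \<open>2 * (2 * m + 1) / (m + 1)\<close> of consecutive values.\<close>

lemma wallis_product_central_binomial:
  "(\<Prod>k=1..m. (4 * real k ^ 2) / (4 * real k ^ 2 - 1))
     = (4 ^ m / real (2 * m choose m))\<^sup>2 / (2 * real m + 1)"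
proof (induction m)
  case (Suc m)
  have "real (Suc m) * real (2 * Suc m choose Suc m) = real (2 * (2 * m + 1)) * real (2 * m choose m)"
  proof -
    have a: "Suc m * (2 * Suc m choose Suc m) = Suc (Suc (2 * m)) * (Suc (2 * m) choose m)"
      using Suc_times_binomial_eq[of "Suc (2 * m)" m] by (simp add: mult.commute)
    have b: "Suc m * (Suc (2 * m) choose m) = Suc (2 * m) * (2 * m choose m)"
    proof -
      have "Suc (2 * m) choose m = Suc (2 * m) choose Suc m"
        using binomial_symmetric[of m "Suc (2 * m)"] by simp
      then show ?thesis using Suc_times_binomial_eq[of "2 * m" m] by (simp add: mult.commute)
    qed
    have "Suc (Suc (2 * m)) = 2 * Suc m" by simp
    then have "Suc m * (Suc m * (2 * Suc m choose Suc m)) = Suc m * (2 * (Suc m * (Suc (2 * m) choose m)))"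
      unfolding a by (simp only: mult_ac)
    also have "\<dots> = Suc m * (2 * (2 * m + 1) * (2 * m choose m))"
      unfolding b by (simp only: mult_ac Suc_eq_plus1)
    finally have "Suc m * (Suc m * (2 * Suc m choose Suc m)) = Suc m * (2 * (2 * m + 1) * (2 * m choose m))" .
    then have "Suc m * (2 * Suc m choose Suc m) = 2 * (2 * m + 1) * (2 * m choose m)"
      by (simp only: mult_cancel1) simp
    then show ?thesis by (metis of_nat_mult)
  qed
  then have c: "real (2 * Suc m choose Suc m) = 2 * (2 * real m + 1) / (real m + 1) * real (2 * m choose m)"
    by (simp add: field_simps)
  have b0: "real (2 * m choose m) \<noteq> 0" by simp
  have d: "4 * real (Suc m) ^ 2 - 1 = (2 * real m + 1) * (2 * real m + 3)"
    by (simp add: power2_eq_square algebra_simps)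
  have e: "4 ^ Suc m / real (2 * Suc m choose Suc m)
      = (4 ^ m / real (2 * m choose m)) * (2 * (real m + 1) / (2 * real m + 1))"
  proof -
    have "4 * D / (2 * b / a * C) = D / C * (2 * a / b)" if "a \<noteq> 0" "b \<noteq> 0" "C \<noteq> 0" for a b C D :: real
      using that by (simp add: field_simps)
    from this[of "real m + 1" "2 * real m + 1" "real (2 * m choose m)" "4 ^ m"] show ?thesis
      unfolding c using b0 by simp
  qed
  have "(\<Prod>k=1..Suc m. (4 * real k ^ 2) / (4 * real k ^ 2 - 1))
      = (4 ^ m / real (2 * m choose m))\<^sup>2 / (2 * real m + 1)
        * ((4 * real (Suc m) ^ 2) / ((2 * real m + 1) * (2 * real m + 3)))"
    using Suc d by simp
  also have "\<dots> = (4 ^ Suc m / real (2 * Suc m choose Suc m))\<^sup>2 / (2 * real (Suc m) + 1)"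
  proof -
    have r: "x / (2 * real m + 1) * ((4 * real (Suc m) ^ 2) / ((2 * real m + 1) * (2 * real m + 3)))
      = x * (2 * (real m + 1) / (2 * real m + 1))\<^sup>2 / (2 * real (Suc m) + 1)" for x
      by (simp add: power2_eq_square field_simps)
    show ?thesis unfolding e power_mult_distrib by (rule r)
  qed
  finally show ?case .
qed simp

definition binomial_ratio :: "nat \<Rightarrow> real" where
  "binomial_ratio m = real (2 * m choose m) * sqrt (pi * real m) / 4 ^ m"

lemma binomial_ratio_tendsto: "binomial_ratio \<longlonglongrightarrow> 1"
proof -
  let ?P = "\<lambda>m. \<Prod>k=1..m. (4 * real k ^ 2) / (4 * real k ^ 2 - 1)"
  have "(\<lambda>m. real m / (2 * real m + 1)) \<longlonglongrightarrow> 1 / 2" by real_asymp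
  then have "(\<lambda>m. sqrt (pi * (real m / (2 * real m + 1)) / ?P m)) \<longlonglongrightarrow> sqrt (pi * (1 / 2) / (pi / 2))"
    by (intro tendsto_real_sqrt tendsto_divide[OF tendsto_mult[OF tendsto_const] wallis]) simp_all
  moreover have "sqrt (pi * (real m / (2 * real m + 1)) / ?P m) = binomial_ratio m" for m
  proof -
    have "pi * (real m / (2 * real m + 1)) / ?P m = (binomial_ratio m)\<^sup>2"
      unfolding wallis_product_central_binomial binomial_ratio_def
      by (simp add: power_mult_distrib power_divide)
    then show ?thesis by (simp add: binomial_ratio_def)
  qed
  ultimately show ?thesis by simp
qed

definition rank_scale :: "nat \<Rightarrow> real" where
  "rank_scale n = 2 powr ((real n - 1) / 2) / sqrt (pi * real n)"

text \<open>\<open>rank_scale (2 * m)\<close> equals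
  \<open>4 ^ m / (2 ^ Suc m * sqrt (pi * m))\<close>, the asymptotic value of the mean. The factor
  \<open>m / Suc m\<close> passes from the central binomial coefficient to its neighbour, and the
  subtracted term is the relative loss to defects, of order \<open>m powr (-3/2)\<close>.\<close>

lemma mean_bound_eq:
  assumes "0 < m"
  shows "mean_bound m = rank_scale (2 * m) *
    (binomial_ratio m * (real m / real (Suc m)) - 2 * sqrt (pi * real m) * real (Suc m) / real m ^ 3)"
proof -
  have "Suc m * (2 * m choose Suc m) = m * (2 * m choose m)"
  proof -
    have "2 * m - m = m" by simp
    then show ?thesis
      using binomial_absorb_comp[of "2 * m" m] binomial_absorption[of m "2 * m"] by (simp only:)
  qed
  then have "real (Suc m) * real (2 * m choose Suc m) = real m * real (2 * m choose m)"
    by (metis of_nat_mult)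
  then have b: "real (2 * m choose Suc m) = real (2 * m choose m) * (real m / real (Suc m))"
    by (simp add: field_simps)
  have s: "rank_scale (2 * m) = 4 ^ m / (2 ^ Suc m * sqrt (pi * real m))"
  proof -
    have "2 powr ((real (2 * m) - 1) / 2) = 2 powr (real m - 1 / 2)" by (simp add: diff_divide_distrib)
    also have "\<dots> = 2 ^ m / sqrt 2" by (simp add: powr_diff powr_realpow powr_half_sqrt)
    finally have "rank_scale (2 * m) = 2 ^ m / sqrt 2 / (sqrt 2 * sqrt (pi * real m))"
      unfolding rank_scale_def by (simp add: real_sqrt_mult mult.left_commute)
    also have "\<dots> = 2 ^ m / (2 * sqrt (pi * real m))" by (simp add: mult.assoc[symmetric])
    also have "\<dots> = 4 ^ m / (2 ^ Suc m * sqrt (pi * real m))"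
    proof -
      have "(4::real) ^ m = 2 ^ m * 2 ^ m" by (simp flip: power_mult_distrib)
      then show ?thesis by simp
    qed
    finally show ?thesis .
  qed
  have alg: "(C * r - 2 * (D / x ^ 4) * x * y) / q = D / (q * z) * (C * z / D * r - 2 * z * y / x ^ 3)"
    if "z \<noteq> 0" "D \<noteq> 0" "x \<noteq> 0" for C r D x y q z :: real
  proof -
    have "D / (q * z) * (C * z / D * r) = C * r / q" using that by simp
    moreover have "D / (q * z) * (2 * z * y / x ^ 3) = 2 * (D / x ^ 4) * x * y / q"
      using that by (simp add: power_numeral_reduce mult_ac)
    ultimately show ?thesis by (simp add: right_diff_distrib diff_divide_distrib)
  qed
  show ?thesis
    unfolding s mean_bound_def binomial_ratio_def b by (rule alg) (use assms in auto)
qed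

text \<open>The leading factor is the loss in the second moment method with
  \<open>\<epsilon> = 1 / m\<close>.\<close>

definition rank_ratio :: "nat \<Rightarrow> real" where
  "rank_ratio m = (1 - 2 * (1 / real m)) *
    (binomial_ratio m * (real m / real (Suc m)) - 2 * sqrt (pi * real m) * real (Suc m) / real m ^ 3)"

lemma tendsto_relative_mean:
  "(\<lambda>m. binomial_ratio m * (real m / real (Suc m)) - 2 * sqrt (pi * real m) * real (Suc m) / real m ^ 3) \<longlonglongrightarrow> 1"
proof -
  have "(\<lambda>m. real m / real (Suc m)) \<longlonglongrightarrow> 1" by real_asymp
  moreover have "(\<lambda>m. 2 * sqrt (pi * real m) * real (Suc m) / real m ^ 3) \<longlonglongrightarrow> 0" by real_asymp
  ultimately show ?thesis
    using tendsto_diff[OF tendsto_mult[OF binomial_ratio_tendsto]] by fastforce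
qed

lemma rank_ratio_tendsto: "rank_ratio \<longlonglongrightarrow> 1"
proof -
  have "(\<lambda>m. 1 - 2 * (1 / real m)) \<longlonglongrightarrow> 1" by real_asymp
  from tendsto_mult[OF this tendsto_relative_mean] show ?thesis by (simp add: rank_ratio_def[abs_def])
qed

lemma eventually_mean_bound_ge: "\<forall>\<^sub>F m in sequentially. rank_scale (2 * m) / 2 \<le> mean_bound m"
proof -
  have "\<forall>\<^sub>F m in sequentially. 1 / 2 <
      binomial_ratio m * (real m / real (Suc m)) - 2 * sqrt (pi * real m) * real (Suc m) / real m ^ 3"
    using order_tendstoD(1)[OF tendsto_relative_mean, of "1 / 2"] by simp
  then show ?thesis using eventually_gt_at_top[of 0]
  proof eventually_elim
    case (elim m)
    have "0 \<le> rank_scale (2 * m)" by (simp add: rank_scale_def)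
    from mult_left_mono[OF less_imp_le[OF elim(1)] this] show ?case
      by (simp add: mean_bound_eq[OF elim(2)])
  qed
qed

text \<open>The factor 2 accounts for faces of size \<open>m + 1\<close> and, by duality, for
  missing \<open>(m - 1)\<close>-sets. The variance term vanishes because the mean grows like
  \<open>2 ^ m / sqrt m\<close>, while \<open>\<epsilon>\<close> shrinks only like
  \<open>1 / m\<close>.\<close>

definition total_error :: "nat \<Rightarrow> real" where
  "total_error m = 2 * upper_error m + variance_error (1 / real m) (rank_scale (2 * m) / 2) (Suc m)"

lemma total_error_tendsto: "total_error \<longlonglongrightarrow> 0"
proof -
  have "(\<lambda>m. variance_error (1 / real m) (rank_scale (2 * m) / 2) (Suc m)) \<longlonglongrightarrow> 0"
    unfolding variance_error_def rank_scale_def by real_asymp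
  from tendsto_add[OF tendsto_mult[OF tendsto_const upper_error_tendsto] this, of 2]
  show ?thesis by (simp add: total_error_def[abs_def])
qed

lemma prob_uniform_complex:
  "measure_pmf.prob (uniform_complex n) A
     = real (card (simplicial_complexes n \<inter> A)) / real (card (simplicial_complexes n))"
  unfolding uniform_complex_def
  by (rule measure_pmf_of_set[OF simplicial_complexes_nonempty finite_simplicial_complexes])

lemma eventually_prob_rank_ge:
  fixes R :: "('a, 'r) ring_scheme" (structure)
  assumes R: "cring R" "\<one> \<noteq> \<zero>"
  shows "\<forall>\<^sub>F m in sequentially. 1 - total_error m
    \<le> measure_pmf.prob (uniform_complex (2 * m))
      {\<Delta>. ereal (rank_ratio m * rank_scale (2 * m)) \<le> ereal_of_enat (module_rank R (homology R \<Delta> (m - 1)))}"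
  using eventually_few_complexes_large_level eventually_mean_bound_ge eventually_ge_at_top[of 2]
proof eventually_elim
  case (elim m)
  define \<tau> where "\<tau> = 4 ^ m / real m ^ 4"
  let ?SC = "simplicial_complexes (2 * m)"
  define N where "N = real (card ?SC)"
  let ?good = "\<lambda>\<Delta>. ereal (rank_ratio m * rank_scale (2 * m)) \<le> ereal_of_enat (module_rank R (homology R \<Delta> (m - 1)))"
  let ?A = "{\<Delta>\<in>?SC. \<tau> \<le> card (level (Suc m) \<Delta>)}"
  let ?B = "{\<Delta>\<in>?SC. \<tau> \<le> card (layer (2 * m) (m - 1) - \<Delta>)}"
  let ?C = "{\<Delta>\<in>?SC. few_defects m \<tau> \<Delta> \<and> \<not> ?good \<Delta>}"
  have fin: "finite ?SC" by (rule finite_simplicial_complexes)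
  have N0: "0 < N" using fin simplicial_complexes_nonempty by (simp add: N_def card_gt_0_iff)
  have \<tau>0: "0 < \<tau>" using elim by (simp add: \<tau>_def)
  have A: "card ?A \<le> N * upper_error m" using elim(1) by (simp add: \<tau>_def N_def)
  have B: "card ?B \<le> N * upper_error m"
  proof -
    have "card ?B \<le> card {\<Delta>\<in>?SC. \<tau> \<le> card (level (2 * m - (m - 1)) \<Delta>)}"
      by (rule card_complexes_missing_layer[OF \<tau>0]) (use elim in auto)
    moreover have "2 * m - (m - 1) = Suc m" using elim by simp
    ultimately show ?thesis using A by simp
  qed
  have scale: "0 < rank_scale (2 * m)" using elim by (simp add: rank_scale_def)
  have C: "card ?C \<le> N * variance_error (1 / real m) (rank_scale (2 * m) / 2) (Suc m)"
  proof -
    have "rank_ratio m * rank_scale (2 * m) = (1 - 2 * (1 / real m)) * mean_bound m"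
      using elim by (simp add: rank_ratio_def mean_bound_eq)
    moreover have "real (card {\<Delta>\<in>?SC. few_defects m (4 ^ m / real m ^ 4) \<Delta> \<and>
        \<not> ereal ((1 - 2 * (1 / real m)) * mean_bound m) \<le> ereal_of_enat (module_rank R (homology R \<Delta> (m - 1)))})
      \<le> card ?SC * variance_error (1 / real m) (mean_bound m) (Suc m)"
      by (rule few_complexes_small_rank[OF R]) (use elim scale in auto)
    ultimately have "card ?C \<le> N * variance_error (1 / real m) (mean_bound m) (Suc m)"
      by (simp add: \<tau>_def N_def)
    also have "\<dots> \<le> N * variance_error (1 / real m) (rank_scale (2 * m) / 2) (Suc m)"
      unfolding variance_error_def using elim scale N0
      by (intro mult_left_mono add_right_mono divide_left_mono mult_pos_pos add_nonneg_nonneg) auto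
    finally show ?thesis .
  qed
  have "?SC \<subseteq> (?SC \<inter> {\<Delta>. ?good \<Delta>}) \<union> (?A \<union> (?B \<union> ?C))" by (auto simp: few_defects_def not_le)
  then have "card ?SC \<le> card ((?SC \<inter> {\<Delta>. ?good \<Delta>}) \<union> (?A \<union> (?B \<union> ?C)))"
    using fin by (intro card_mono) auto
  also have "\<dots> \<le> card (?SC \<inter> {\<Delta>. ?good \<Delta>}) + (card ?A + (card ?B + card ?C))"
    by (meson add_left_mono card_Un_le order_trans)
  finally have "N \<le> card (?SC \<inter> {\<Delta>. ?good \<Delta>}) + (card ?A + (card ?B + card ?C))"
    unfolding N_def by linarith
  then have "N * (1 - total_error m) \<le> card (?SC \<inter> {\<Delta>. ?good \<Delta>})"
    using A B C by (simp add: total_error_def algebra_simps)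
  then have "1 - total_error m \<le> card (?SC \<inter> {\<Delta>. ?good \<Delta>}) / N"
    using N0 by (simp add: pos_le_divide_eq mult.commute)
  then show ?case by (simp add: prob_uniform_complex N_def)
qed

theorem theorem8:
  fixes R :: "('a, 'r) ring_scheme" (structure)
  assumes "cring R" and "\<one> \<noteq> \<zero>"
  shows "\<exists>\<delta> :: nat \<Rightarrow> real. \<delta> \<longlonglongrightarrow> 0 \<and>
    ((\<lambda>n. measure_pmf.prob (uniform_complex n)
        {\<Delta>. ereal ((1 - \<delta> n) * (2 powr ((real n - 1) / 2) / sqrt (pi * real n)))
              \<le> ereal_of_enat (module_rank R (homology R \<Delta> (n div 2 - 1)))})
      \<longlongrightarrow> 1) (inf sequentially (principal {n. even n}))"
proof (intro exI conjI)
  \<comment> \<open>\<open>rank_ratio\<close> does not involve \<open>R\<close>, so the same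
    \<open>\<delta>\<close> serves all rings; rounding \<open>n div 2\<close> extends it to odd
    \<open>n\<close>, where it must tend to zero as well.\<close>
  define \<delta> where "\<delta> n = 1 - rank_ratio (n div 2)" for n
  have half: "filterlim (\<lambda>n::nat. n div 2) sequentially sequentially"
    by (rule filterlim_at_top_div_const_nat) simp
  show "\<delta> \<longlonglongrightarrow> 0"
    using tendsto_diff[OF tendsto_const filterlim_compose[OF rank_ratio_tendsto half], of 1]
    by (simp add: \<delta>_def[abs_def])
  let ?p = "\<lambda>n. measure_pmf.prob (uniform_complex n)
        {\<Delta>. ereal ((1 - \<delta> n) * (2 powr ((real n - 1) / 2) / sqrt (pi * real n)))
              \<le> ereal_of_enat (module_rank R (homology R \<Delta> (n div 2 - 1)))}"
  let ?F = "inf sequentially (principal {n::nat. even n})"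
  have "\<forall>\<^sub>F n in sequentially. even n \<longrightarrow> 1 - total_error (n div 2) \<le> ?p n"
    using eventually_compose_filterlim[OF eventually_prob_rank_ge[OF assms] half]
  proof eventually_elim
    case (elim n)
    show ?case
    proof
      assume "even n"
      then have "2 * (n div 2) = n" by simp
      then show "1 - total_error (n div 2) \<le> ?p n"
        using elim by (simp add: \<delta>_def rank_scale_def)
    qed
  qed
  then have lower: "\<forall>\<^sub>F n in ?F. 1 - total_error (n div 2) \<le> ?p n"
    by (simp add: eventually_inf_principal)
  have "(\<lambda>n. 1 - total_error (n div 2)) \<longlonglongrightarrow> 1"
    using tendsto_diff[OF tendsto_const filterlim_compose[OF total_error_tendsto half], of 1] by simp
  then have lim: "((\<lambda>n. 1 - total_error (n div 2)) \<longlongrightarrow> 1) ?F"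
    by (rule tendsto_mono[OF inf_le1])
  show "(?p \<longlongrightarrow> 1) ?F"
    by (rule tendsto_sandwich[OF lower _ lim tendsto_const]) simp
qed

end
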